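(* Let $(N,J,k,\omega)$ be a compact Kähler manifold (complex structure $J$, Kähler metric $k$, Kähler form $\omega$), and let $\{e^1(t),e^2(t),e^3(t)\}_{t\in[0,1]}$ be an admissible family of coframes on $\mathbb{T}^3$ with coefficients $a_1,b_2,b_3$ and $l=b_2^2+b_3^2$ (as defined in the context). Suppose that there exist (i) a diffeomorphism $\rho$ of $\mathbb{T}^3$ such that $\rho^*\big(e^i(1)_{\rho(\underline{x})}\big)=e^i(0)_{\underline{x}}$ for all $\underline{x}\in\mathbb{T}^3$ and $i=1,2,3$, and such that the function $t\mapsto \big(\tfrac{1}{l(t)}\big)'\cdot\tfrac{1}{a_1(t)}$ is a nonzero constant on $[0,1]$; (ii) a diffeomorphism $\psi$ of $N$ preserving the Kähler structure, i.e. $\psi$ is holomorphic with respect to $J$ and $\psi^*\omega=\omega$. Then the mapping torus $M_f$ of $M=\mathbb{T}^3\times N$ by the diffeomorphism $f(\underline{x},p)=(\rho(\underline{x}),\psi(p))$ admits a split generalized Kähler structure $(I_\pm,g,\omega_\pm)$.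
   Context: Mapping torus: for a diffeomorphism $f$ of a manifold $M$, $M_f=\dfrac{M\times[0,1]}{(x,0)\sim(f(x),1)}$; equivalently the quotient of $M\times\mathbb{R}$ by the $\mathbb{Z}$-action $n\cdot(x,t)=(f^n(x),t+n)$. Generalized Kähler structure on a $2n$-dimensional manifold: a triple $(g,I_+,I_-)$, where $g$ is a Riemannian metric and $I_\pm$ are two (integrable) complex structures, each compatible with $g$, such that the fundamental forms $\omega_\pm$ of $(g,I_\pm)$ satisfy $d^c_+\omega_+=-d^c_-\omega_-=H$ with $H$ a closed $3$-form. Here $d^c_\pm=I_\pm^{-1}\,d\,I_\pm$ is the real Dolbeault operator of $I_\pm$ ($I_\pm$ acting on forms by evaluating on $I_\pm X_1,\dots,I_\pm X_r$). The structure is split if $[I_+,I_-]=0$ and non-split otherwise. Admissible family of coframes on $\mathbb{T}^3$: let $\mathbb{T}^3=\Gamma_0\backslash\mathbb{R}^3$, where $\Gamma_0\cong\mathbb{Z}^3$ is a lattice in $\mathbb{R}^3$, with local coordinates $(x^1,x^2,x^3)$ induced by the standard coordinates of $\mathbb{R}^3$. Let $a_1,b_2,b_3:[0,1]\to\mathbb{R}$ be smooth functions such that for every $t$ the vector fields $$e_1(t)=a_1(t)\tfrac{\partial}{\partial x^1},\quad e_2(t)=b_2(t)\tfrac{\partial}{\partial x^2}+b_3(t)\tfrac{\partial}{\partial x^3},\quad e_3(t)=-b_3(t)\tfrac{\partial}{\partial x^2}+b_2(t)\tfrac{\partial}{\partial x^3}$$ form a frame of $\mathbb{T}^3$. Put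 $l=b_2^2+b_3^2>0$, $v=b_2b_2'+b_3b_3'=\tfrac12 l'$, $w=b_2b_3'-b_3b_2'$, and require $$\frac{v(1)}{l(1)}=\frac{v(0)}{l(0)},\qquad \frac{w(1)}{l(1)}=\frac{w(0)}{l(0)}.$$ The dual coframe is $$e^1(t)=\tfrac{1}{a_1(t)}dx^1,\quad e^2(t)=\tfrac{b_2(t)}{l(t)}dx^2+\tfrac{b_3(t)}{l(t)}dx^3,\quad e^3(t)=-\tfrac{b_3(t)}{l(t)}dx^2+\tfrac{b_2(t)}{l(t)}dx^3 .$$ *)

theory Defs
  imports "HOL-Analysis.Analysis"
begin

section \<open>Smooth functions\<close>

text \<open>
  \<open>C_on k S f\<close>: \<open>f\<close> is of class \<open>C^k\<close> on \<open>S\<close>. Since derivatives are taken within \<open>S\<close>, this is the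
  usual notion for open \<open>S\<close>, and for a compact interval it uses one-sided derivatives at the end
  points. These are the only two kinds of sets it is applied to.
\<close>

primrec C_on :: "nat \<Rightarrow> 'a::real_normed_vector set \<Rightarrow> ('a \<Rightarrow> 'b::real_normed_vector) \<Rightarrow> bool" where
  "C_on 0 S f \<longleftrightarrow> continuous_on S f"
| "C_on (Suc k) S f \<longleftrightarrow> (\<forall>x\<in>S. f differentiable (at x within S)) \<and>
     (\<forall>v. C_on k S (\<lambda>x. frechet_derivative f (at x within S) v))"

definition smooth_on :: "'a::real_normed_vector set \<Rightarrow> ('a \<Rightarrow> 'b::real_normed_vector) \<Rightarrow> bool" where
  "smooth_on S f \<longleftrightarrow> (\<forall>k. C_on k S f)"


section \<open>Smooth manifolds and smooth maps\<close>

text \<open>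
  A manifold modelled on the Euclidean space \<open>'e\<close> has as underlying set the topspace of an abstract
  topology on \<open>'a\<close>. A chart \<open>(U, \<phi>)\<close> consists of its domain and the coordinate map; the values of
  \<open>\<phi>\<close> outside \<open>U\<close> are irrelevant. The atlas need not be maximal.
\<close>

type_synonym ('a, 'e) chart = "'a set \<times> ('a \<Rightarrow> 'e)"

record ('a, 'e) manifold =
  mtop :: "'a topology"
  atlas :: "('a, 'e) chart set"

definition is_chart :: "'a topology \<Rightarrow> ('a, 'e::euclidean_space) chart \<Rightarrow> bool" where
  "is_chart X c \<longleftrightarrow> (case c of (U, \<phi>) \<Rightarrow>
     openin X U \<and> open (\<phi> ` U) \<and>
     homeomorphic_map (subtopology X U) (top_of_set (\<phi> ` U)) \<phi>)"

definition local_rep :: "('a, 'e) chart \<Rightarrow> ('a \<Rightarrow> 'b) \<Rightarrow> ('b, 'f) chart \<Rightarrow> 'e \<Rightarrow> 'f" where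
  "local_rep c F d = snd d \<circ> F \<circ> inv_into (fst c) (snd c)"

definition smooth_between :: "('a, 'e::euclidean_space) chart \<Rightarrow> ('a \<Rightarrow> 'b) \<Rightarrow>
    ('b, 'f::euclidean_space) chart \<Rightarrow> bool" where
  "smooth_between c F d \<longleftrightarrow> smooth_on (snd c ` {p \<in> fst c. F p \<in> fst d}) (local_rep c F d)"

definition smooth_manifold :: "('a, 'e::euclidean_space) manifold \<Rightarrow> bool" where
  "smooth_manifold M \<longleftrightarrow>
     Hausdorff_space (mtop M) \<and> second_countable (mtop M) \<and>
     (\<forall>c\<in>atlas M. is_chart (mtop M) c) \<and>
     (\<Union>c\<in>atlas M. fst c) = topspace (mtop M) \<and>
     (\<forall>c\<in>atlas M. \<forall>d\<in>atlas M. smooth_between c (\<lambda>p. p) d)"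

text \<open>The charts of the maximal atlas.\<close>

definition compatible_chart :: "('a, 'e::euclidean_space) manifold \<Rightarrow> ('a, 'e) chart \<Rightarrow> bool" where
  "compatible_chart M d \<longleftrightarrow> is_chart (mtop M) d \<and>
     (\<forall>c\<in>atlas M. smooth_between c (\<lambda>p. p) d \<and> smooth_between d (\<lambda>p. p) c)"

definition smooth_map :: "('a, 'e::euclidean_space) manifold \<Rightarrow> ('b, 'f::euclidean_space) manifold \<Rightarrow>
    ('a \<Rightarrow> 'b) \<Rightarrow> bool" where
  "smooth_map M M' F \<longleftrightarrow> continuous_map (mtop M) (mtop M') F \<and>
     (\<forall>c\<in>atlas M. \<forall>d\<in>atlas M'. smooth_between c F d)"

definition diffeomorphism :: "('a, 'e::euclidean_space) manifold \<Rightarrow> ('b, 'f::euclidean_space) manifold \<Rightarrow>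
    ('a \<Rightarrow> 'b) \<Rightarrow> bool" where
  "diffeomorphism M M' F \<longleftrightarrow> bij_betw F (topspace (mtop M)) (topspace (mtop M')) \<and>
     smooth_map M M' F \<and> smooth_map M' M (inv_into (topspace (mtop M)) F)"

definition euclidean_manifold :: "('e::euclidean_space, 'e) manifold" where
  "euclidean_manifold = \<lparr>mtop = euclidean, atlas = {(UNIV, \<lambda>x. x)}\<rparr>"

definition product_manifold :: "('a, 'e) manifold \<Rightarrow> ('b, 'f) manifold \<Rightarrow>
    ('a \<times> 'b, 'e \<times> 'f) manifold" where
  "product_manifold M M' = \<lparr>mtop = prod_topology (mtop M) (mtop M'),
     atlas = {(U \<times> V, map_prod \<phi> \<psi>) | U \<phi> V \<psi>. (U, \<phi>) \<in> atlas M \<and> (V, \<psi>) \<in> atlas M'}\<rparr>"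


section \<open>Quotients by group actions, tori and mapping tori\<close>

definition orbit :: "('a \<Rightarrow> 'a) set \<Rightarrow> 'a \<Rightarrow> 'a set" where
  "orbit G p = {h p | h. h \<in> G}"

definition quotient_topology :: "'a topology \<Rightarrow> ('a \<Rightarrow> 'b) \<Rightarrow> 'b topology" where
  "quotient_topology X q =
     topology (\<lambda>V. V \<subseteq> q ` topspace X \<and> openin X {x \<in> topspace X. q x \<in> V})"

lemma openin_quotient_topology:
  "openin (quotient_topology X q) V \<longleftrightarrow>
     V \<subseteq> q ` topspace X \<and> openin X {x \<in> topspace X. q x \<in> V}"
proof -
  have "istopology (\<lambda>V. V \<subseteq> q ` topspace X \<and> openin X {x \<in> topspace X. q x \<in> V})"
    unfolding istopology_def
  proof (intro conjI allI impI)
    fix S T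
    assume "S \<subseteq> q ` topspace X \<and> openin X {x \<in> topspace X. q x \<in> S}"
      and "T \<subseteq> q ` topspace X \<and> openin X {x \<in> topspace X. q x \<in> T}"
    moreover have "{x \<in> topspace X. q x \<in> S \<inter> T} =
        {x \<in> topspace X. q x \<in> S} \<inter> {x \<in> topspace X. q x \<in> T}"
      by auto
    ultimately show "S \<inter> T \<subseteq> q ` topspace X" "openin X {x \<in> topspace X. q x \<in> S \<inter> T}"
      by auto
  next
    fix K
    assume K: "\<forall>V\<in>K. V \<subseteq> q ` topspace X \<and> openin X {x \<in> topspace X. q x \<in> V}"
    show "\<Union>K \<subseteq> q ` topspace X"
      using K by blast
    have "{x \<in> topspace X. q x \<in> \<Union>K} = \<Union>((\<lambda>V. {x \<in> topspace X. q x \<in> V}) ` K)"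
      by auto
    then show "openin X {x \<in> topspace X. q x \<in> \<Union>K}"
      using K by (metis (no_types, lifting) image_iff openin_Union)
  qed
  then show ?thesis
    by (simp add: quotient_topology_def)
qed

text \<open>
  The quotient of \<open>M\<close> by a group \<open>G\<close> of transformations acting freely and properly discontinuously.
  The points are the orbits, and a chart \<open>(U, \<phi>)\<close> of \<open>M\<close> induces local coordinates on the image of
  each open \<open>W \<subseteq> U\<close> on which the projection is injective, namely \<open>\<phi>\<close> composed with the inverse of
  the projection restricted to \<open>W\<close>.
\<close>

definition quotient_manifold :: "('a, 'e) manifold \<Rightarrow> ('a \<Rightarrow> 'a) set \<Rightarrow> ('a set, 'e) manifold" where
  "quotient_manifold M G = \<lparr>mtop = quotient_topology (mtop M) (orbit G),
     atlas = {(orbit G ` W, \<phi> \<circ> inv_into W (orbit G)) | W U \<phi>.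
       (U, \<phi>) \<in> atlas M \<and> openin (mtop M) W \<and> W \<subseteq> U \<and> inj_on (orbit G) W}\<rparr>"

definition is_lattice :: "(real^'n) set \<Rightarrow> bool" where
  "is_lattice \<Gamma> \<longleftrightarrow> (\<exists>B :: real^'n^'n. invertible B \<and> \<Gamma> = {B *v z | z. \<forall>i. z $ i \<in> \<int>})"

definition torus :: "(real^3) set \<Rightarrow> ((real^3) set, real^3) manifold" where
  "torus \<Gamma> = quotient_manifold euclidean_manifold {(\<lambda>x. x + \<gamma>) | \<gamma>. \<gamma> \<in> \<Gamma>}"

definition int_iterate :: "'a set \<Rightarrow> ('a \<Rightarrow> 'a) \<Rightarrow> int \<Rightarrow> 'a \<Rightarrow> 'a" where
  "int_iterate A f n = (if 0 \<le> n then f ^^ nat n else inv_into A f ^^ nat (- n))"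

text \<open>The quotient of \<open>M \<times> \<real>\<close> by the action \<open>n \<cdot> (x, t) = (f^n x, t + n)\<close> of the integers.\<close>

definition mapping_torus :: "('a, 'e) manifold \<Rightarrow> ('a \<Rightarrow> 'a) \<Rightarrow> (('a \<times> real) set, 'e \<times> real) manifold" where
  "mapping_torus M f = quotient_manifold (product_manifold M euclidean_manifold)
     {(\<lambda>(x, t). (int_iterate (topspace (mtop M)) f n x, t + of_int n)) | n :: int. True}"


section \<open>Tensor fields\<close>

text \<open>
  A tensor field is given by its components in the charts of the atlas, which have to obey the
  transformation law. For a chart \<open>c\<close> and a point \<open>x\<close> of the coordinate domain, tangent vectors are
  identified via \<open>c\<close> with elements of the model space. A \<open>k\<close>-covariant tensor is evaluated on lists
  of \<open>k\<close> vectors; its values on lists of other lengths are irrelevant, and so are the components at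
  points outside the coordinate domain.
\<close>

type_synonym ('a, 'e) covariant_field = "('a, 'e) chart \<Rightarrow> 'e \<Rightarrow> 'e list \<Rightarrow> real"
type_synonym ('a, 'e) endomorphism_field = "('a, 'e) chart \<Rightarrow> 'e \<Rightarrow> 'e \<Rightarrow> 'e"

text \<open>\<open>F\<^sup>* \<alpha> = \<beta>\<close> for \<open>k\<close>-covariant tensor fields; for the identity map this is the transformation law.\<close>

definition pullback_eq :: "('a, 'e::euclidean_space) manifold \<Rightarrow> ('b, 'f::euclidean_space) manifold \<Rightarrow>
    ('a \<Rightarrow> 'b) \<Rightarrow> nat \<Rightarrow> ('b, 'f) covariant_field \<Rightarrow> ('a, 'e) covariant_field \<Rightarrow> bool" where
  "pullback_eq M M' F k \<alpha> \<beta> \<longleftrightarrow>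
     (\<forall>c\<in>atlas M. \<forall>d\<in>atlas M'. \<forall>p\<in>fst c. F p \<in> fst d \<longrightarrow>
       (\<forall>vs. length vs = k \<longrightarrow>
         \<alpha> d (snd d (F p)) (map (frechet_derivative (local_rep c F d) (at (snd c p))) vs) =
         \<beta> c (snd c p) vs))"

text \<open>\<open>dF \<circ> I = I' \<circ> dF\<close>; for the identity map this is the transformation law.\<close>

definition intertwines :: "('a, 'e::euclidean_space) manifold \<Rightarrow> ('b, 'f::euclidean_space) manifold \<Rightarrow>
    ('a \<Rightarrow> 'b) \<Rightarrow> ('a, 'e) endomorphism_field \<Rightarrow> ('b, 'f) endomorphism_field \<Rightarrow> bool" where
  "intertwines M M' F I I' \<longleftrightarrow>
     (\<forall>c\<in>atlas M. \<forall>d\<in>atlas M'. \<forall>p\<in>fst c. F p \<in> fst d \<longrightarrow>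
       (\<forall>v. frechet_derivative (local_rep c F d) (at (snd c p)) (I c (snd c p) v) =
         I' d (snd d (F p)) (frechet_derivative (local_rep c F d) (at (snd c p)) v)))"

definition multilinear :: "nat \<Rightarrow> ('e::real_vector list \<Rightarrow> real) \<Rightarrow> bool" where
  "multilinear k T \<longleftrightarrow> (\<forall>vs i. length vs = k \<longrightarrow> i < k \<longrightarrow> linear (\<lambda>u. T (vs[i := u])))"

definition covariant_tensor :: "('a, 'e::euclidean_space) manifold \<Rightarrow> nat \<Rightarrow>
    ('a, 'e) covariant_field \<Rightarrow> bool" where
  "covariant_tensor M k T \<longleftrightarrow>
     (\<forall>c\<in>atlas M. (\<forall>x\<in>snd c ` fst c. multilinear k (T c x)) \<and>
        (\<forall>vs. length vs = k \<longrightarrow> smooth_on (snd c ` fst c) (\<lambda>x. T c x vs))) \<and>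
     pullback_eq M M (\<lambda>p. p) k T T"

definition differential_form :: "('a, 'e::euclidean_space) manifold \<Rightarrow> nat \<Rightarrow>
    ('a, 'e) covariant_field \<Rightarrow> bool" where
  "differential_form M k \<alpha> \<longleftrightarrow> covariant_tensor M k \<alpha> \<and>
     (\<forall>c\<in>atlas M. \<forall>x\<in>snd c ` fst c. \<forall>vs i j.
        length vs = k \<longrightarrow> i < j \<longrightarrow> j < k \<longrightarrow> vs ! i = vs ! j \<longrightarrow> \<alpha> c x vs = 0)"

definition field_eq :: "('a, 'e) manifold \<Rightarrow> nat \<Rightarrow> ('a, 'e) covariant_field \<Rightarrow>
    ('a, 'e) covariant_field \<Rightarrow> bool" where
  "field_eq M k \<alpha> \<beta> \<longleftrightarrow>
     (\<forall>c\<in>atlas M. \<forall>x\<in>snd c ` fst c. \<forall>vs. length vs = k \<longrightarrow> \<alpha> c x vs = \<beta> c x vs)"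

text \<open>
  \<open>d\<alpha>(v\<^sub>0, \<dots>, v\<^sub>k) = \<Sum>\<^sub>i (-1)^i \<partial>\<^sub>v\<^sub>i \<alpha>(v\<^sub>0, \<dots>, v\<^sub>i\<^sub>-\<^sub>1, v\<^sub>i\<^sub>+\<^sub>1, \<dots>, v\<^sub>k)\<close>, the invariant formula for \<open>d\<close> on
  vector fields that are constant in the given chart.
\<close>

definition ext_deriv :: "('a, 'e::euclidean_space) covariant_field \<Rightarrow> ('a, 'e) covariant_field" where
  "ext_deriv \<alpha> = (\<lambda>c x vs. \<Sum>i<length vs. (-1) ^ i *
     frechet_derivative (\<lambda>y. \<alpha> c y (take i vs @ drop (Suc i) vs)) (at x) (vs ! i))"

definition closed_form :: "('a, 'e::euclidean_space) manifold \<Rightarrow> nat \<Rightarrow>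
    ('a, 'e) covariant_field \<Rightarrow> bool" where
  "closed_form M k \<alpha> \<longleftrightarrow> differential_form M k \<alpha> \<and>
     field_eq M (Suc k) (ext_deriv \<alpha>) (\<lambda>c x vs. 0)"

definition endomorphism_tensor :: "('a, 'e::euclidean_space) manifold \<Rightarrow>
    ('a, 'e) endomorphism_field \<Rightarrow> bool" where
  "endomorphism_tensor M I \<longleftrightarrow>
     (\<forall>c\<in>atlas M. (\<forall>x\<in>snd c ` fst c. linear (I c x)) \<and>
        (\<forall>v. smooth_on (snd c ` fst c) (\<lambda>x. I c x v))) \<and>
     intertwines M M (\<lambda>p. p) I I"


section \<open>Hermitian, Kaehler and generalized Kaehler structures\<close>

definition almost_complex_structure :: "('a, 'e::euclidean_space) manifold \<Rightarrow>
    ('a, 'e) endomorphism_field \<Rightarrow> bool" where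
  "almost_complex_structure M I \<longleftrightarrow> endomorphism_tensor M I \<and>
     (\<forall>c\<in>atlas M. \<forall>x\<in>snd c ` fst c. \<forall>v. I c x (I c x v) = - v)"

text \<open>
  Integrability: near each point there are holomorphic coordinates, i.e. a chart \<open>d\<close> of the maximal
  atlas whose differential is complex linear from \<open>(T\<^sub>qM, I\<^sub>q)\<close> to a fixed complex vector space
  \<open>('e, j)\<close>. The equation forces \<open>j \<circ> j = -1\<close>.
\<close>

definition complex_structure :: "('a, 'e::euclidean_space) manifold \<Rightarrow>
    ('a, 'e) endomorphism_field \<Rightarrow> bool" where
  "complex_structure M I \<longleftrightarrow> almost_complex_structure M I \<and>
     (\<forall>p\<in>topspace (mtop M). \<exists>d j. compatible_chart M d \<and> p \<in> fst d \<and> linear j \<and>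
        (\<forall>c\<in>atlas M. \<forall>q\<in>fst c \<inter> fst d. \<forall>v.
           frechet_derivative (local_rep c (\<lambda>p. p) d) (at (snd c q)) (I c (snd c q) v) =
           j (frechet_derivative (local_rep c (\<lambda>p. p) d) (at (snd c q)) v)))"

definition riemannian_metric :: "('a, 'e::euclidean_space) manifold \<Rightarrow>
    ('a, 'e) covariant_field \<Rightarrow> bool" where
  "riemannian_metric M g \<longleftrightarrow> covariant_tensor M 2 g \<and>
     (\<forall>c\<in>atlas M. \<forall>x\<in>snd c ` fst c.
        (\<forall>u v. g c x [u, v] = g c x [v, u]) \<and> (\<forall>u. u \<noteq> 0 \<longrightarrow> 0 < g c x [u, u]))"

definition compatible_metric :: "('a, 'e) manifold \<Rightarrow> ('a, 'e) covariant_field \<Rightarrow>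
    ('a, 'e) endomorphism_field \<Rightarrow> bool" where
  "compatible_metric M g I \<longleftrightarrow>
     (\<forall>c\<in>atlas M. \<forall>x\<in>snd c ` fst c. \<forall>u v. g c x [I c x u, I c x v] = g c x [u, v])"

definition fundamental_form :: "('a, 'e) covariant_field \<Rightarrow> ('a, 'e) endomorphism_field \<Rightarrow>
    ('a, 'e) covariant_field" where
  "fundamental_form g I = (\<lambda>c x vs. g c x [I c x (vs ! 0), vs ! 1])"

definition kaehler :: "('a, 'e::euclidean_space) manifold \<Rightarrow> ('a, 'e) endomorphism_field \<Rightarrow>
    ('a, 'e) covariant_field \<Rightarrow> ('a, 'e) covariant_field \<Rightarrow> bool" where
  "kaehler N J k \<omega> \<longleftrightarrow> smooth_manifold N \<and> complex_structure N J \<and> riemannian_metric N k \<and>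
     compatible_metric N k J \<and> field_eq N 2 \<omega> (fundamental_form k J) \<and> closed_form N 2 \<omega>"

definition act_on_form :: "('a, 'e) endomorphism_field \<Rightarrow> ('a, 'e) covariant_field \<Rightarrow>
    ('a, 'e) covariant_field" where
  "act_on_form I \<alpha> = (\<lambda>c x vs. \<alpha> c x (map (I c x) vs))"

definition dc :: "('a, 'e::euclidean_space) endomorphism_field \<Rightarrow> ('a, 'e) covariant_field \<Rightarrow>
    ('a, 'e) covariant_field" where
  "dc I \<alpha> = act_on_form (\<lambda>c x. inv (I c x)) (ext_deriv (act_on_form I \<alpha>))"

definition generalized_kaehler :: "('a, 'e::euclidean_space) manifold \<Rightarrow> ('a, 'e) covariant_field \<Rightarrow>
    ('a, 'e) endomorphism_field \<Rightarrow> ('a, 'e) endomorphism_field \<Rightarrow> bool" where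
  "generalized_kaehler M g I\<^sub>p I\<^sub>m \<longleftrightarrow> smooth_manifold M \<and> riemannian_metric M g \<and>
     complex_structure M I\<^sub>p \<and> complex_structure M I\<^sub>m \<and>
     compatible_metric M g I\<^sub>p \<and> compatible_metric M g I\<^sub>m \<and>
     (\<exists>H. closed_form M 3 H \<and>
        field_eq M 3 (dc I\<^sub>p (fundamental_form g I\<^sub>p)) H \<and>
        field_eq M 3 (\<lambda>c x vs. - dc I\<^sub>m (fundamental_form g I\<^sub>m) c x vs) H)"

definition split_structure :: "('a, 'e) manifold \<Rightarrow> ('a, 'e) endomorphism_field \<Rightarrow>
    ('a, 'e) endomorphism_field \<Rightarrow> bool" where
  "split_structure M I\<^sub>p I\<^sub>m \<longleftrightarrow>
     (\<forall>c\<in>atlas M. \<forall>x\<in>snd c ` fst c. \<forall>v. I\<^sub>p c x (I\<^sub>m c x v) = I\<^sub>m c x (I\<^sub>p c x v))"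


section \<open>Admissible families of coframes on the three-torus\<close>

text \<open>
  The charts of \<^term>\<open>torus \<Gamma>\<close> are exactly the local coordinates induced by the standard coordinates
  of \<open>\<real>^3\<close>, so the frames and coframes have the same components in every chart and at every
  point of the torus.
\<close>

definition frame :: "(real \<Rightarrow> real) \<Rightarrow> (real \<Rightarrow> real) \<Rightarrow> (real \<Rightarrow> real) \<Rightarrow> real \<Rightarrow> 3 \<Rightarrow> real^3" where
  "frame a1 b2 b3 t i =
     (if i = 1 then vector [a1 t, 0, 0]
      else if i = 2 then vector [0, b2 t, b3 t]
      else vector [0, - b3 t, b2 t])"

definition l_fun :: "(real \<Rightarrow> real) \<Rightarrow> (real \<Rightarrow> real) \<Rightarrow> real \<Rightarrow> real" where
  "l_fun b2 b3 t = (b2 t)\<^sup>2 + (b3 t)\<^sup>2"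

abbreviation deriv01 :: "(real \<Rightarrow> real) \<Rightarrow> real \<Rightarrow> real" where
  "deriv01 h t \<equiv> vector_derivative h (at t within {0..1})"

definition v_fun :: "(real \<Rightarrow> real) \<Rightarrow> (real \<Rightarrow> real) \<Rightarrow> real \<Rightarrow> real" where
  "v_fun b2 b3 t = b2 t * deriv01 b2 t + b3 t * deriv01 b3 t"

definition w_fun :: "(real \<Rightarrow> real) \<Rightarrow> (real \<Rightarrow> real) \<Rightarrow> real \<Rightarrow> real" where
  "w_fun b2 b3 t = b2 t * deriv01 b3 t - b3 t * deriv01 b2 t"

definition admissible :: "(real \<Rightarrow> real) \<Rightarrow> (real \<Rightarrow> real) \<Rightarrow> (real \<Rightarrow> real) \<Rightarrow> bool" where
  "admissible a1 b2 b3 \<longleftrightarrow>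
     smooth_on {0..1} a1 \<and> smooth_on {0..1} b2 \<and> smooth_on {0..1} b3 \<and>
     (\<forall>t\<in>{0..1}. inj (frame a1 b2 b3 t) \<and> independent (range (frame a1 b2 b3 t))) \<and>
     v_fun b2 b3 1 / l_fun b2 b3 1 = v_fun b2 b3 0 / l_fun b2 b3 0 \<and>
     w_fun b2 b3 1 / l_fun b2 b3 1 = w_fun b2 b3 0 / l_fun b2 b3 0"

definition coframe :: "(real \<Rightarrow> real) \<Rightarrow> (real \<Rightarrow> real) \<Rightarrow> (real \<Rightarrow> real) \<Rightarrow> real \<Rightarrow> 3 \<Rightarrow>
    ((real^3) set, real^3) covariant_field" where
  "coframe a1 b2 b3 t i = (\<lambda>c x vs. let u = vs ! 0; l = l_fun b2 b3 t in
     if i = 1 then 1 / a1 t * u $ 1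
     else if i = 2 then b2 t / l * u $ 2 + b3 t / l * u $ 3
     else - (b3 t / l) * u $ 2 + b2 t / l * u $ 3)"

end

theory Submission
  imports Defs
begin

text \<open>
  Only the derivative of \<open>\<rho>\<close> matters: the coframe equations force it to be a constant matrix \<open>P\<close>, which
  scales \<open>x\<^sup>1\<close> by \<open>e\<^sup>\<mu> = a\<^sub>1(1)/a\<^sub>1(0)\<close> and acts on the \<open>(x\<^sup>2, x\<^sup>3)\<close>-plane conformally with determinant
  \<open>e\<^sup>-\<^sup>\<mu>\<close>; the hypothesis on \<open>(1/l)'/a\<^sub>1\<close> gives \<open>\<mu> \<noteq> 0\<close>. The given coefficients need not extend smoothly
  across the gluing, so they are replaced by exponentials with the same monodromy: on \<open>\<T>\<^sup>3 \<times> N \<times> \<real>\<close> put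
  \<open>g = e\<^sup>-\<^sup>2\<^sup>\<mu>\<^sup>t (dx\<^sup>1)\<^sup>2 + \<mu>\<^sup>2 dt\<^sup>2 + e\<^sup>\<mu>\<^sup>t ((dx\<^sup>2)\<^sup>2 + (dx\<^sup>3)\<^sup>2) + k\<close> and let \<open>I\<^sub>\<plusminus>\<close> be \<open>J\<close> on \<open>N\<close>, the rotation
  \<open>\<partial>\<^sub>2 \<mapsto> \<partial>\<^sub>3\<close>, and plus or minus the complex structure of the \<open>(x\<^sup>1, e\<^sup>\<mu>\<^sup>t)\<close>-plane. Then
  \<open>d\<^sup>c\<^sub>\<plusminus> \<omega>\<^sub>\<plusminus> = \<mp> dx\<^sup>1 \<and> dx\<^sup>2 \<and> dx\<^sup>3\<close>, and all these tensors are invariant under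
  \<open>(x, p, t) \<mapsto> (\<rho> x, \<psi> p, t + 1)\<close>, hence descend to the mapping torus.
\<close>

section \<open>Calculus of smooth functions\<close>

text \<open>The construction is dictated by the coordinate s = e^(\<mu> t). It turns the shift t ->
  t + 1 into multiplication by e^\<mu>, which is also what \<rho> does to x1; so on the half plane
  of (x1, s) both the hyperbolic metric and the standard complex structure are invariant under this
  common dilation. On the (x2, x3)-plane the map scales squared lengths by e^(-\<mu>), which the
  weight s compensates. That s is a coordinate at all is the condition \<mu> \<noteq> 0. The weight
  is linear in s for the sake of the torsion: the half plane part of the fundamental form is a top
  form in two variables and the part on N is closed, so only s dx2 dx3 contributes, with
  differential ds dx2 dx3. The complex structure carries ds to a multiple of dx1 and preserves dx2
  dx3, leaving a constant form, which is closed and, as the determinant of d\<rho> is 1, invariant.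
  Reversing the complex structure on the half plane alone reverses the sign of this form and keeps
  the two structures commuting.\<close>

lemma frechet_derivative_within_cong:
  assumes "\<And>x. x \<in> S \<Longrightarrow> f x = g x" "x \<in> S"
  shows "frechet_derivative f (at x within S) = frechet_derivative g (at x within S)"
proof -
  \<comment> \<open>\<open>frechet_derivative\<close> is a choice among all derivatives, so equality
    follows once both functions have the same derivatives; nothing need be known about existence or
    uniqueness.\<close>
  have "(f has_derivative D) (at x within S) \<longleftrightarrow> (g has_derivative D) (at x within S)" for D
    using assms has_derivative_transform[of x S] by metis
  then show ?thesis
    unfolding frechet_derivative_def by simp
qed

lemma C_on_cong:
  assumes "\<And>x. x \<in> S \<Longrightarrow> f x = g x"
  shows "C_on k S f \<longleftrightarrow> C_on k S g"
  using assms
proof (induction k arbitrary: f g)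
  case 0
  then show ?case
    using continuous_on_cong by auto
next
  case (Suc k)
  have "f differentiable (at x within S) \<longleftrightarrow> g differentiable (at x within S)" if "x \<in> S" for x
    using Suc.prems that has_derivative_transform[of x S] unfolding differentiable_def by metis
  moreover have "C_on k S (\<lambda>x. frechet_derivative f (at x within S) v) \<longleftrightarrow>
      C_on k S (\<lambda>x. frechet_derivative g (at x within S) v)" for v
    by (rule Suc.IH) (simp add: frechet_derivative_within_cong[OF Suc.prems])
  ultimately show ?case
    by simp
qed

declare C_on.simps(2) [simp del]

text \<open>On an open set the derivative within the set is the ordinary one. This recursion takes
  the place of the defining equation, which stays in use only for functions on the closed
  interval.\<close>

lemma C_on_Suc_open:
  assumes "open S"
  shows "C_on (Suc k) S f \<longleftrightarrow> (\<forall>x\<in>S. f differentiable (at x)) \<and>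
    (\<forall>v. C_on k S (\<lambda>x. frechet_derivative f (at x) v))"
proof -
  have "C_on k S (\<lambda>x. frechet_derivative f (at x within S) v) \<longleftrightarrow>
      C_on k S (\<lambda>x. frechet_derivative f (at x) v)" for v
    by (rule C_on_cong) (simp add: at_within_open[OF _ assms])
  then show ?thesis
    by (simp add: C_on.simps(2) at_within_open[OF _ assms])
qed

text \<open>The form in which closure properties are proved by induction: an explicit formula for
  the derivative is given, and that formula is of class \<open>C^k\<close> by the induction
  hypothesis.\<close>

lemma C_on_Suc_has_derivative:
  assumes "open S" "\<And>x. x \<in> S \<Longrightarrow> (f has_derivative f' x) (at x)" "\<And>v. C_on k S (\<lambda>x. f' x v)"
  shows "C_on (Suc k) S f"
proof -
  have "C_on k S (\<lambda>x. frechet_derivative f (at x) v)" for v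
    using assms(3)[of v] by (rule C_on_cong[THEN iffD1, rotated])
      (simp add: frechet_derivative_at[OF assms(2)])
  then show ?thesis
    using assms(2) by (auto simp: C_on_Suc_open[OF assms(1)] differentiable_def)
qed

lemma C_on_subset:
  assumes "open S" "open T" "T \<subseteq> S" "C_on k S f"
  shows "C_on k T f"
  using assms(4)
proof (induction k arbitrary: f)
  case 0
  then show ?case
    using assms(3) continuous_on_subset by auto
next
  case (Suc k)
  then show ?case
    using assms by (auto simp: C_on_Suc_open)
qed

text \<open>On open sets differentiability and the value of \<open>frechet_derivative\<close> depend
  only on a neighbourhood. This is needed because maps between manifolds can be factored through a
  chart only locally.\<close>

lemma C_on_local:
  assumes "open S" "\<And>x. x \<in> S \<Longrightarrow> \<exists>T. open T \<and> x \<in> T \<and> T \<subseteq> S \<and> C_on k T f"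
  shows "C_on k S f"
  using assms(2)
proof (induction k arbitrary: f)
  case 0
  have "isCont f x" if "x \<in> S" for x
    using 0[OF that] by (auto simp: continuous_on_eq_continuous_at)
  then show ?case
    by (simp add: continuous_at_imp_continuous_on)
next
  case (Suc k)
  have "f differentiable (at x)" if "x \<in> S" for x
    using Suc.prems[OF that] by (auto simp: C_on_Suc_open)
  moreover have "C_on k S (\<lambda>x. frechet_derivative f (at x) v)" for v
  proof (rule Suc.IH)
    fix x assume "x \<in> S"
    from Suc.prems[OF this] obtain T where "open T" "x \<in> T" "T \<subseteq> S" "C_on (Suc k) T f"
      by auto
    then show "\<exists>T. open T \<and> x \<in> T \<and> T \<subseteq> S \<and> C_on k T (\<lambda>x. frechet_derivative f (at x) v)"
      by (auto simp: C_on_Suc_open)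
  qed
  ultimately show ?case
    by (simp add: C_on_Suc_open[OF assms(1)])
qed

text \<open>Product and chain rule produce terms in which the original function occurs
  undifferentiated; in the induction these are known to be of class \<open>Suc k\<close> but are
  needed in class \<open>k\<close>.\<close>

lemma C_on_lower:
  assumes "open S" "C_on (Suc k) S f"
  shows "C_on k S f"
  using assms(2)
proof (induction k arbitrary: f)
  case 0
  then have "isCont f x" if "x \<in> S" for x
    using that by (auto simp: C_on_Suc_open[OF assms(1)] differentiable_imp_continuous_within
       )
  then show ?case
    by (simp add: continuous_at_imp_continuous_on)
next
  case (Suc k)
  have "C_on k S (\<lambda>x. frechet_derivative f (at x) v)" for v
    using Suc.prems by (intro Suc.IH) (simp add: C_on_Suc_open[OF assms(1), of "Suc k"])
  then show ?case
    using Suc.prems unfolding C_on_Suc_open[OF assms(1)] by simp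
qed

lemma C_on_const: "open S \<Longrightarrow> C_on k S (\<lambda>x. c)"
proof (induction k arbitrary: c)
  case 0
  then show ?case by simp
next
  case (Suc k)
  then show ?case
    by (intro C_on_Suc_has_derivative[where f' = "\<lambda>x v. 0"]) auto
qed

lemma C_on_bounded_linear:
  assumes "open S" "bounded_linear f"
  shows "C_on k S f"
proof (cases k)
  case 0
  then show ?thesis
    by (simp add: assms(2) linear_continuous_on)
next
  case (Suc k')
  then show ?thesis
    using C_on_Suc_has_derivative[of S f "\<lambda>_. f"]
      assms C_on_const[of S] bounded_linear_imp_has_derivative by blast
qed

lemma C_on_add:
  assumes "open S" "C_on k S f" "C_on k S g"
  shows "C_on k S (\<lambda>x. f x + g x)"
  using assms(2,3)
proof (induction k arbitrary: f g)
  case 0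
  then show ?case
    by (simp add: continuous_on_add)
next
  case (Suc k)
  show ?case
  proof (rule C_on_Suc_has_derivative[OF assms(1)])
    show "((\<lambda>x. f x + g x) has_derivative (\<lambda>v. frechet_derivative f (at x) v + frechet_derivative g (at x) v)) (at x)"
      if "x \<in> S" for x
      using Suc.prems that
      by (intro has_derivative_add) (auto simp: C_on_Suc_open[OF assms(1)] frechet_derivative_works)
    show "C_on k S (\<lambda>x. frechet_derivative f (at x) v + frechet_derivative g (at x) v)" for v
      using Suc.prems by (intro Suc.IH) (auto simp: C_on_Suc_open[OF assms(1)])
  qed
qed

lemma C_on_bilinear:
  assumes "bounded_bilinear P" "open S" "C_on k S f" "C_on k S g"
  shows "C_on k S (\<lambda>x. P (f x) (g x))"
  using assms(3,4)
proof (induction k arbitrary: f g)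
  case 0
  then show ?case
    using bounded_bilinear.continuous_on[OF assms(1)] by simp
next
  case (Suc k)
  have low: "C_on k S f" "C_on k S g"
    using Suc.prems C_on_lower[OF assms(2)] by blast+
  show ?case
  proof (rule C_on_Suc_has_derivative[OF assms(2)])
    show "((\<lambda>x. P (f x) (g x)) has_derivative
        (\<lambda>v. P (f x) (frechet_derivative g (at x) v) + P (frechet_derivative f (at x) v) (g x))) (at x)"
      if "x \<in> S" for x
      using Suc.prems that
      by (intro bounded_bilinear.FDERIV[OF assms(1)])
        (auto simp: C_on_Suc_open[OF assms(2)] frechet_derivative_works)
    show "C_on k S (\<lambda>x. P (f x) (frechet_derivative g (at x) v) + P (frechet_derivative f (at x) v) (g x))" for v
      using Suc.prems low by (intro C_on_add Suc.IH assms(2))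
        (auto simp: C_on_Suc_open[OF assms(2)])
  qed
qed

lemma C_on_sum:
  assumes "open S" "\<And>i. i \<in> A \<Longrightarrow> C_on k S (f i)"
  shows "C_on k S (\<lambda>x. \<Sum>i\<in>A. f i x)"
  using assms(2)
proof (induction A rule: infinite_finite_induct)
  case (insert i A)
  then show ?case
    by (simp add: C_on_add[OF assms(1)])
qed (simp_all add: C_on_const[OF assms(1)])

lemma C_on_linear_compose:
  assumes "open S" "bounded_linear L" "C_on k S f"
  shows "C_on k S (\<lambda>x. L (f x))"
  using assms(3)
proof (induction k arbitrary: f)
  case 0
  then show ?case
    using bounded_linear.continuous_on[OF assms(2)] by simp
next
  case (Suc k)
  then show ?case
    by (intro C_on_Suc_has_derivative[OF assms(1), where f' = "\<lambda>x v. L (frechet_derivative f (at x) v)"]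
        bounded_linear.has_derivative[OF assms(2)])
      (auto simp: C_on_Suc_open[OF assms(1)] frechet_derivative_works)
qed

text \<open>In the derivative \<open>g' (f x) (f' x v)\<close> the point enters twice. Expanding the
  inner vector in an orthonormal basis separates the two: the result is a sum of products of a
  scalar coefficient with \<open>g' (f x) b\<close>, and the latter is again a composition, to which
  the induction hypothesis applies.\<close>

lemma C_on_compose:
  fixes f :: "'a::real_normed_vector \<Rightarrow> 'b::euclidean_space" and g :: "'b \<Rightarrow> 'c::real_normed_vector"
  assumes "open S" "open T" "f ` S \<subseteq> T" "C_on k S f" "C_on k T g"
  shows "C_on k S (\<lambda>x. g (f x))"
  using assms(4,5)
proof (induction k arbitrary: g)
  case 0
  then show ?case
    using assms(3) by (auto intro: continuous_on_compose2)
next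
  case (Suc k)
  have low: "C_on k S f"
    using Suc.prems C_on_lower[OF assms(1)] by blast
  let ?g' = "\<lambda>y. frechet_derivative g (at y)" and ?f' = "\<lambda>x. frechet_derivative f (at x)"
  have g': "(g has_derivative ?g' (f x)) (at (f x))" if "x \<in> S" for x
    using Suc.prems(2) assms(3) that
    by (auto simp: C_on_Suc_open[OF assms(2)] frechet_derivative_works)
  have f': "(f has_derivative ?f' x) (at x)" if "x \<in> S" for x
    using Suc.prems(1) that
    by (auto simp: C_on_Suc_open[OF assms(1)] frechet_derivative_works)
  have eq: "?g' (f x) u = (\<Sum>b\<in>Basis. (u \<bullet> b) *\<^sub>R ?g' (f x) b)" if "x \<in> S" for x u
  proof -
    have "linear (?g' (f x))"
      using g'[OF that] has_derivative_linear by blast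
    then have "?g' (f x) (\<Sum>b\<in>Basis. (u \<bullet> b) *\<^sub>R b) = (\<Sum>b\<in>Basis. (u \<bullet> b) *\<^sub>R ?g' (f x) b)"
      by (simp add: linear_sum linear_scale del: euclidean_representation)
    then show ?thesis
      by (simp only: euclidean_representation)
  qed
  show ?case
  proof (rule C_on_Suc_has_derivative[OF assms(1)])
    show "((\<lambda>x. g (f x)) has_derivative (\<lambda>v. \<Sum>b\<in>Basis. (?f' x v \<bullet> b) *\<^sub>R ?g' (f x) b)) (at x)"
      if "x \<in> S" for x
      by (rule has_derivative_eq_rhs[OF diff_chain_at[OF f'[OF that] g'[OF that], unfolded o_def]])
        (rule ext, rule eq[OF that])
    show "C_on k S (\<lambda>x. \<Sum>b\<in>Basis. (?f' x v \<bullet> b) *\<^sub>R ?g' (f x) b)" for v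
    proof (intro C_on_sum assms(1) C_on_bilinear[OF bounded_bilinear_scaleR])
      show "C_on k S (\<lambda>x. ?f' x v \<bullet> b)" for b
        using Suc.prems(1)
        by (intro C_on_linear_compose[OF assms(1) bounded_linear_inner_left])
          (auto simp: C_on_Suc_open[OF assms(1)])
      show "C_on k S (\<lambda>x. ?g' (f x) b)" for b
        using Suc.prems(2) by (intro Suc.IH low)
          (auto simp: C_on_Suc_open[OF assms(2)])
    qed
  qed
qed

section \<open>The exponential, the reciprocal and the logarithm\<close>

lemma C_on_exp: "C_on k UNIV (\<lambda>t::real. exp (c * t))"
proof (induction k)
  case 0
  then show ?case
    by (auto intro!: continuous_intros)
next
  case (Suc k)
  have "C_on k UNIV (\<lambda>t. (c * v) * exp (c * t))" for v
    by (rule C_on_linear_compose[OF _ bounded_linear_mult_right Suc]) auto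
  moreover have "((\<lambda>t. exp (c * t)) has_derivative (\<lambda>v. (c * v) * exp (c * t))) (at t)" for t
    by (auto intro!: derivative_eq_intros)
  ultimately show ?case
    by (intro C_on_Suc_has_derivative[where f' = "\<lambda>t v. (c * v) * exp (c * t)"]) auto
qed

lemma C_on_inverse: "C_on k {0<..} (inverse :: real \<Rightarrow> real)"
proof (induction k)
  case 0
  then show ?case
    by (auto intro!: continuous_intros)
next
  case (Suc k)
  have "C_on k {0<..} (\<lambda>t. (- v) * (inverse t * inverse t))" for v :: real
    by (rule C_on_linear_compose[OF _ bounded_linear_mult_right
          C_on_bilinear[OF bounded_bilinear_mult _ Suc Suc]]) auto
  moreover have "(inverse has_derivative (\<lambda>v. (- v) * (inverse t * inverse t))) (at t)" if "0 < t" for t :: real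
    using that by (auto intro!: derivative_eq_intros ext)
  ultimately show ?case
    by (intro C_on_Suc_has_derivative[where f' = "\<lambda>t v. (- v) * (inverse t * inverse t)"]) auto
qed

lemma C_on_ln: "C_on k {0<..} (ln :: real \<Rightarrow> real)"
proof (cases k)
  case 0
  then show ?thesis
    by (auto intro!: continuous_intros)
next
  case (Suc k')
  have "C_on k' {0<..} (\<lambda>t. v * inverse t)" for v :: real
    by (rule C_on_linear_compose[OF _ bounded_linear_mult_right C_on_inverse]) auto
  moreover have "(ln has_derivative (\<lambda>v. v * inverse t)) (at t)" if "0 < t" for t :: real
    using that by (auto intro!: derivative_eq_intros simp: field_simps)
  ultimately show ?thesis
    unfolding Suc by (intro C_on_Suc_has_derivative[where f' = "\<lambda>t v. v * inverse t"]) auto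
qed

section \<open>Closure properties of smooth functions\<close>

lemma smooth_on_cong:
  assumes "\<And>x. x \<in> S \<Longrightarrow> f x = g x"
  shows "smooth_on S f \<longleftrightarrow> smooth_on S g"
  using C_on_cong[of S f g, OF assms] by (simp add: smooth_on_def)

lemma smooth_on_subset: "open S \<Longrightarrow> open T \<Longrightarrow> T \<subseteq> S \<Longrightarrow> smooth_on S f \<Longrightarrow> smooth_on T f"
  by (simp add: smooth_on_def C_on_subset[of S T])

lemma smooth_on_local:
  assumes "open S" "\<And>x. x \<in> S \<Longrightarrow> \<exists>T. open T \<and> x \<in> T \<and> T \<subseteq> S \<and> smooth_on T f"
  shows "smooth_on S f"
  unfolding smooth_on_def
proof
  fix k
  show "C_on k S f"
    using assms(2) by (intro C_on_local[OF assms(1)]) (fastforce simp: smooth_on_def)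
qed

lemma smooth_on_differentiable: "open S \<Longrightarrow> smooth_on S f \<Longrightarrow> x \<in> S \<Longrightarrow> f differentiable (at x)"
  using C_on_Suc_open[of S 0 f] by (simp add: smooth_on_def)

lemma smooth_on_const: "open S \<Longrightarrow> smooth_on S (\<lambda>x. c)"
  by (simp add: smooth_on_def C_on_const)

lemma smooth_on_bounded_linear: "open S \<Longrightarrow> bounded_linear f \<Longrightarrow> smooth_on S f"
  by (simp add: smooth_on_def C_on_bounded_linear)

lemma smooth_on_add: "open S \<Longrightarrow> smooth_on S f \<Longrightarrow> smooth_on S g \<Longrightarrow> smooth_on S (\<lambda>x. f x + g x)"
  by (simp add: smooth_on_def C_on_add)

lemma smooth_on_mult:
  fixes f g :: "'a::real_normed_vector \<Rightarrow> real"
  shows "open S \<Longrightarrow> smooth_on S f \<Longrightarrow> smooth_on S g \<Longrightarrow> smooth_on S (\<lambda>x. f x * g x)"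
  by (simp add: smooth_on_def C_on_bilinear[OF bounded_bilinear_mult])

lemma smooth_on_scaleR:
  "open S \<Longrightarrow> smooth_on S f \<Longrightarrow> smooth_on S g \<Longrightarrow> smooth_on S (\<lambda>x. f x *\<^sub>R g x)"
  by (simp add: smooth_on_def C_on_bilinear[OF bounded_bilinear_scaleR])

lemma smooth_on_linear_compose:
  "open S \<Longrightarrow> bounded_linear L \<Longrightarrow> smooth_on S f \<Longrightarrow> smooth_on S (\<lambda>x. L (f x))"
  by (simp add: smooth_on_def C_on_linear_compose)

lemma smooth_on_Pair:
  assumes "open S" "smooth_on S f" "smooth_on S g"
  shows "smooth_on S (\<lambda>x. (f x, g x))"
proof -
  have "smooth_on S (\<lambda>x. (f x, 0) + (0, g x))"
    using assms by (intro smooth_on_add smooth_on_linear_compose[where L = "\<lambda>u. (u, 0)"]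
        smooth_on_linear_compose[where L = "\<lambda>u. (0, u)"])
      (auto intro: bounded_linear_Pair bounded_linear_ident bounded_linear_zero)
  then show ?thesis
    by simp
qed

lemma smooth_on_compose:
  fixes f :: "'a::real_normed_vector \<Rightarrow> 'b::euclidean_space" and g :: "'b \<Rightarrow> 'c::real_normed_vector"
  assumes "open S" "open T" "f ` S \<subseteq> T" "smooth_on S f" "smooth_on T g"
  shows "smooth_on S (\<lambda>x. g (f x))"
  using assms(4,5) by (simp add: smooth_on_def C_on_compose[OF assms(1-3)])

lemma smooth_on_map_prod:
  fixes f :: "'a::euclidean_space \<Rightarrow> 'c::real_normed_vector" and g :: "'b::euclidean_space \<Rightarrow> 'd::real_normed_vector"
  assumes "open S" "open T" "smooth_on S f" "smooth_on T g"
  shows "smooth_on (S \<times> T) (map_prod f g)"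
proof -
  have "smooth_on (S \<times> T) (\<lambda>z. f (fst z))" "smooth_on (S \<times> T) (\<lambda>z. g (snd z))"
    by (rule smooth_on_compose[of _ S] smooth_on_compose[of _ T];
        auto simp: assms open_Times intro!: smooth_on_bounded_linear bounded_linear_fst bounded_linear_snd)+
  then have "smooth_on (S \<times> T) (\<lambda>z. (f (fst z), g (snd z)))"
    by (intro smooth_on_Pair open_Times assms)
  moreover have "map_prod f g = (\<lambda>z. (f (fst z), g (snd z)))"
    by auto
  ultimately show ?thesis
    by metis
qed

lemma smooth_on_ident: "open S \<Longrightarrow> smooth_on S (\<lambda>x. x)"
  by (simp add: smooth_on_bounded_linear bounded_linear_ident)

section \<open>Charts and smooth maps\<close>

text \<open>Being a homeomorphism onto the image is spelled out as openness of images and preimages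
  in the ambient topology. Product and quotient charts are verified in this form, without handling
  subspace topologies again.\<close>

lemma is_chart_iff:
  "is_chart X c \<longleftrightarrow> openin X (fst c) \<and> inj_on (snd c) (fst c) \<and>
     (\<forall>V. openin X V \<and> V \<subseteq> fst c \<longrightarrow> open (snd c ` V)) \<and>
     (\<forall>B. open B \<longrightarrow> openin X {p \<in> fst c. snd c p \<in> B})"
proof (cases c)
  case (Pair U \<phi>)
  show ?thesis
  proof
    assume "is_chart X c"
    then have U: "openin X U" and opn: "open (\<phi> ` U)"
      and hom: "homeomorphic_map (subtopology X U) (top_of_set (\<phi> ` U)) \<phi>"
      by (auto simp: is_chart_def Pair)
    have top: "topspace (subtopology X U) = U"
      using openin_subset[OF U] by auto
    have "inj_on \<phi> U"
      using homeomorphic_imp_injective_map[OF hom] top by simp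
    moreover have "open (\<phi> ` V)" if "openin X V" "V \<subseteq> U" for V
    proof -
      have "openin (subtopology X U) V"
        using that U openin_open_subtopology by blast
      then have "openin (top_of_set (\<phi> ` U)) (\<phi> ` V)"
        using homeomorphic_imp_open_map[OF hom] by (simp add: open_map_def)
      then show ?thesis
        using opn openin_open_trans by blast
    qed
    moreover have "openin X {p \<in> U. \<phi> p \<in> B}" if "open B" for B
    proof -
      have "openin (top_of_set (\<phi> ` U)) (\<phi> ` U \<inter> B)"
        using that by (simp add: openin_open_Int)
      then have "openin (subtopology X U) {p \<in> topspace (subtopology X U). \<phi> p \<in> \<phi> ` U \<inter> B}"
        using homeomorphic_imp_continuous_map[OF hom] openin_continuous_map_preimage by blast
      moreover have "{p \<in> topspace (subtopology X U). \<phi> p \<in> \<phi> ` U \<inter> B} = {p \<in> U. \<phi> p \<in> B}"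
        unfolding top by auto
      ultimately show ?thesis
        using U openin_open_subtopology by metis
    qed
    ultimately show "openin X (fst c) \<and> inj_on (snd c) (fst c) \<and>
     (\<forall>V. openin X V \<and> V \<subseteq> fst c \<longrightarrow> open (snd c ` V)) \<and>
     (\<forall>B. open B \<longrightarrow> openin X {p \<in> fst c. snd c p \<in> B})"
      using U by (simp add: Pair)
  next
    assume *: "openin X (fst c) \<and> inj_on (snd c) (fst c) \<and>
     (\<forall>V. openin X V \<and> V \<subseteq> fst c \<longrightarrow> open (snd c ` V)) \<and>
     (\<forall>B. open B \<longrightarrow> openin X {p \<in> fst c. snd c p \<in> B})"
    then have U: "openin X U" and inj: "inj_on \<phi> U" and opn: "\<And>V. openin X V \<Longrightarrow> V \<subseteq> U \<Longrightarrow> open (\<phi> ` V)"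
      and pre: "\<And>B. open B \<Longrightarrow> openin X {p \<in> U. \<phi> p \<in> B}"
      by (auto simp: Pair)
    have top: "topspace (subtopology X U) = U"
      using openin_subset[OF U] by auto
    have "homeomorphic_map (subtopology X U) (top_of_set (\<phi> ` U)) \<phi>"
    proof (rule bijective_open_imp_homeomorphic_map)
      show "continuous_map (subtopology X U) (top_of_set (\<phi> ` U)) \<phi>"
      proof (rule continuous_map_into_subtopology)
        have "openin (subtopology X U) {x \<in> U. \<phi> x \<in> B}" if "open B" for B
          using openin_open_subtopology[OF U] pre[OF that] by blast
        then show "continuous_map (subtopology X U) euclidean \<phi>"
          unfolding continuous_map_def top by simp
      qed (simp add: top)
      show "open_map (subtopology X U) (top_of_set (\<phi> ` U)) \<phi>"
        unfolding open_map_def using openin_open_subtopology[OF U] opn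
        by (metis image_mono open_openin open_subset)
    qed (use inj top in auto)
    then show "is_chart X c"
      using U opn[OF U] by (simp add: is_chart_def Pair)
  qed
qed

lemma is_chart_open: "is_chart X c \<Longrightarrow> openin X (fst c)"
  and is_chart_inj: "is_chart X c \<Longrightarrow> inj_on (snd c) (fst c)"
  and is_chart_open_image: "is_chart X c \<Longrightarrow> openin X V \<Longrightarrow> V \<subseteq> fst c \<Longrightarrow> open (snd c ` V)"
  and is_chart_open_preimage: "is_chart X c \<Longrightarrow> open B \<Longrightarrow> openin X {p \<in> fst c. snd c p \<in> B}"
  by (simp_all add: is_chart_iff)

lemma is_chart_subset: "is_chart X c \<Longrightarrow> fst c \<subseteq> topspace X"
  using is_chart_open openin_subset by blast

lemma openin_chart_overlap:
  assumes "is_chart X c" "continuous_map X Y F" "openin Y V"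
  shows "openin X {p \<in> fst c. F p \<in> V}"
proof -
  have "{p \<in> fst c. F p \<in> V} = fst c \<inter> {p \<in> topspace X. F p \<in> V}"
    using is_chart_subset[OF assms(1)] by auto
  then show ?thesis
    using openin_Int[OF is_chart_open[OF assms(1)] openin_continuous_map_preimage[OF assms(2,3)]] by simp
qed

lemma open_chart_overlap:
  assumes "is_chart X c" "continuous_map X Y F" "openin Y V"
  shows "open (snd c ` {p \<in> fst c. F p \<in> V})"
  using is_chart_open_image[OF assms(1) openin_chart_overlap[OF assms]] by blast

lemma local_rep_apply: "is_chart X c \<Longrightarrow> p \<in> fst c \<Longrightarrow> local_rep c F d (snd c p) = snd d (F p)"
  using inv_into_f_f[OF is_chart_inj, of X c p] by (simp add: local_rep_def)

lemma frechet_derivative_cong_open: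
  assumes "open S" "x \<in> S" and eq: "\<And>y. y \<in> S \<Longrightarrow> f y = g y"
  shows "frechet_derivative f (at x) = frechet_derivative g (at x)"
  using frechet_derivative_within_cong[OF eq assms(2)] unfolding at_within_open[OF assms(2,1)] .

abbreviation "chart_deriv c F d p \<equiv> frechet_derivative (local_rep c F d) (at (snd c p))"

lemma frechet_derivative_local_rep_cong:
  assumes "is_chart X c" "openin X V" "V \<subseteq> fst c" "p \<in> V" "\<And>q. q \<in> V \<Longrightarrow> F q = G q"
  shows "chart_deriv c F d p = chart_deriv c G d p"
proof (rule frechet_derivative_cong_open)
  show "open (snd c ` V)"
    using assms is_chart_open_image by blast
qed (use assms(3-5) in \<open>auto simp: local_rep_apply[OF assms(1)]\<close>)

lemma smooth_between_cong:
  assumes "is_chart X c" "\<And>p. p \<in> fst c \<Longrightarrow> F p = G p"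
  shows "smooth_between c F d \<longleftrightarrow> smooth_between c G d"
proof -
  have "{p \<in> fst c. F p \<in> fst d} = {p \<in> fst c. G p \<in> fst d}"
    using assms(2) by auto
  then show ?thesis
    unfolding smooth_between_def
    by (auto intro!: smooth_on_cong simp: local_rep_apply[OF assms(1)] assms(2))
qed

lemma smooth_between_differentiable:
  assumes "smooth_between c F d" "is_chart X c" "is_chart Y d" "continuous_map X Y F"
    "p \<in> fst c" "F p \<in> fst d"
  shows "local_rep c F d differentiable (at (snd c p))"
  using smooth_on_differentiable[OF open_chart_overlap[OF assms(2,4) is_chart_open[OF assms(3)]]] assms
  unfolding smooth_between_def by blast

lemma frechet_derivative_local_rep_comp:
  assumes "is_chart X c" "is_chart Y e" "is_chart Z d" "continuous_map X Y F" "continuous_map Y Z G"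
    "smooth_between c F e" "smooth_between e G d"
    "p \<in> fst c" "F p \<in> fst e" "G (F p) \<in> fst d"
  shows "chart_deriv c (\<lambda>p. G (F p)) d p v =
    chart_deriv e G d (F p)
      (chart_deriv c F e p v)"
proof -
  have "chart_deriv c (\<lambda>p. G (F p)) d p =
      frechet_derivative (local_rep e G d \<circ> local_rep c F e) (at (snd c p))"
    by (rule frechet_derivative_cong_open[OF open_chart_overlap[OF assms(1,4) is_chart_open[OF assms(2)]]])
      (use assms in \<open>auto simp: local_rep_apply[OF assms(1)] local_rep_apply[OF assms(2)]\<close>)
  also have "\<dots> = frechet_derivative (local_rep e G d) (at (local_rep c F e (snd c p))) \<circ>
      chart_deriv c F e p"
    using assms smooth_between_differentiable[OF assms(6,1,2,4)] smooth_between_differentiable[OF assms(7,2,3,5)]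
    by (intro frechet_derivative_compose) (auto simp: local_rep_apply[OF assms(1)])
  finally show ?thesis
    using assms by (simp add: local_rep_apply[OF assms(1)])
qed

lemma smooth_manifold_chart: "smooth_manifold M \<Longrightarrow> c \<in> atlas M \<Longrightarrow> is_chart (mtop M) c"
  and smooth_manifold_cover: "smooth_manifold M \<Longrightarrow> p \<in> topspace (mtop M) \<Longrightarrow> \<exists>c\<in>atlas M. p \<in> fst c"
  and smooth_manifold_transition:
    "smooth_manifold M \<Longrightarrow> c \<in> atlas M \<Longrightarrow> d \<in> atlas M \<Longrightarrow> smooth_between c (\<lambda>p. p) d"
  by (auto simp: smooth_manifold_def)

lemma smooth_manifold_open_image: "smooth_manifold M \<Longrightarrow> c \<in> atlas M \<Longrightarrow> open (snd c ` fst c)"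
  using is_chart_open_image is_chart_open smooth_manifold_chart by blast

lemma compatible_chart_atlas: "smooth_manifold M \<Longrightarrow> c \<in> atlas M \<Longrightarrow> compatible_chart M c"
  by (simp add: compatible_chart_def smooth_manifold_chart smooth_manifold_transition)

text \<open>Near a given point an atlas chart \<open>e\<close> of the middle manifold around its
  image can be interposed, and smoothness is local. The outer charts \<open>c\<close> and
  \<open>d\<close> need not belong to any atlas, which makes the lemma applicable to charts of the
  maximal atlas.\<close>

lemma smooth_between_trans:
  fixes M :: "('b, 'f::euclidean_space) manifold" and c :: "('a, 'e::euclidean_space) chart"
    and d :: "('c, 'g::euclidean_space) chart"
  assumes c: "is_chart X c" and d: "is_chart Y d" and M: "smooth_manifold M"
    and F: "continuous_map X (mtop M) F" and G: "continuous_map (mtop M) Y G"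
    and cF: "\<And>e. e \<in> atlas M \<Longrightarrow> smooth_between c F e"
    and Gd: "\<And>e. e \<in> atlas M \<Longrightarrow> smooth_between e G d"
  shows "smooth_between c (\<lambda>p. G (F p)) d"
  unfolding smooth_between_def
proof (rule smooth_on_local)
  have GF: "continuous_map X Y (\<lambda>p. G (F p))"
    using continuous_map_compose[OF F G] by (simp add: o_def)
  show "open (snd c ` {p \<in> fst c. G (F p) \<in> fst d})"
    by (rule open_chart_overlap[OF c GF is_chart_open[OF d]])
  fix x assume "x \<in> snd c ` {p \<in> fst c. G (F p) \<in> fst d}"
  then obtain p where p: "p \<in> fst c" "G (F p) \<in> fst d" "x = snd c p"
    by auto
  have "F p \<in> topspace (mtop M)"
    using p(1) is_chart_subset[OF c] F by (auto simp: continuous_map_def)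
  then obtain e where e: "e \<in> atlas M" "F p \<in> fst e"
    using smooth_manifold_cover[OF M] by blast
  have ech: "is_chart (mtop M) e"
    using M e(1) by (rule smooth_manifold_chart)
  define Q where "Q = {q \<in> fst e. G q \<in> fst d}"
  have Q: "openin (mtop M) Q"
    unfolding Q_def by (rule openin_chart_overlap[OF ech G is_chart_open[OF d]])
  define T where "T = snd c ` {p \<in> fst c. F p \<in> Q}"
  have T: "open T"
    unfolding T_def by (rule open_chart_overlap[OF c F Q])
  have "smooth_on T (\<lambda>z. local_rep e G d (local_rep c F e z))"
  proof (rule smooth_on_compose[OF T, where T = "snd e ` Q" and f = "local_rep c F e" and g = "local_rep e G d"])
    show "open (snd e ` Q)"
      using is_chart_open_image[OF ech Q] by (auto simp: Q_def)
    show "local_rep c F e ` T \<subseteq> snd e ` Q"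
      by (auto simp: T_def local_rep_apply[OF c])
    show "smooth_on T (local_rep c F e)"
      by (rule smooth_on_subset[OF open_chart_overlap[OF c F is_chart_open[OF ech]] T])
        (use cF[OF e(1)] in \<open>auto simp: smooth_between_def T_def Q_def\<close>)
    show "smooth_on (snd e ` Q) (local_rep e G d)"
      using Gd[OF e(1)] by (simp add: smooth_between_def Q_def)
  qed
  then have "smooth_on T (local_rep c (\<lambda>p. G (F p)) d)"
    by (rule smooth_on_cong[THEN iffD1, rotated])
      (auto simp: T_def Q_def local_rep_apply[OF c] local_rep_apply[OF ech])
  then show "\<exists>T. open T \<and> x \<in> T \<and> T \<subseteq> snd c ` {p \<in> fst c. G (F p) \<in> fst d} \<and>
      smooth_on T (local_rep c (\<lambda>p. G (F p)) d)"
    using T p e by (intro exI[of _ T]) (auto simp: T_def Q_def)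
qed

section \<open>Smooth maps between manifolds\<close>

lemma smooth_map_continuous: "smooth_map M M' F \<Longrightarrow> continuous_map (mtop M) (mtop M') F"
  and smooth_map_between: "smooth_map M M' F \<Longrightarrow> c \<in> atlas M \<Longrightarrow> d \<in> atlas M' \<Longrightarrow> smooth_between c F d"
  by (auto simp: smooth_map_def)

lemma smooth_map_image: "smooth_map M M' F \<Longrightarrow> p \<in> topspace (mtop M) \<Longrightarrow> F p \<in> topspace (mtop M')"
  by (auto simp: smooth_map_def continuous_map_def)

lemma smooth_map_chart_image:
  assumes "smooth_manifold M" "smooth_map M M' F" "c \<in> atlas M" "p \<in> fst c"
  shows "F p \<in> topspace (mtop M')"
  using is_chart_subset[OF smooth_manifold_chart[OF assms(1,3)]] assms(4) smooth_map_image[OF assms(2)] by blast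

lemma smooth_map_ident: "smooth_manifold M \<Longrightarrow> smooth_map M M (\<lambda>p. p)"
  by (simp add: smooth_map_def smooth_manifold_transition)

lemma smooth_map_compose:
  assumes "smooth_manifold M" "smooth_manifold M'" "smooth_manifold M''" "smooth_map M M' F" "smooth_map M' M'' G"
  shows "smooth_map M M'' (\<lambda>p. G (F p))"
  unfolding smooth_map_def
proof (intro conjI ballI)
  show "continuous_map (mtop M) (mtop M'') (\<lambda>p. G (F p))"
    using continuous_map_compose[OF smooth_map_continuous smooth_map_continuous, OF assms(4,5)]
    by (simp add: o_def)
  fix c d assume cd: "c \<in> atlas M" "d \<in> atlas M''"
  show "smooth_between c (\<lambda>p. G (F p)) d"
    by (rule smooth_between_trans[OF smooth_manifold_chart[OF assms(1) cd(1)]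
          smooth_manifold_chart[OF assms(3) cd(2)] assms(2) smooth_map_continuous[OF assms(4)]
          smooth_map_continuous[OF assms(5)] smooth_map_between[OF assms(4) cd(1)]
          smooth_map_between[OF assms(5) _ cd(2)]])
qed

lemma smooth_map_cong:
  assumes "smooth_manifold M" "\<And>p. p \<in> topspace (mtop M) \<Longrightarrow> F p = G p" "smooth_map M M' F"
  shows "smooth_map M M' G"
proof -
  have "smooth_between c G d" if "c \<in> atlas M" "d \<in> atlas M'" for c d
  proof -
    have c: "is_chart (mtop M) c"
      using assms(1) that(1) by (rule smooth_manifold_chart)
    have "F p = G p" if "p \<in> fst c" for p
      using that assms(2) is_chart_subset[OF c] by auto
    then show ?thesis
      using smooth_between_cong[OF c, of F G d] smooth_map_between[OF assms(3) that] by blast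
  qed
  then show ?thesis
    using continuous_map_eq[OF smooth_map_continuous[OF assms(3)] assms(2)] by (simp add: smooth_map_def)
qed

lemma frechet_derivative_smooth_map_comp:
  assumes "smooth_manifold M" "smooth_manifold M'" "smooth_manifold M''" "smooth_map M M' F" "smooth_map M' M'' G"
    "c \<in> atlas M" "e \<in> atlas M'" "d \<in> atlas M''" "p \<in> fst c" "F p \<in> fst e" "G (F p) \<in> fst d"
  shows "chart_deriv c (\<lambda>p. G (F p)) d p v =
    chart_deriv e G d (F p)
      (chart_deriv c F e p v)"
  by (rule frechet_derivative_local_rep_comp[OF smooth_manifold_chart[OF assms(1,6)]
        smooth_manifold_chart[OF assms(2,7)] smooth_manifold_chart[OF assms(3,8)]
        smooth_map_continuous[OF assms(4)] smooth_map_continuous[OF assms(5)]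
        smooth_map_between[OF assms(4,6,7)] smooth_map_between[OF assms(5,7,8)] assms(9-11)])

lemma frechet_derivative_local_rep_ident:
  assumes "is_chart X c" "p \<in> fst c" "\<And>q. q \<in> fst c \<Longrightarrow> F q = q"
  shows "chart_deriv c F c p v = v"
proof -
  have "chart_deriv c F c p = frechet_derivative (\<lambda>z. z) (at (snd c p))"
    by (rule frechet_derivative_cong_open[of "snd c ` fst c"])
      (use assms(2,3) is_chart_open_image[OF assms(1) is_chart_open[OF assms(1)]] in \<open>auto simp: local_rep_apply[OF assms(1)]\<close>)
  then show ?thesis
    by simp
qed

section \<open>Pullback and intertwining under composition and inversion\<close>

lemma pullback_eqD:
  "pullback_eq M M' F k \<alpha> \<beta> \<Longrightarrow> c \<in> atlas M \<Longrightarrow> d \<in> atlas M' \<Longrightarrow> p \<in> fst c \<Longrightarrow> F p \<in> fst d \<Longrightarrow> length vs = k \<Longrightarrow>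
    \<alpha> d (snd d (F p)) (map (chart_deriv c F d p) vs) = \<beta> c (snd c p) vs"
  unfolding pullback_eq_def by blast

lemma intertwinesD:
  "intertwines M M' F I I' \<Longrightarrow> c \<in> atlas M \<Longrightarrow> d \<in> atlas M' \<Longrightarrow> p \<in> fst c \<Longrightarrow> F p \<in> fst d \<Longrightarrow>
    chart_deriv c F d p (I c (snd c p) v) =
      I' d (snd d (F p)) (chart_deriv c F d p v)"
  unfolding intertwines_def by blast

lemma pullback_eq_compose:
  assumes "smooth_manifold M" "smooth_manifold M'" "smooth_manifold M''" "smooth_map M M' F" "smooth_map M' M'' G"
    "pullback_eq M M' F k \<beta> \<alpha>" "pullback_eq M' M'' G k \<gamma> \<beta>"
  shows "pullback_eq M M'' (\<lambda>p. G (F p)) k \<gamma> \<alpha>"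
  unfolding pullback_eq_def
proof (intro ballI allI impI)
  fix c d p and vs :: "'b list"
  assume *: "c \<in> atlas M" "d \<in> atlas M''" "p \<in> fst c" "G (F p) \<in> fst d" "length vs = k"
  have "F p \<in> topspace (mtop M')"
    by (rule smooth_map_chart_image[OF assms(1,4) *(1,3)])
  then obtain e where e: "e \<in> atlas M'" "F p \<in> fst e"
    using smooth_manifold_cover[OF assms(2)] by blast
  have "chart_deriv c (\<lambda>p. G (F p)) d p =
      chart_deriv e G d (F p) \<circ> chart_deriv c F e p"
    using frechet_derivative_smooth_map_comp[OF assms(1-5) *(1) e(1) *(2,3) e(2) *(4)] by (simp add: fun_eq_iff)
  then show "\<gamma> d (snd d (G (F p))) (map (chart_deriv c (\<lambda>p. G (F p)) d p) vs) =
      \<alpha> c (snd c p) vs"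
    using pullback_eqD[OF assms(7) e(1) *(2) e(2) *(4), of "map (chart_deriv c F e p) vs"]
      pullback_eqD[OF assms(6) *(1) e(1) *(3) e(2) *(5)] *(5)
    by simp
qed

lemma intertwines_compose:
  assumes "smooth_manifold M" "smooth_manifold M'" "smooth_manifold M''" "smooth_map M M' F" "smooth_map M' M'' G"
    "intertwines M M' F I I'" "intertwines M' M'' G I' I''"
  shows "intertwines M M'' (\<lambda>p. G (F p)) I I''"
  unfolding intertwines_def
proof (intro ballI allI impI)
  fix c d p v
  assume *: "c \<in> atlas M" "d \<in> atlas M''" "p \<in> fst c" "G (F p) \<in> fst d"
  have "F p \<in> topspace (mtop M')"
    by (rule smooth_map_chart_image[OF assms(1,4) *(1,3)])
  then obtain e where e: "e \<in> atlas M'" "F p \<in> fst e"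
    using smooth_manifold_cover[OF assms(2)] by blast
  show "chart_deriv c (\<lambda>p. G (F p)) d p (I c (snd c p) v) =
      I'' d (snd d (G (F p))) (chart_deriv c (\<lambda>p. G (F p)) d p v)"
    by (simp add: frechet_derivative_smooth_map_comp[OF assms(1-5) *(1) e(1) *(2,3) e(2) *(4)]
        intertwinesD[OF assms(6) *(1) e(1) *(3) e(2)] intertwinesD[OF assms(7) e(1) *(2) e(2) *(4)])
qed

text \<open>By the chain rule dF o dG = 1, so evaluating the hypothesis on vectors of the form dG v
  undoes dG.\<close>

lemma pullback_eq_inverse:
  assumes "smooth_manifold M" "smooth_manifold M'" "smooth_map M M' F" "smooth_map M' M G"
    "\<And>q. q \<in> topspace (mtop M') \<Longrightarrow> F (G q) = q" "pullback_eq M M' F k \<beta> \<alpha>"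
  shows "pullback_eq M' M G k \<alpha> \<beta>"
  unfolding pullback_eq_def
proof (intro ballI allI impI)
  fix d c q and vs :: "'d list"
  assume *: "d \<in> atlas M'" "c \<in> atlas M" "q \<in> fst d" "G q \<in> fst c" "length vs = k"
  let ?A = "chart_deriv c F d (G q)"
    and ?B = "chart_deriv d G c q"
  have d: "is_chart (mtop M') d"
    using assms(2) *(1) by (rule smooth_manifold_chart)
  have FG: "F (G q) = q" if "q \<in> fst d" for q
    using that assms(5) is_chart_subset[OF d] by auto
  have "?A (?B v) = v" for v
    using frechet_derivative_smooth_map_comp[OF assms(2,1,2,4,3) *(1,2,1,3,4)] FG *(3)
      frechet_derivative_local_rep_ident[OF d *(3)] by simp
  then have "map (?A \<circ> ?B) vs = vs"
    by (simp add: map_idI)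
  then show "\<alpha> c (snd c (G q)) (map ?B vs) = \<beta> d (snd d q) vs"
    using pullback_eqD[OF assms(6) *(2,1) *(4), of "map ?B vs"] FG *(3,5) by simp
qed

text \<open>Both compositions enter: dF o dG = 1 to insert dF in front of dG v, and dG o dF = 1 to
  cancel the outer factors afterwards.\<close>

lemma intertwines_inverse:
  assumes "smooth_manifold M" "smooth_manifold M'" "smooth_map M M' F" "smooth_map M' M G"
    "\<And>p. p \<in> topspace (mtop M) \<Longrightarrow> G (F p) = p"
    "\<And>q. q \<in> topspace (mtop M') \<Longrightarrow> F (G q) = q" "intertwines M M' F I I'"
  shows "intertwines M' M G I' I"
  unfolding intertwines_def
proof (intro ballI allI impI)
  fix d c q v
  assume *: "d \<in> atlas M'" "c \<in> atlas M" "q \<in> fst d" "G q \<in> fst c"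
  let ?A = "chart_deriv c F d (G q)"
    and ?B = "chart_deriv d G c q"
  have c: "is_chart (mtop M) c" and d: "is_chart (mtop M') d"
    using assms(1,2) *(1,2) by (simp_all add: smooth_manifold_chart)
  have FG: "F (G q) = q" if "q \<in> fst d" for q
    using that assms(6) is_chart_subset[OF d] by auto
  have GF: "G (F p) = p" if "p \<in> fst c" for p
    using that assms(5) is_chart_subset[OF c] by auto
  have AB: "?A (?B v) = v" for v
    using frechet_derivative_smooth_map_comp[OF assms(2,1,2,4,3) *(1,2,1,3,4)] FG *(3)
      frechet_derivative_local_rep_ident[OF d *(3)] by simp
  have BA: "?B (?A v) = v" for v
    using frechet_derivative_smooth_map_comp[OF assms(1,2,1,3,4) *(2,1,2,4)] FG GF *(3,4)
      frechet_derivative_local_rep_ident[OF c *(4)] by simp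
  have "?B (I' d (snd d q) (?A (?B v))) = ?B (?A (I c (snd c (G q)) (?B v)))"
    using intertwinesD[OF assms(7) *(2,1,4), of "?B v"] FG[OF *(3)] *(3) by simp
  then show "?B (I' d (snd d q) v) = I c (snd c (G q)) (?B v)"
    by (simp add: AB BA)
qed

text \<open>Inverses and iterates are determined only on the underlying set. Agreement there
  suffices, since derivatives are taken at points of open chart domains.\<close>

lemma pullback_eq_cong:
  assumes "smooth_manifold M" "\<And>p. p \<in> topspace (mtop M) \<Longrightarrow> F p = G p" "pullback_eq M M' F k \<beta> \<alpha>"
  shows "pullback_eq M M' G k \<beta> \<alpha>"
  unfolding pullback_eq_def
proof (intro ballI allI impI)
  fix c d p and vs :: "'b list"
  assume *: "c \<in> atlas M" "d \<in> atlas M'" "p \<in> fst c" "G p \<in> fst d" "length vs = k"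
  have c: "is_chart (mtop M) c"
    using assms(1) *(1) by (rule smooth_manifold_chart)
  have FG: "F q = G q" if "q \<in> fst c" for q
    using that assms(2) is_chart_subset[OF c] by auto
  show "\<beta> d (snd d (G p)) (map (chart_deriv c G d p) vs) = \<alpha> c (snd c p) vs"
    using pullback_eqD[OF assms(3) *(1-3) _ *(5)] FG[OF *(3)] *(4)
      frechet_derivative_local_rep_cong[OF c is_chart_open[OF c] _ *(3) FG, where d = d] by simp
qed

lemma intertwines_cong:
  assumes "smooth_manifold M" "\<And>p. p \<in> topspace (mtop M) \<Longrightarrow> F p = G p" "intertwines M M' F I I'"
  shows "intertwines M M' G I I'"
  unfolding intertwines_def
proof (intro ballI allI impI)
  fix c d p v
  assume *: "c \<in> atlas M" "d \<in> atlas M'" "p \<in> fst c" "G p \<in> fst d"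
  have c: "is_chart (mtop M) c"
    using assms(1) *(1) by (rule smooth_manifold_chart)
  have FG: "F q = G q" if "q \<in> fst c" for q
    using that assms(2) is_chart_subset[OF c] by auto
  show "chart_deriv c G d p (I c (snd c p) v) =
      I' d (snd d (G p)) (chart_deriv c G d p v)"
    using intertwinesD[OF assms(3) *(1-3)] FG[OF *(3)] *(4)
      frechet_derivative_local_rep_cong[OF c is_chart_open[OF c] _ *(3) FG, where d = d] by simp
qed

section \<open>Products\<close>

lemma second_countable_prod_topology:
  assumes "second_countable X" "second_countable Y"
  shows "second_countable (prod_topology X Y)"
proof -
  obtain A where A: "countable A" "\<And>V. V \<in> A \<Longrightarrow> openin X V"
    "\<And>U x. openin X U \<Longrightarrow> x \<in> U \<Longrightarrow> \<exists>V\<in>A. x \<in> V \<and> V \<subseteq> U"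
    using assms(1) unfolding second_countable_def by metis
  obtain B where B: "countable B" "\<And>V. V \<in> B \<Longrightarrow> openin Y V"
    "\<And>U x. openin Y U \<Longrightarrow> x \<in> U \<Longrightarrow> \<exists>V\<in>B. x \<in> V \<and> V \<subseteq> U"
    using assms(2) unfolding second_countable_def by metis
  show ?thesis
    unfolding second_countable_def
  proof (intro exI conjI allI impI ballI)
    show "countable ((\<lambda>(U, V). U \<times> V) ` (A \<times> B))"
      using A(1) B(1) by blast
    show "openin (prod_topology X Y) W" if "W \<in> (\<lambda>(U, V). U \<times> V) ` (A \<times> B)" for W
      using that A(2) B(2) by (auto simp: openin_prod_Times_iff)
    fix W z assume "openin (prod_topology X Y) W \<and> z \<in> W"
    then obtain U V where UV: "openin X U" "openin Y V" "fst z \<in> U" "snd z \<in> V" "U \<times> V \<subseteq> W"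
      unfolding openin_prod_topology_alt by (metis prod.collapse)
    then obtain U' V' where "U' \<in> A" "fst z \<in> U'" "U' \<subseteq> U" "V' \<in> B" "snd z \<in> V'" "V' \<subseteq> V"
      using A(3) B(3) by meson
    then show "\<exists>Va\<in>(\<lambda>(U, V). U \<times> V) ` (A \<times> B). z \<in> Va \<and> Va \<subseteq> W"
      using UV(5) by (intro bexI[of _ "U' \<times> V'"]) (auto simp: mem_Times_iff)
  qed
qed

section \<open>Product charts and maps between products\<close>

definition prod_chart :: "('a, 'e) chart \<Rightarrow> ('b, 'f) chart \<Rightarrow> ('a \<times> 'b, 'e \<times> 'f) chart" where
  "prod_chart c d = (fst c \<times> fst d, map_prod (snd c) (snd d))"

lemma fst_prod_chart [simp]: "fst (prod_chart c d) = fst c \<times> fst d"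
  and snd_prod_chart [simp]: "snd (prod_chart c d) = map_prod (snd c) (snd d)"
  by (simp_all add: prod_chart_def)

lemma mtop_product [simp]: "mtop (product_manifold M M') = prod_topology (mtop M) (mtop M')"
  by (simp add: product_manifold_def)

lemma atlas_product: "atlas (product_manifold M M') = {prod_chart c d | c d. c \<in> atlas M \<and> d \<in> atlas M'}"
  by (auto simp: product_manifold_def prod_chart_def)

lemma atlas_productI: "c \<in> atlas M \<Longrightarrow> d \<in> atlas M' \<Longrightarrow> prod_chart c d \<in> atlas (product_manifold M M')"
  unfolding atlas_product by blast

lemma is_chart_prod:
  fixes c :: "('a, 'e::euclidean_space) chart" and d :: "('b, 'f::euclidean_space) chart"
  assumes c: "is_chart X c" and d: "is_chart Y d"
  shows "is_chart (prod_topology X Y) (prod_chart c d)"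
  unfolding is_chart_iff
proof (intro conjI allI impI)
  show "openin (prod_topology X Y) (fst (prod_chart c d))"
    using is_chart_open[OF c] is_chart_open[OF d] by (simp add: openin_prod_Times_iff)
  show "inj_on (snd (prod_chart c d)) (fst (prod_chart c d))"
    using is_chart_inj[OF c] is_chart_inj[OF d] by (simp add: map_prod_inj_on)
  fix V assume V: "openin (prod_topology X Y) V \<and> V \<subseteq> fst (prod_chart c d)"
  show "open (snd (prod_chart c d) ` V)"
    unfolding open_prod_def
  proof
    fix z assume "z \<in> snd (prod_chart c d) ` V"
    then obtain p q where pq: "(p, q) \<in> V" "z = (snd c p, snd d q)"
      by auto
    then obtain A B where AB: "openin X A" "openin Y B" "p \<in> A" "q \<in> B" "A \<times> B \<subseteq> V"
      using V unfolding openin_prod_topology_alt by metis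
    have "A \<times> B \<subseteq> fst c \<times> fst d"
      using AB(5) V by auto
    then have "A \<subseteq> fst c" "B \<subseteq> fst d"
      using AB(3,4) by auto
    then have "open (snd c ` A)" "open (snd d ` B)"
      using is_chart_open_image[OF c] is_chart_open_image[OF d] AB by auto
    moreover have "snd c ` A \<times> snd d ` B \<subseteq> snd (prod_chart c d) ` V"
    proof (rule subsetI)
      fix y assume "y \<in> snd c ` A \<times> snd d ` B"
      then obtain a b where "a \<in> A" "b \<in> B" "y = snd (prod_chart c d) (a, b)"
        by auto
      then show "y \<in> snd (prod_chart c d) ` V"
        using AB(5) by blast
    qed
    ultimately show "\<exists>A B. open A \<and> open B \<and> z \<in> A \<times> B \<and> A \<times> B \<subseteq> snd (prod_chart c d) ` V"
      using AB(3,4) pq(2) by blast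
  qed
next
  fix B :: "('e \<times> 'f) set" assume B: "open B"
  show "openin (prod_topology X Y) {p \<in> fst (prod_chart c d). snd (prod_chart c d) p \<in> B}"
    unfolding openin_prod_topology_alt
  proof (intro allI impI)
    fix p q assume "(p, q) \<in> {p \<in> fst (prod_chart c d). snd (prod_chart c d) p \<in> B}"
    then have pq: "p \<in> fst c" "q \<in> fst d" "(snd c p, snd d q) \<in> B"
      by auto
    then obtain S T where ST: "open S" "open T" "snd c p \<in> S" "snd d q \<in> T" "S \<times> T \<subseteq> B"
      using open_prod_elim[OF B] by (metis mem_Sigma_iff)
    show "\<exists>U V. openin X U \<and> openin Y V \<and> p \<in> U \<and> q \<in> V \<and>
        U \<times> V \<subseteq> {p \<in> fst (prod_chart c d). snd (prod_chart c d) p \<in> B}"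
      by (rule exI[of _ "{p \<in> fst c. snd c p \<in> S}"], rule exI[of _ "{q \<in> fst d. snd d q \<in> T}"])
        (use is_chart_open_preimage[OF c ST(1)] is_chart_open_preimage[OF d ST(2)] ST pq in auto)
  qed
qed

text \<open>Restricted to the coordinate domain because elsewhere \<open>inv_into\<close> returns
  arbitrary values, which need not split as a pair. The domain is open, so derivatives still
  split.\<close>

lemma local_rep_prod:
  assumes "is_chart X c" "is_chart Y d" "z \<in> (snd c ` fst c) \<times> (snd d ` fst d)"
  shows "local_rep (prod_chart c d) (map_prod F G) (prod_chart c' d') z =
    map_prod (local_rep c F c') (local_rep d G d') z"
proof -
  obtain p q where pq: "p \<in> fst c" "q \<in> fst d" "z = snd (prod_chart c d) (p, q)"
    using assms(3) by auto
  have "local_rep (prod_chart c d) (map_prod F G) (prod_chart c' d') z = (snd c' (F p), snd d' (G q))"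
    unfolding pq(3) using pq(1,2) by (subst local_rep_apply[OF is_chart_prod[OF assms(1,2)]]) auto
  then show ?thesis
    using pq by (simp add: local_rep_apply[OF assms(1)] local_rep_apply[OF assms(2)])
qed

lemma smooth_between_prod:
  assumes c: "is_chart X c" and d: "is_chart Y d" and c': "is_chart X' c'" and d': "is_chart Y' d'"
    and F: "continuous_map X X' F" and G: "continuous_map Y Y' G"
    and "smooth_between c F c'" "smooth_between d G d'"
  shows "smooth_between (prod_chart c d) (map_prod F G) (prod_chart c' d')"
proof -
  let ?S = "snd c ` {p \<in> fst c. F p \<in> fst c'}" and ?T = "snd d ` {p \<in> fst d. G p \<in> fst d'}"
  have "smooth_on (?S \<times> ?T) (map_prod (local_rep c F c') (local_rep d G d'))"
    using assms(7,8) unfolding smooth_between_def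
    by (intro smooth_on_map_prod open_chart_overlap[OF c F is_chart_open[OF c']]
        open_chart_overlap[OF d G is_chart_open[OF d']])
  then have "smooth_on (?S \<times> ?T) (local_rep (prod_chart c d) (map_prod F G) (prod_chart c' d'))"
    by (rule smooth_on_cong[THEN iffD1, rotated]) (subst local_rep_prod[OF c d]; auto)
  moreover have "?S \<times> ?T = snd (prod_chart c d) `
      {p \<in> fst (prod_chart c d). map_prod F G p \<in> fst (prod_chart c' d')}"
    by (fastforce simp: image_iff)
  ultimately show ?thesis
    unfolding smooth_between_def by simp
qed

lemma frechet_derivative_local_rep_prod:
  assumes c: "is_chart X c" and d: "is_chart Y d"
    and "p \<in> fst c" "q \<in> fst d"
    and "local_rep c F c' differentiable (at (snd c p))"
    and "local_rep d G d' differentiable (at (snd d q))"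
  shows "frechet_derivative (local_rep (prod_chart c d) (map_prod F G) (prod_chart c' d')) (at (snd c p, snd d q)) =
    map_prod (chart_deriv c F c' p)
      (chart_deriv d G d' q)"
    (is "_ = map_prod ?A ?B")
proof -
  have "frechet_derivative (local_rep (prod_chart c d) (map_prod F G) (prod_chart c' d')) (at (snd c p, snd d q)) =
      frechet_derivative (map_prod (local_rep c F c') (local_rep d G d')) (at (snd c p, snd d q))"
  proof (rule frechet_derivative_cong_open)
    show "open ((snd c ` fst c) \<times> (snd d ` fst d))"
      by (intro open_Times is_chart_open_image[OF c] is_chart_open_image[OF d] is_chart_open[OF c] is_chart_open[OF d]) auto
  qed (use assms in \<open>auto simp: local_rep_prod[OF c d]\<close>)
  moreover have "(map_prod (local_rep c F c') (local_rep d G d') has_derivative map_prod ?A ?B) (at (snd c p, snd d q))"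
  proof -
    have A: "((\<lambda>z. local_rep c F c' (fst z)) has_derivative (\<lambda>v. ?A (fst v))) (at (snd c p, snd d q))"
      by (rule has_derivative_compose[OF has_derivative_fst[OF has_derivative_ident]])
        (use assms(5) in \<open>simp add: frechet_derivative_works\<close>)
    have B: "((\<lambda>z. local_rep d G d' (snd z)) has_derivative (\<lambda>v. ?B (snd v))) (at (snd c p, snd d q))"
      by (rule has_derivative_compose[OF has_derivative_snd[OF has_derivative_ident]])
        (use assms(6) in \<open>simp add: frechet_derivative_works\<close>)
    show ?thesis
      using has_derivative_Pair[OF A B] by (simp add: map_prod_def case_prod_beta')
  qed
  ultimately show ?thesis
    using frechet_derivative_at by metis
qed

section \<open>Product manifolds\<close>

lemma smooth_manifold_product:
  assumes M: "smooth_manifold M" and M': "smooth_manifold M'"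
  shows "smooth_manifold (product_manifold M M')"
  unfolding smooth_manifold_def
proof (intro conjI ballI)
  show "Hausdorff_space (mtop (product_manifold M M'))"
    using assms by (simp add: smooth_manifold_def Hausdorff_space_prod_topology)
  show "second_countable (mtop (product_manifold M M'))"
    using assms by (simp add: smooth_manifold_def second_countable_prod_topology)
  show ch: "is_chart (mtop (product_manifold M M')) c" if "c \<in> atlas (product_manifold M M')" for c
    using that by (auto simp: atlas_product intro!: is_chart_prod smooth_manifold_chart[OF M] smooth_manifold_chart[OF M'])
  show "(\<Union>c\<in>atlas (product_manifold M M'). fst c) = topspace (mtop (product_manifold M M'))"
  proof
    show "(\<Union>c\<in>atlas (product_manifold M M'). fst c) \<subseteq> topspace (mtop (product_manifold M M'))"
      using ch is_chart_subset by blast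
    show "topspace (mtop (product_manifold M M')) \<subseteq> (\<Union>c\<in>atlas (product_manifold M M'). fst c)"
    proof
      fix z assume "z \<in> topspace (mtop (product_manifold M M'))"
      then obtain c d where "c \<in> atlas M" "d \<in> atlas M'" "fst z \<in> fst c" "snd z \<in> fst d"
        using smooth_manifold_cover[OF M] smooth_manifold_cover[OF M'] by fastforce
      then show "z \<in> (\<Union>c\<in>atlas (product_manifold M M'). fst c)"
        by (intro UN_I[of "prod_chart c d"]) (auto simp: atlas_productI mem_Times_iff)
    qed
  qed
  fix c d assume "c \<in> atlas (product_manifold M M')" "d \<in> atlas (product_manifold M M')"
  then obtain c1 c2 d1 d2 where *: "c = prod_chart c1 c2" "d = prod_chart d1 d2"
      "c1 \<in> atlas M" "d1 \<in> atlas M" "c2 \<in> atlas M'" "d2 \<in> atlas M'"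
    by (auto simp: atlas_product)
  then have "smooth_between c (map_prod (\<lambda>p. p) (\<lambda>p. p)) d"
    unfolding *(1,2)
    by (intro smooth_between_prod[of "mtop M" _ "mtop M'" _ "mtop M" _ "mtop M'"]
        smooth_manifold_chart[OF M] smooth_manifold_chart[OF M']
        smooth_manifold_transition[OF M] smooth_manifold_transition[OF M']) auto
  then show "smooth_between c (\<lambda>p. p) d"
    by (simp add: map_prod_def case_prod_beta')
qed

lemma smooth_map_product:
  assumes "smooth_manifold M1" "smooth_manifold M2" "smooth_manifold M1'" "smooth_manifold M2'"
    "smooth_map M1 M1' F" "smooth_map M2 M2' G"
  shows "smooth_map (product_manifold M1 M2) (product_manifold M1' M2') (map_prod F G)"
  unfolding smooth_map_def
proof (intro conjI ballI)
  have "continuous_map (prod_topology (mtop M1) (mtop M2)) (prod_topology (mtop M1') (mtop M2'))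
      (\<lambda>z. (F (fst z), G (snd z)))"
    using continuous_map_compose[OF continuous_map_fst smooth_map_continuous[OF assms(5)]]
      continuous_map_compose[OF continuous_map_snd smooth_map_continuous[OF assms(6)]]
    by (auto simp: continuous_map_pairwise o_def)
  then show "continuous_map (mtop (product_manifold M1 M2)) (mtop (product_manifold M1' M2')) (map_prod F G)"
    by (simp add: map_prod_def case_prod_beta')
  fix c d assume "c \<in> atlas (product_manifold M1 M2)" "d \<in> atlas (product_manifold M1' M2')"
  then obtain c1 c2 d1 d2 where *: "c = prod_chart c1 c2" "d = prod_chart d1 d2"
      "c1 \<in> atlas M1" "d1 \<in> atlas M1'" "c2 \<in> atlas M2" "d2 \<in> atlas M2'"
    by (auto simp: atlas_product)
  show "smooth_between c (map_prod F G) d"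
    unfolding *(1,2)
    by (rule smooth_between_prod[OF smooth_manifold_chart[OF assms(1) *(3)] smooth_manifold_chart[OF assms(2) *(5)]
          smooth_manifold_chart[OF assms(3) *(4)] smooth_manifold_chart[OF assms(4) *(6)]
          smooth_map_continuous[OF assms(5)] smooth_map_continuous[OF assms(6)]
          smooth_map_between[OF assms(5) *(3,4)] smooth_map_between[OF assms(6) *(5,6)]])
qed

lemma diffeomorphism_product:
  assumes "smooth_manifold M1" "smooth_manifold M2" "smooth_manifold M1'" "smooth_manifold M2'"
    and F: "diffeomorphism M1 M1' F" and H: "diffeomorphism M2 M2' H"
  shows "diffeomorphism (product_manifold M1 M2) (product_manifold M1' M2') (map_prod F H)"
proof -
  let ?X1 = "topspace (mtop M1)" and ?X2 = "topspace (mtop M2)"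
  have bij: "bij_betw F ?X1 (topspace (mtop M1'))" "bij_betw H ?X2 (topspace (mtop M2'))"
    using F H by (auto simp: diffeomorphism_def)
  have b: "bij_betw (map_prod F H) (?X1 \<times> ?X2) (topspace (mtop M1') \<times> topspace (mtop M2'))"
    by (rule bij_betw_map_prod[OF bij])
  have "smooth_map (product_manifold M1' M2') (product_manifold M1 M2)
      (map_prod (inv_into ?X1 F) (inv_into ?X2 H))"
    using F H by (intro smooth_map_product assms) (auto simp: diffeomorphism_def)
  \<comment> \<open>The product of the inverses and the inverse of the product are known to agree
    only on the target space; \<open>smooth_map_cong\<close> accepts exactly this.\<close>
  moreover have "map_prod (inv_into ?X1 F) (inv_into ?X2 H) q = inv_into (?X1 \<times> ?X2) (map_prod F H) q"
    if q: "q \<in> topspace (mtop (product_manifold M1' M2'))" for q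
  proof -
    have "q \<in> map_prod F H ` (?X1 \<times> ?X2)"
      using q unfolding bij_betw_imp_surj_on[OF b] by simp
    then obtain z where z: "q = map_prod F H z" "z \<in> ?X1 \<times> ?X2"
      by (rule imageE)
    obtain x y where xy: "q = map_prod F H (x, y)" "x \<in> ?X1" "y \<in> ?X2"
      using z by (cases z) auto
    have "inv_into (?X1 \<times> ?X2) (map_prod F H) q = (x, y)"
      unfolding xy(1) using bij_betw_inv_into_left[OF b, of "(x, y)"] xy(2,3) by simp
    then show ?thesis
      using bij_betw_inv_into_left[OF bij(1) xy(2)] bij_betw_inv_into_left[OF bij(2) xy(3)] by (simp add: xy(1))
  qed
  ultimately have "smooth_map (product_manifold M1' M2') (product_manifold M1 M2) (inv_into (?X1 \<times> ?X2) (map_prod F H))"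
    using smooth_map_cong[OF smooth_manifold_product[OF assms(3,4)]] by blast
  moreover have "smooth_map (product_manifold M1 M2) (product_manifold M1' M2') (map_prod F H)"
    using F H by (intro smooth_map_product assms) (auto simp: diffeomorphism_def)
  ultimately show ?thesis
    using b by (simp add: diffeomorphism_def)
qed

lemma smooth_map_differentiable:
  assumes "smooth_manifold M" "smooth_manifold M'" "smooth_map M M' F" "c \<in> atlas M" "d \<in> atlas M'"
    "p \<in> fst c" "F p \<in> fst d"
  shows "local_rep c F d differentiable (at (snd c p))"
  by (rule smooth_between_differentiable[OF smooth_map_between[OF assms(3-5)] smooth_manifold_chart[OF assms(1,4)]
        smooth_manifold_chart[OF assms(2,5)] smooth_map_continuous[OF assms(3)] assms(6,7)])

text \<open>Holomorphic coordinates live in the maximal atlas, so products of charts outside the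
  given atlases are needed as well.\<close>

lemma compatible_chart_product:
  assumes M: "smooth_manifold M" and M': "smooth_manifold M'"
    and c: "compatible_chart M c" and d: "compatible_chart M' d"
  shows "compatible_chart (product_manifold M M') (prod_chart c d)"
  unfolding compatible_chart_def
proof (intro conjI ballI)
  have cd: "is_chart (mtop M) c" "is_chart (mtop M') d"
    using c d by (auto simp: compatible_chart_def)
  show "is_chart (mtop (product_manifold M M')) (prod_chart c d)"
    using cd by (simp add: is_chart_prod)
  fix e assume "e \<in> atlas (product_manifold M M')"
  then obtain e1 e2 where e: "e = prod_chart e1 e2" "e1 \<in> atlas M" "e2 \<in> atlas M'"
    by (auto simp: atlas_product)
  have ech: "is_chart (mtop M) e1" "is_chart (mtop M') e2"
    using e M M' by (auto simp: smooth_manifold_chart)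
  have *: "smooth_between e1 (\<lambda>p. p) c" "smooth_between c (\<lambda>p. p) e1"
    "smooth_between e2 (\<lambda>p. p) d" "smooth_between d (\<lambda>p. p) e2"
    using c d e by (auto simp: compatible_chart_def)
  have idid: "map_prod (\<lambda>p. p) (\<lambda>p. p) = (\<lambda>p. p)"
    by auto
  show "smooth_between e (\<lambda>p. p) (prod_chart c d)"
    using smooth_between_prod[OF ech cd continuous_map_id[unfolded id_def] continuous_map_id[unfolded id_def] *(1,3)]
    by (simp add: e idid)
  show "smooth_between (prod_chart c d) (\<lambda>p. p) e"
    using smooth_between_prod[OF cd ech continuous_map_id[unfolded id_def] continuous_map_id[unfolded id_def] *(2,4)]
    by (simp add: e idid)
qed

section \<open>Euclidean space as a manifold with one chart\<close>

lemma smooth_manifold_euclidean: "smooth_manifold (euclidean_manifold :: ('e::euclidean_space, 'e) manifold)"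
proof -
  have "second_countable (euclidean :: 'e topology)"
  proof -
    obtain B :: "'e set set" where B: "countable B" "\<And>C. C \<in> B \<Longrightarrow> open C"
      and U: "\<And>S. open S \<Longrightarrow> \<exists>U. U \<subseteq> B \<and> S = \<Union>U"
      using univ_second_countable by blast
    have "\<exists>V\<in>B. x \<in> V \<and> V \<subseteq> S" if "open S" "x \<in> S" for S x
      using U[OF that(1)] that(2) by blast
    then show ?thesis
      unfolding second_countable_def using B by (intro exI[of _ B]) simp
  qed
  moreover have "is_chart euclidean (UNIV :: 'e set, \<lambda>x. x)"
    by (auto simp: is_chart_iff)
  moreover have "smooth_between (UNIV, \<lambda>x. x) (\<lambda>p. p) (UNIV :: 'e set, \<lambda>x. x)"
    by (auto simp: smooth_between_def local_rep_def o_def inv_into_def smooth_on_ident)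
  ultimately show ?thesis
    by (auto simp: smooth_manifold_def euclidean_manifold_def)
qed

lemma atlas_euclidean: "atlas euclidean_manifold = {(UNIV, \<lambda>x. x)}"
  and mtop_euclidean [simp]: "mtop euclidean_manifold = euclidean"
  by (simp_all add: euclidean_manifold_def)

lemma local_rep_euclidean: "local_rep (UNIV, \<lambda>x. x) F (UNIV, \<lambda>x. x) = F"
proof -
  have "inv_into UNIV (\<lambda>x. x) = (\<lambda>x. x :: 'a)"
    using inv_into_f_f[of "\<lambda>x. x" UNIV] by auto
  then show ?thesis
    by (auto simp: local_rep_def)
qed

section \<open>Quotients by properly discontinuous actions\<close>

text \<open>The group laws are required only on the underlying set, because negative iterates are
  built from \<open>inv_into\<close>, which is arbitrary elsewhere. \<open>evenly\<close> supplies
  the sheets on which the projection can be inverted, \<open>separated\<close> the Hausdorff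
  property of the quotient.\<close>

locale properly_discontinuous =
  fixes M :: "('a, 'e::euclidean_space) manifold" and G :: "('a \<Rightarrow> 'a) set"
  assumes manifold: "smooth_manifold M"
    and ident: "\<exists>e\<in>G. \<forall>p\<in>topspace (mtop M). e p = p"
    and comp: "g \<in> G \<Longrightarrow> h \<in> G \<Longrightarrow> \<exists>f\<in>G. \<forall>p\<in>topspace (mtop M). f p = g (h p)"
    and inverse: "h \<in> G \<Longrightarrow> \<exists>g\<in>G. \<forall>p\<in>topspace (mtop M). g (h p) = p"
    and smooth: "h \<in> G \<Longrightarrow> smooth_map M M h"
    and evenly: "p \<in> topspace (mtop M) \<Longrightarrow> \<exists>W. openin (mtop M) W \<and> p \<in> W \<and> inj_on (orbit G) W"
    and separated: "p \<in> topspace (mtop M) \<Longrightarrow> q \<in> topspace (mtop M) \<Longrightarrow> orbit G p \<noteq> orbit G q \<Longrightarrow>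
      \<exists>U V. openin (mtop M) U \<and> openin (mtop M) V \<and> p \<in> U \<and> q \<in> V \<and> (\<forall>h\<in>G. h ` U \<inter> V = {})"
begin

abbreviation "X \<equiv> topspace (mtop M)"
abbreviation "Q \<equiv> quotient_manifold M G"

section \<open>Orbits and the quotient topology\<close>

lemma action_closed: "h \<in> G \<Longrightarrow> p \<in> X \<Longrightarrow> h p \<in> X"
  using smooth_map_image[OF smooth] .

lemma orbit_self:
  assumes "p \<in> X"
  shows "p \<in> orbit G p"
proof -
  obtain e where "e \<in> G" "p = e p"
    using ident assms by metis
  then show ?thesis
    unfolding orbit_def by blast
qed

lemma orbit_action:
  assumes "h \<in> G" "p \<in> X"
  shows "orbit G (h p) = orbit G p"
proof
  show "orbit G (h p) \<subseteq> orbit G p"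
  proof
    fix q assume "q \<in> orbit G (h p)"
    then obtain g where g: "g \<in> G" "q = g (h p)"
      by (auto simp: orbit_def)
    then obtain f where "f \<in> G" "q = f p"
      using comp[OF g(1) assms(1)] assms(2) by metis
    then show "q \<in> orbit G p"
      unfolding orbit_def by blast
  qed
  obtain k where k: "k \<in> G" "k (h p) = p"
    using inverse[OF assms(1)] assms(2) by blast
  show "orbit G p \<subseteq> orbit G (h p)"
  proof
    fix q assume "q \<in> orbit G p"
    then obtain g where g: "g \<in> G" "q = g p"
      by (auto simp: orbit_def)
    obtain f where "f \<in> G" "f (h p) = g (k (h p))"
      using comp[OF g(1) k(1)] action_closed[OF assms] by blast
    then have "f \<in> G" "q = f (h p)"
      using g k by simp_all
    then show "q \<in> orbit G (h p)"
      unfolding orbit_def by blast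
  qed
qed

lemma orbit_eqD:
  assumes "q \<in> X" "orbit G p = orbit G q"
  shows "\<exists>h\<in>G. q = h p"
  using orbit_self[OF assms(1)] unfolding assms(2)[symmetric] by (auto simp: orbit_def)

lemma openin_Q: "openin (mtop Q) V \<longleftrightarrow> V \<subseteq> orbit G ` X \<and> openin (mtop M) {p \<in> X. orbit G p \<in> V}"
  by (simp add: quotient_manifold_def openin_quotient_topology)

text \<open>The saturation of a set is the union of its preimages under the group elements, each of
  which is open by continuity.\<close>

lemma open_orbit_image:
  assumes "openin (mtop M) W"
  shows "openin (mtop Q) (orbit G ` W)"
proof -
  have W: "W \<subseteq> X"
    using assms openin_subset by blast
  have "{p \<in> X. orbit G p \<in> orbit G ` W} = (\<Union>h\<in>G. {p \<in> X. h p \<in> W})"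
  proof (intro equalityI subsetI)
    fix p assume "p \<in> {p \<in> X. orbit G p \<in> orbit G ` W}"
    then obtain w where "p \<in> X" "w \<in> W" "orbit G p = orbit G w"
      by auto
    moreover from this obtain h where "h \<in> G" "w = h p"
      using orbit_eqD W by (metis subsetD)
    ultimately show "p \<in> (\<Union>h\<in>G. {p \<in> X. h p \<in> W})"
      by blast
  next
    fix p assume "p \<in> (\<Union>h\<in>G. {p \<in> X. h p \<in> W})"
    then obtain h where h: "h \<in> G" "p \<in> X" "h p \<in> W"
      by auto
    then have "orbit G p \<in> orbit G ` W"
      using orbit_action[OF h(1,2)] by (metis image_eqI)
    then show "p \<in> {p \<in> X. orbit G p \<in> orbit G ` W}"
      using h by blast
  qed
  moreover have "openin (mtop M) (\<Union>h\<in>G. {p \<in> X. h p \<in> W})"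
    using openin_continuous_map_preimage[OF smooth_map_continuous[OF smooth] assms]
    by (intro openin_Union) blast
  ultimately show ?thesis
    using W unfolding openin_Q by auto
qed

lemma topspace_Q: "topspace (mtop Q) = orbit G ` X"
proof
  show "orbit G ` X \<subseteq> topspace (mtop Q)"
    using openin_subset[OF open_orbit_image[OF openin_topspace]] .
  show "topspace (mtop Q) \<subseteq> orbit G ` X"
    using openin_topspace[of "mtop Q"] unfolding openin_Q by blast
qed

lemma continuous_orbit: "continuous_map (mtop M) (mtop Q) (orbit G)"
  unfolding continuous_map_def topspace_Q by (simp add: openin_Q Pi_iff)

lemma Hausdorff_Q: "Hausdorff_space (mtop Q)"
  unfolding Hausdorff_space_def
proof (intro allI impI)
  fix P P' assume "P \<in> topspace (mtop Q) \<and> P' \<in> topspace (mtop Q) \<and> P \<noteq> P'"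
  then have "P \<in> orbit G ` X" "P' \<in> orbit G ` X" and neq: "P \<noteq> P'"
    unfolding topspace_Q by blast+
  then obtain p q where pq: "p \<in> X" "q \<in> X" "P = orbit G p" "P' = orbit G q"
    by blast
  then have "orbit G p \<noteq> orbit G q"
    using neq by simp
  then obtain U V where UV: "openin (mtop M) U" "openin (mtop M) V" "p \<in> U" "q \<in> V" "\<And>h. h \<in> G \<Longrightarrow> h ` U \<inter> V = {}"
    using separated[OF pq(1,2)] by metis
  have "orbit G ` U \<inter> orbit G ` V = {}"
  proof (rule ccontr)
    assume "orbit G ` U \<inter> orbit G ` V \<noteq> {}"
    then obtain u v where uv: "u \<in> U" "v \<in> V" "orbit G u = orbit G v"
      by auto
    have "v \<in> X"
      using uv(2) openin_subset[OF UV(2)] by blast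
    then obtain h where "h \<in> G" "v = h u"
      using orbit_eqD[OF _ uv(3)] by blast
    then show False
      using UV(5)[of h] uv by blast
  qed
  then show "\<exists>U V. openin (mtop Q) U \<and> openin (mtop Q) V \<and> P \<in> U \<and> P' \<in> V \<and> disjnt U V"
    using open_orbit_image[OF UV(1)] open_orbit_image[OF UV(2)] UV(3,4) pq(3,4)
    by (intro exI[of _ "orbit G ` U"] exI[of _ "orbit G ` V"]) (simp add: disjnt_def)
qed

lemma second_countable_Q: "second_countable (mtop Q)"
  using manifold by (intro second_countable_open_map_image[OF continuous_orbit])
    (auto simp: open_map_def open_orbit_image topspace_Q smooth_manifold_def)

section \<open>Sheets of the projection and the charts they induce\<close>

definition small :: "'a set \<Rightarrow> bool" where
  "small W \<longleftrightarrow> openin (mtop M) W \<and> inj_on (orbit G) W"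

definition qchart :: "'a set \<Rightarrow> ('a, 'e) chart \<Rightarrow> ('a set, 'e) chart" where
  "qchart W c = (orbit G ` W, snd c \<circ> inv_into W (orbit G))"

lemma fst_qchart: "fst (qchart W c) = orbit G ` W"
  by (simp add: qchart_def)

lemma qchart_apply: "small W \<Longrightarrow> p \<in> W \<Longrightarrow> snd (qchart W c) (orbit G p) = snd c p"
  by (simp add: qchart_def small_def)

lemma qchart_image: "small W \<Longrightarrow> snd (qchart W c) ` fst (qchart W c) = snd c ` W"
  by (force simp: fst_qchart qchart_apply image_image)

lemma small_subset: "small W \<Longrightarrow> p \<in> W \<Longrightarrow> p \<in> X"
  unfolding small_def using openin_subset by blast

lemma atlas_Q: "atlas Q = {qchart W c | W c. c \<in> atlas M \<and> small W \<and> W \<subseteq> fst c}"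
proof -
  have "atlas Q = {qchart W (U, \<phi>) | W U \<phi>. (U, \<phi>) \<in> atlas M \<and> openin (mtop M) W \<and> W \<subseteq> U \<and> inj_on (orbit G) W}"
    by (simp add: quotient_manifold_def qchart_def)
  also have "\<dots> = {qchart W c | W c. c \<in> atlas M \<and> small W \<and> W \<subseteq> fst c}"
    unfolding small_def by (rule Collect_cong) (metis fst_conv prod.collapse)
  finally show ?thesis .
qed

lemma atlas_QI: "c \<in> atlas M \<Longrightarrow> small W \<Longrightarrow> W \<subseteq> fst c \<Longrightarrow> qchart W c \<in> atlas Q"
  unfolding atlas_Q by blast

lemma is_chart_qchart:
  assumes W: "small W" and c: "is_chart (mtop M) c" and Wc: "W \<subseteq> fst c"
  shows "is_chart (mtop Q) (qchart W c)"
  unfolding is_chart_iff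
proof (intro conjI allI impI)
  have Wo: "openin (mtop M) W"
    using W by (simp add: small_def)
  show "openin (mtop Q) (fst (qchart W c))"
    unfolding fst_qchart by (rule open_orbit_image[OF Wo])
  show "inj_on (snd (qchart W c)) (fst (qchart W c))"
  proof (rule inj_onI)
    fix P P' assume "P \<in> fst (qchart W c)" "P' \<in> fst (qchart W c)" "snd (qchart W c) P = snd (qchart W c) P'"
    then obtain p q where pq: "p \<in> W" "q \<in> W" "P = orbit G p" "P' = orbit G q" "snd c p = snd c q"
      by (auto simp: fst_qchart qchart_apply[OF W])
    then have "p = q"
      using inj_onD[OF is_chart_inj[OF c]] Wc by blast
    then show "P = P'"
      using pq by simp
  qed
  fix V assume V: "openin (mtop Q) V \<and> V \<subseteq> fst (qchart W c)"
  have "snd (qchart W c) ` V = snd c ` (W \<inter> {p \<in> X. orbit G p \<in> V})"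
  proof (intro equalityI subsetI)
    fix x assume "x \<in> snd (qchart W c) ` V"
    then obtain p where "p \<in> W" "orbit G p \<in> V" "x = snd (qchart W c) (orbit G p)"
      using V by (auto simp: fst_qchart)
    then show "x \<in> snd c ` (W \<inter> {p \<in> X. orbit G p \<in> V})"
      using qchart_apply[OF W] small_subset[OF W] by auto
  next
    fix x assume "x \<in> snd c ` (W \<inter> {p \<in> X. orbit G p \<in> V})"
    then obtain p where p: "p \<in> W" "orbit G p \<in> V" "x = snd c p"
      by auto
    then show "x \<in> snd (qchart W c) ` V"
      by (intro image_eqI[of _ _ "orbit G p"]) (simp_all add: qchart_apply[OF W])
  qed
  moreover have "openin (mtop M) (W \<inter> {p \<in> X. orbit G p \<in> V})"
    using Wo V openin_Q by blast
  ultimately show "open (snd (qchart W c) ` V)"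
    using is_chart_open_image[OF c] Wc by (metis Int_lower1 subset_trans)
next
  fix B :: "'e set" assume B: "open B"
  have "{P \<in> fst (qchart W c). snd (qchart W c) P \<in> B} = orbit G ` (W \<inter> {p \<in> fst c. snd c p \<in> B})"
    using Wc by (auto simp: fst_qchart qchart_apply[OF W])
  then show "openin (mtop Q) {P \<in> fst (qchart W c). snd (qchart W c) P \<in> B}"
    using open_orbit_image openin_Int[OF _ is_chart_open_preimage[OF c B]] W by (simp add: small_def)
qed

text \<open>A transition map of the quotient is locally the coordinate expression of a group element.\<close>

lemma local_rep_qchart:
  assumes "small W" "small W'" "is_chart (mtop M) c" "W \<subseteq> fst c" "h \<in> G" "p \<in> W" "h p \<in> W'"
  shows "local_rep (qchart W c) (\<lambda>p. p) (qchart W' d) (snd c p) = local_rep c h d (snd c p)"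
proof -
  have "local_rep (qchart W c) (\<lambda>p. p) (qchart W' d) (snd (qchart W c) (orbit G p)) = snd (qchart W' d) (orbit G p)"
    by (rule local_rep_apply[OF is_chart_qchart[OF assms(1,3,4)]]) (simp add: fst_qchart assms(6))
  also have "orbit G p = orbit G (h p)"
    using orbit_action[OF assms(5) small_subset[OF assms(1,6)]] by simp
  also have "snd (qchart W' d) (orbit G (h p)) = snd d (h p)"
    by (rule qchart_apply[OF assms(2,7)])
  finally show ?thesis
    using assms(4,6) by (simp add: qchart_apply[OF assms(1)] local_rep_apply[OF assms(3)] subset_iff
        orbit_action[OF assms(5) small_subset[OF assms(1,6)]])
qed

lemma openin_small_overlap:
  assumes "small W" "small W'" "h \<in> G"
  shows "openin (mtop M) {p \<in> W. h p \<in> W'}"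
proof -
  have "{p \<in> W. h p \<in> W'} = W \<inter> {p \<in> X. h p \<in> W'}"
    using small_subset[OF assms(1)] by auto
  then show ?thesis
    using openin_Int openin_continuous_map_preimage[OF smooth_map_continuous[OF smooth[OF assms(3)]]] assms(1,2)
    unfolding small_def by metis
qed

lemma open_small_overlap:
  assumes "small W" "small W'" "is_chart (mtop M) c" "W \<subseteq> fst c" "h \<in> G"
  shows "open (snd c ` {p \<in> W. h p \<in> W'})"
  by (rule is_chart_open_image[OF assms(3) openin_small_overlap[OF assms(1,2,5)]]) (use assms(4) in auto)

lemma frechet_derivative_qchart:
  assumes "small W" "small W'" "is_chart (mtop M) c" "W \<subseteq> fst c" "h \<in> G" "p \<in> W" "h p \<in> W'"
  shows "frechet_derivative (local_rep (qchart W c) (\<lambda>p. p) (qchart W' d)) (at (snd c p)) =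
    chart_deriv c h d p"
  by (rule frechet_derivative_cong_open[OF open_small_overlap[OF assms(1-5)]])
    (use assms(6,7) in \<open>auto simp: local_rep_qchart[OF assms(1-5)]\<close>)

text \<open>The group element relating the two sheets may vary from point to point, but the one
  found at a given point works on a whole neighbourhood, where the transition map is its coordinate
  expression. Locality of smoothness does the rest.\<close>

lemma smooth_between_qchart:
  assumes W: "small W" "small W'" and c: "is_chart (mtop M) c" "W \<subseteq> fst c" and d: "is_chart (mtop M) d" "W' \<subseteq> fst d"
    and sm: "\<And>h. h \<in> G \<Longrightarrow> smooth_between c h d"
  shows "smooth_between (qchart W c) (\<lambda>p. p) (qchart W' d)"
  unfolding smooth_between_def
proof (rule smooth_on_local)
  let ?S = "snd (qchart W c) ` {P \<in> fst (qchart W c). P \<in> fst (qchart W' d)}"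
  show "open ?S"
    using open_chart_overlap[OF is_chart_qchart[OF W(1) c] continuous_map_id is_chart_open[OF is_chart_qchart[OF W(2) d]]]
    by simp
  fix x assume "x \<in> ?S"
  then obtain P where P: "P \<in> orbit G ` W" "P \<in> orbit G ` W'" "x = snd (qchart W c) P"
    by (auto simp: fst_qchart)
  then obtain p q where pq: "p \<in> W" "q \<in> W'" "orbit G p = orbit G q" "P = orbit G p"
    by blast
  have x: "x = snd c p"
    unfolding P(3) pq(4) by (rule qchart_apply[OF W(1) pq(1)])
  obtain h where h: "h \<in> G" "q = h p"
    using orbit_eqD[OF small_subset[OF W(2) pq(2)] pq(3)] by blast
  let ?T = "snd c ` {p \<in> W. h p \<in> W'}"
  have T: "open ?T"
    by (rule open_small_overlap[OF W c h(1)])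
  have "smooth_on ?T (local_rep c h d)"
  proof (rule smooth_on_subset[OF _ T])
    show "smooth_on (snd c ` {p \<in> fst c. h p \<in> fst d}) (local_rep c h d)"
      using sm[OF h(1)] by (simp add: smooth_between_def)
    show "open (snd c ` {p \<in> fst c. h p \<in> fst d})"
      by (rule open_chart_overlap[OF c(1) smooth_map_continuous[OF smooth[OF h(1)]] is_chart_open[OF d(1)]])
  qed (use c d in auto)
  then have "smooth_on ?T (local_rep (qchart W c) (\<lambda>p. p) (qchart W' d))"
    by (rule smooth_on_cong[THEN iffD1, rotated]) (auto simp: local_rep_qchart[OF W c h(1)])
  moreover have "?T \<subseteq> ?S"
  proof
    fix y assume "y \<in> ?T"
    then obtain p where p: "p \<in> W" "h p \<in> W'" "y = snd c p"
      by auto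
    have "orbit G p \<in> orbit G ` W'"
      using p(2) orbit_action[OF h(1) small_subset[OF W(1) p(1)]] by (metis image_eqI)
    then show "y \<in> ?S"
      using p by (intro image_eqI[of _ _ "orbit G p"]) (auto simp: fst_qchart qchart_apply[OF W(1)])
  qed
  ultimately show "\<exists>T. open T \<and> x \<in> T \<and> T \<subseteq> ?S \<and> smooth_on T (local_rep (qchart W c) (\<lambda>p. p) (qchart W' d))"
    using T pq(1,2) h(2) x by blast
qed

text \<open>For charts of the maximal atlas the action is sandwiched between two changes of chart,
  each passing through the atlas by \<open>smooth_between_trans\<close>.\<close>

lemma smooth_between_action:
  assumes "h \<in> G" "compatible_chart M c" "compatible_chart M d"
  shows "smooth_between c h d"
proof -
  have c: "is_chart (mtop M) c" "\<And>e. e \<in> atlas M \<Longrightarrow> smooth_between c (\<lambda>p. p) e"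
    and d: "is_chart (mtop M) d" "\<And>e. e \<in> atlas M \<Longrightarrow> smooth_between e (\<lambda>p. p) d"
    using assms(2,3) by (auto simp: compatible_chart_def)
  note ch = smooth_manifold_chart[OF manifold] and h = smooth_map_continuous[OF smooth[OF assms(1)]]
  note idc = continuous_map_id[unfolded id_def]
  have "smooth_between c h e" if "e \<in> atlas M" for e
    by (rule smooth_between_trans[OF c(1) ch[OF that] manifold idc h c(2) smooth_map_between[OF smooth[OF assms(1)] _ that]])
  then show ?thesis
    by (rule smooth_between_trans[OF c(1) d(1) manifold h idc _ d(2)])
qed

lemma small_neighbourhood:
  assumes "p \<in> X" "openin (mtop M) U" "p \<in> U"
  shows "\<exists>W. small W \<and> p \<in> W \<and> W \<subseteq> U"
proof -
  obtain W where "openin (mtop M) W" "p \<in> W" "inj_on (orbit G) W"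
    using evenly[OF assms(1)] by blast
  then show ?thesis
    using assms by (intro exI[of _ "W \<inter> U"]) (auto simp: small_def inj_on_Int)
qed

lemma smooth_manifold_Q: "smooth_manifold Q"
  unfolding smooth_manifold_def
proof (intro conjI ballI)
  show ch: "is_chart (mtop Q) c" if "c \<in> atlas Q" for c
    using that unfolding atlas_Q by (auto intro!: is_chart_qchart smooth_manifold_chart[OF manifold])
  show "(\<Union>c\<in>atlas Q. fst c) = topspace (mtop Q)"
  proof
    show "(\<Union>c\<in>atlas Q. fst c) \<subseteq> topspace (mtop Q)"
      using ch is_chart_subset by blast
    show "topspace (mtop Q) \<subseteq> (\<Union>c\<in>atlas Q. fst c)"
    proof
      fix P assume "P \<in> topspace (mtop Q)"
      then obtain p where p: "p \<in> X" "P = orbit G p"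
        by (auto simp: topspace_Q)
      then obtain c where c: "c \<in> atlas M" "p \<in> fst c"
        using smooth_manifold_cover[OF manifold] by blast
      then obtain W where W: "small W" "p \<in> W" "W \<subseteq> fst c"
        using small_neighbourhood p(1) is_chart_open[OF smooth_manifold_chart[OF manifold]] by meson
      then have "qchart W c \<in> atlas Q" "P \<in> fst (qchart W c)"
        using c p by (auto simp: atlas_QI fst_qchart)
      then show "P \<in> (\<Union>c\<in>atlas Q. fst c)"
        by blast
    qed
  qed
  fix c d assume "c \<in> atlas Q" "d \<in> atlas Q"
  then obtain W c' W' d' where *: "c = qchart W c'" "c' \<in> atlas M" "small W" "W \<subseteq> fst c'"
      "d = qchart W' d'" "d' \<in> atlas M" "small W'" "W' \<subseteq> fst d'"
    unfolding atlas_Q by blast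
  note ch = smooth_manifold_chart[OF manifold] and cc = compatible_chart_atlas[OF manifold]
  show "smooth_between c (\<lambda>p. p) d"
    unfolding *(1,5) by (rule smooth_between_qchart[OF *(3,7) ch[OF *(2)] *(4) ch[OF *(6)] *(8)
          smooth_between_action[OF _ cc[OF *(2)] cc[OF *(6)]]])
qed (rule Hausdorff_Q second_countable_Q)+

lemma compatible_chart_qchart:
  assumes W: "small W" and d: "compatible_chart M d" and Wd: "W \<subseteq> fst d"
  shows "compatible_chart Q (qchart W d)"
  unfolding compatible_chart_def
proof (intro conjI ballI)
  have dch: "is_chart (mtop M) d"
    using d by (simp add: compatible_chart_def)
  show "is_chart (mtop Q) (qchart W d)"
    by (rule is_chart_qchart[OF W dch Wd])
  fix c assume "c \<in> atlas Q"
  then obtain W' e where e: "c = qchart W' e" "e \<in> atlas M" "small W'" "W' \<subseteq> fst e"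
    unfolding atlas_Q by blast
  note ech = smooth_manifold_chart[OF manifold e(2)] and ecc = compatible_chart_atlas[OF manifold e(2)]
  show "smooth_between c (\<lambda>p. p) (qchart W d)"
    unfolding e(1) by (rule smooth_between_qchart[OF e(3) W ech e(4) dch Wd smooth_between_action[OF _ ecc d]])
  show "smooth_between (qchart W d) (\<lambda>p. p) c"
    unfolding e(1) by (rule smooth_between_qchart[OF W e(3) dch Wd ech e(4) smooth_between_action[OF _ d ecc]])
qed

text \<open>
  A chart of the quotient does not determine the chart of \<open>M\<close> it comes from, so one is chosen;
  for invariant tensor fields the transformation law makes the choice immaterial.
\<close>

definition lift_chart :: "('a set, 'e) chart \<Rightarrow> ('a, 'e) chart" where
  "lift_chart c = (SOME d. d \<in> atlas M \<and> (\<exists>W. small W \<and> W \<subseteq> fst d \<and> c = qchart W d))"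

definition descend :: "(('a, 'e) chart \<Rightarrow> 'b) \<Rightarrow> ('a set, 'e) chart \<Rightarrow> 'b" where
  "descend T c = T (lift_chart c)"

lemma lift_chart:
  assumes "c \<in> atlas Q"
  obtains W b where "lift_chart c = b" "b \<in> atlas M" "small W" "W \<subseteq> fst b" "c = qchart W b"
proof -
  have "\<exists>d. d \<in> atlas M \<and> (\<exists>W. small W \<and> W \<subseteq> fst d \<and> c = qchart W d)"
    using assms unfolding atlas_Q by blast
  from someI_ex[OF this] show ?thesis
    using that unfolding lift_chart_def by blast
qed

lemma lift_chart_atlas: "c \<in> atlas Q \<Longrightarrow> lift_chart c \<in> atlas M"
  by (erule lift_chart) simp

lemma coordinate_domain_subset:
  assumes "c \<in> atlas Q" "x \<in> snd c ` fst c"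
  shows "x \<in> snd (lift_chart c) ` fst (lift_chart c)"
proof -
  obtain W b where b: "lift_chart c = b" "b \<in> atlas M" "small W" "W \<subseteq> fst b" "c = qchart W b"
    by (rule lift_chart[OF assms(1)])
  have "x \<in> snd b ` W"
    using assms(2) unfolding b(5) qchart_image[OF b(3)] .
  then show ?thesis
    unfolding b(1) using b(4) by blast
qed

text \<open>Everything at an overlap point of two quotient charts is expressed upstairs: the point
  is seen as \<open>p\<close> in one lifted chart and as \<open>h p\<close> in the other, and the
  derivative of the transition is that of \<open>h\<close>. Hence the transformation law on the
  quotient is precisely invariance under the group.\<close>

lemma lift_overlap:
  assumes "c \<in> atlas Q" "d \<in> atlas Q" "P \<in> fst c" "P \<in> fst d"
  obtains p h where "h \<in> G" "p \<in> fst (lift_chart c)" "h p \<in> fst (lift_chart d)"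
    "snd c P = snd (lift_chart c) p" "snd d P = snd (lift_chart d) (h p)"
    "chart_deriv c (\<lambda>p. p) d P =
       chart_deriv (lift_chart c) h (lift_chart d) p"
proof -
  obtain W b where W: "lift_chart c = b" "b \<in> atlas M" "small W" "W \<subseteq> fst b" "c = qchart W b"
    by (rule lift_chart[OF assms(1)])
  obtain W' b' where W': "lift_chart d = b'" "b' \<in> atlas M" "small W'" "W' \<subseteq> fst b'" "d = qchart W' b'"
    by (rule lift_chart[OF assms(2)])
  obtain p where p: "p \<in> W" "P = orbit G p"
    using assms(3) unfolding W(5) fst_qchart by blast
  obtain q where q: "q \<in> W'" "P = orbit G q"
    using assms(4) unfolding W'(5) fst_qchart by blast
  obtain h where h: "h \<in> G" "q = h p"
    using orbit_eqD[OF small_subset[OF W'(3) q(1)], of p] p(2) q(2) by blast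
  have cP: "snd c P = snd (lift_chart c) p"
    unfolding W(1) unfolding W(5) p(2) by (rule qchart_apply[OF W(3) p(1)])
  have dP: "snd d P = snd (lift_chart d) (h p)"
    unfolding W'(1) unfolding W'(5) q(2) h(2)[symmetric] by (rule qchart_apply[OF W'(3) q(1)])
  have "chart_deriv c (\<lambda>p. p) d P =
       chart_deriv (lift_chart c) h (lift_chart d) p"
    unfolding cP unfolding W(1) W'(1) unfolding W(5) W'(5)
    by (rule frechet_derivative_qchart[OF W(3) W'(3) smooth_manifold_chart[OF manifold W(2)] W(4) h(1) p(1)])
      (use q h in simp)
  moreover have "p \<in> fst (lift_chart c)" "h p \<in> fst (lift_chart d)"
    using W(1,4) W'(1,4) p(1) q(1) h(2) by auto
  ultimately show ?thesis
    using that[OF h(1) _ _ cP dP] by blast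
qed

section \<open>Descent of invariant tensor fields and structures\<close>

lemma pullback_eq_descend:
  assumes "\<And>h. h \<in> G \<Longrightarrow> pullback_eq M M h k T T"
  shows "pullback_eq Q Q (\<lambda>p. p) k (descend T) (descend T)"
  unfolding pullback_eq_def
proof (intro ballI allI impI)
  fix c d P and vs :: "'e list"
  assume *: "c \<in> atlas Q" "d \<in> atlas Q" "P \<in> fst c" "P \<in> fst d" "length vs = k"
  obtain p h where ph: "h \<in> G" "p \<in> fst (lift_chart c)" "h p \<in> fst (lift_chart d)"
    "snd c P = snd (lift_chart c) p" "snd d P = snd (lift_chart d) (h p)"
    "chart_deriv c (\<lambda>p. p) d P =
       chart_deriv (lift_chart c) h (lift_chart d) p"
    by (rule lift_overlap[OF *(1-4)])
  show "descend T d (snd d P) (map (chart_deriv c (\<lambda>p. p) d P) vs) =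
      descend T c (snd c P) vs"
    unfolding descend_def ph(6) ph(5) unfolding ph(4)
    by (rule pullback_eqD[OF assms[OF ph(1)] lift_chart_atlas[OF *(1)] lift_chart_atlas[OF *(2)] ph(2,3) *(5)])
qed

lemma intertwines_descend:
  assumes "\<And>h. h \<in> G \<Longrightarrow> intertwines M M h I I"
  shows "intertwines Q Q (\<lambda>p. p) (descend I) (descend I)"
  unfolding intertwines_def
proof (intro ballI allI impI)
  fix c d P v
  assume *: "c \<in> atlas Q" "d \<in> atlas Q" "P \<in> fst c" "P \<in> fst d"
  obtain p h where ph: "h \<in> G" "p \<in> fst (lift_chart c)" "h p \<in> fst (lift_chart d)"
    "snd c P = snd (lift_chart c) p" "snd d P = snd (lift_chart d) (h p)"
    "chart_deriv c (\<lambda>p. p) d P =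
       chart_deriv (lift_chart c) h (lift_chart d) p"
    by (rule lift_overlap[OF *(1-4)])
  show "chart_deriv c (\<lambda>p. p) d P (descend I c (snd c P) v) =
      descend I d (snd d P) (chart_deriv c (\<lambda>p. p) d P v)"
    unfolding descend_def ph(6) ph(5) unfolding ph(4)
    by (rule intertwinesD[OF assms[OF ph(1)] lift_chart_atlas[OF *(1)] lift_chart_atlas[OF *(2)] ph(2,3)])
qed

lemma smooth_on_descend:
  assumes "c \<in> atlas Q" "smooth_on (snd (lift_chart c) ` fst (lift_chart c)) f"
  shows "smooth_on (snd c ` fst c) f"
  using smooth_on_subset[OF smooth_manifold_open_image[OF manifold lift_chart_atlas[OF assms(1)]]
      smooth_manifold_open_image[OF smooth_manifold_Q assms(1)] _ assms(2)]
    coordinate_domain_subset[OF assms(1)] by blast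

lemma covariant_tensor_descend:
  assumes "covariant_tensor M k T" "\<And>h. h \<in> G \<Longrightarrow> pullback_eq M M h k T T"
  shows "covariant_tensor Q k (descend T)"
  unfolding covariant_tensor_def
proof (intro conjI ballI allI impI pullback_eq_descend assms(2))
  fix c assume c: "c \<in> atlas Q"
  show "multilinear k (descend T c x)" if "x \<in> snd c ` fst c" for x
    using assms(1) lift_chart_atlas[OF c] coordinate_domain_subset[OF c that]
    unfolding covariant_tensor_def descend_def by blast
  show "smooth_on (snd c ` fst c) (\<lambda>x. descend T c x vs)" if "length vs = k" for vs
    using assms(1) lift_chart_atlas[OF c] that
    unfolding covariant_tensor_def descend_def by (intro smooth_on_descend[OF c]) blast
qed

lemma endomorphism_tensor_descend:
  assumes "endomorphism_tensor M I" "\<And>h. h \<in> G \<Longrightarrow> intertwines M M h I I"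
  shows "endomorphism_tensor Q (descend I)"
  unfolding endomorphism_tensor_def
proof (intro conjI ballI allI intertwines_descend assms(2))
  fix c assume c: "c \<in> atlas Q"
  show "linear (descend I c x)" if "x \<in> snd c ` fst c" for x
    using assms(1) lift_chart_atlas[OF c] coordinate_domain_subset[OF c that]
    unfolding endomorphism_tensor_def descend_def by blast
  show "smooth_on (snd c ` fst c) (\<lambda>x. descend I c x v)" for v
    using assms(1) lift_chart_atlas[OF c]
    unfolding endomorphism_tensor_def descend_def by (intro smooth_on_descend[OF c]) blast
qed

lemma field_eq_descend: "field_eq M k \<alpha> \<beta> \<Longrightarrow> field_eq Q k (descend \<alpha>) (descend \<beta>)"
  unfolding field_eq_def descend_def using lift_chart_atlas coordinate_domain_subset by blast

text \<open>\<open>descend\<close> only relabels charts, while \<open>ext_deriv\<close> is computed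
  inside a single chart, so the two commute by unfolding their definitions.\<close>

lemma closed_form_descend:
  assumes "closed_form M k H" "\<And>h. h \<in> G \<Longrightarrow> pullback_eq M M h k H H"
  shows "closed_form Q k (descend H)"
proof -
  have "covariant_tensor Q k (descend H)"
    using assms covariant_tensor_descend by (simp add: closed_form_def differential_form_def)
  moreover have "descend H c x vs = 0" if c: "c \<in> atlas Q" and x: "x \<in> snd c ` fst c"
    and vs: "length vs = k" "i < j" "j < k" "vs ! i = vs ! j" for c x vs i j
    using assms(1) lift_chart_atlas[OF c] coordinate_domain_subset[OF c x] vs
    unfolding closed_form_def differential_form_def descend_def by blast
  moreover have "field_eq Q (Suc k) (descend (ext_deriv H)) (descend (\<lambda>c x vs. 0))"
    using assms(1) by (intro field_eq_descend) (simp add: closed_form_def)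
  then have "field_eq Q (Suc k) (ext_deriv (descend H)) (\<lambda>c x vs. 0)"
    by (simp add: descend_def[abs_def] ext_deriv_def)
  ultimately show ?thesis
    unfolding closed_form_def differential_form_def by blast
qed

lemma riemannian_metric_descend:
  assumes "riemannian_metric M g" "\<And>h. h \<in> G \<Longrightarrow> pullback_eq M M h 2 g g"
  shows "riemannian_metric Q (descend g)"
  using assms(1) covariant_tensor_descend[OF _ assms(2)] lift_chart_atlas coordinate_domain_subset
  unfolding riemannian_metric_def descend_def[of _ c for c] by blast

lemma compatible_metric_descend: "compatible_metric M g I \<Longrightarrow> compatible_metric Q (descend g) (descend I)"
  unfolding compatible_metric_def descend_def using lift_chart_atlas coordinate_domain_subset by blast

lemma split_structure_descend: "split_structure M I I' \<Longrightarrow> split_structure Q (descend I) (descend I')"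
  unfolding split_structure_def descend_def using lift_chart_atlas coordinate_domain_subset by blast

text \<open>A holomorphic chart \<open>d\<close> upstairs, restricted to a sheet, gives a chart of
  the quotient. Seen from another sheet, reached by a group element \<open>h\<close>, this chart
  reads as \<open>d\<close> composed with \<open>h\<close>, which is still holomorphic because
  \<open>h\<close> preserves the structure.\<close>

lemma complex_structure_descend:
  assumes I: "complex_structure M I" and inv: "\<And>h. h \<in> G \<Longrightarrow> intertwines M M h I I"
  shows "complex_structure Q (descend I)"
  unfolding complex_structure_def
proof (intro conjI ballI)
  show "almost_complex_structure Q (descend I)"
    using I endomorphism_tensor_descend[OF _ inv] lift_chart_atlas coordinate_domain_subset
    unfolding complex_structure_def almost_complex_structure_def descend_def[of _ c for c] by blast
  fix P assume "P \<in> topspace (mtop Q)"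
  then obtain p where p: "p \<in> X" "P = orbit G p"
    by (auto simp: topspace_Q)
  obtain d j where d: "compatible_chart M d" "p \<in> fst d" "linear j"
    and hol: "\<And>c q v. c \<in> atlas M \<Longrightarrow> q \<in> fst c \<inter> fst d \<Longrightarrow>
      chart_deriv c (\<lambda>p. p) d q (I c (snd c q) v) =
      j (chart_deriv c (\<lambda>p. p) d q v)"
    using I p(1) unfolding complex_structure_def by blast
  have dch: "is_chart (mtop M) d"
    using d(1) by (simp add: compatible_chart_def)
  obtain W where W: "small W" "p \<in> W" "W \<subseteq> fst d"
    using small_neighbourhood[OF p(1) is_chart_open[OF dch] d(2)] by blast
  have "chart_deriv c (\<lambda>p. p) (qchart W d) R (descend I c (snd c R) v) =
        j (chart_deriv c (\<lambda>p. p) (qchart W d) R v)"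
    if c: "c \<in> atlas Q" and R: "R \<in> fst c \<inter> fst (qchart W d)" for c R v
  proof -
    obtain V b where V: "lift_chart c = b" "small V" and b: "b \<in> atlas M" "V \<subseteq> fst b" "c = qchart V b"
      by (rule lift_chart[OF c])
    have bch: "is_chart (mtop M) b"
      using manifold b(1) by (rule smooth_manifold_chart)
    obtain q where q: "q \<in> V" "R = orbit G q"
      using R unfolding b(3) fst_qchart by blast
    obtain r where r: "r \<in> W" "R = orbit G r"
      using R unfolding fst_qchart by blast
    obtain h where h: "h \<in> G" "r = h q"
      using orbit_eqD[OF small_subset[OF W(1) r(1)], of q] q(2) r(2) by blast
    \<comment> \<open>Holomorphy of \<open>d\<close> is stated relative to atlas charts, so
      \<open>h\<close> is first followed into such a chart \<open>a\<close> and only then into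
      \<open>d\<close>.\<close>
    obtain a where a: "a \<in> atlas M" "h q \<in> fst a"
      using smooth_manifold_cover[OF manifold] action_closed[OF h(1) small_subset[OF V(2) q(1)]] by blast
    have ach: "is_chart (mtop M) a"
      using manifold a(1) by (rule smooth_manifold_chart)
    have cR: "snd c R = snd b q"
      unfolding b(3) q(2) by (rule qchart_apply[OF V(2) q(1)])
    have hq: "h q \<in> fst d" "q \<in> fst b"
      using r(1) h(2) W(3) q(1) b(2) by auto
    let ?A = "chart_deriv a (\<lambda>p. p) d (h q)"
      and ?B = "chart_deriv b h a q"
    have ad: "smooth_between a (\<lambda>p. p) d"
      using d(1) a(1) by (simp add: compatible_chart_def)
    have "chart_deriv c (\<lambda>p. p) (qchart W d) R =
        chart_deriv b h d q"
      unfolding cR unfolding b(3)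
      by (rule frechet_derivative_qchart[OF V(2) W(1) bch b(2) h(1) q(1)]) (use r h in simp)
    then have D: "chart_deriv c (\<lambda>p. p) (qchart W d) R u = ?A (?B u)" for u
      using frechet_derivative_local_rep_comp[OF bch ach dch smooth_map_continuous[OF smooth[OF h(1)]]
          continuous_map_id[unfolded id_def] smooth_map_between[OF smooth[OF h(1)] b(1) a(1)] ad hq(2) a(2) hq(1)]
      by simp
    have "?A (?B (I b (snd b q) v)) = ?A (I a (snd a (h q)) (?B v))"
      by (simp only: intertwinesD[OF inv[OF h(1)] b(1) a(1) hq(2) a(2)])
    also have "\<dots> = j (?A (?B v))"
      using hol[OF a(1)] a(2) hq(1) by blast
    finally show ?thesis
      unfolding D unfolding cR by (simp add: descend_def V(1))
  qed
  then show "\<exists>d j. compatible_chart Q d \<and> P \<in> fst d \<and> linear j \<and>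
      (\<forall>c\<in>atlas Q. \<forall>q\<in>fst c \<inter> fst d. \<forall>v.
         chart_deriv c (\<lambda>p. p) d q (descend I c (snd c q) v) =
         j (chart_deriv c (\<lambda>p. p) d q v))"
    using compatible_chart_qchart[OF W(1) d(1) W(3)] d(3) W(2) p(2)
    by (intro exI[of _ "qchart W d"] exI[of _ j]) (auto simp: fst_qchart)
qed

text \<open>The definition provides the torsion form only existentially and only up to its values on
  coordinate domains and lists of length 3. The last assumption therefore asks for invariance of
  every form that represents it.\<close>

lemma generalized_kaehler_descend:
  assumes "generalized_kaehler M g I\<^sub>p I\<^sub>m"
    and "\<And>h. h \<in> G \<Longrightarrow> pullback_eq M M h 2 g g"
    and "\<And>h. h \<in> G \<Longrightarrow> intertwines M M h I\<^sub>p I\<^sub>p"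
    and "\<And>h. h \<in> G \<Longrightarrow> intertwines M M h I\<^sub>m I\<^sub>m"
    and "\<And>H h. h \<in> G \<Longrightarrow> field_eq M 3 (dc I\<^sub>p (fundamental_form g I\<^sub>p)) H \<Longrightarrow> pullback_eq M M h 3 H H"
  shows "generalized_kaehler Q (descend g) (descend I\<^sub>p) (descend I\<^sub>m)"
proof -
  have dc: "dc (descend I) (fundamental_form (descend g) (descend I)) = descend (dc I (fundamental_form g I))" for I
    by (simp add: dc_def fundamental_form_def act_on_form_def ext_deriv_def descend_def fun_eq_iff)
  obtain H where H: "closed_form M 3 H" "field_eq M 3 (dc I\<^sub>p (fundamental_form g I\<^sub>p)) H"
    "field_eq M 3 (\<lambda>c x vs. - dc I\<^sub>m (fundamental_form g I\<^sub>m) c x vs) H"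
    using assms(1) unfolding generalized_kaehler_def by blast
  have "(\<lambda>c x vs. - descend (dc I\<^sub>m (fundamental_form g I\<^sub>m)) c x vs) =
      descend (\<lambda>c x vs. - dc I\<^sub>m (fundamental_form g I\<^sub>m) c x vs)"
    by (simp add: descend_def fun_eq_iff)
  then have "closed_form Q 3 (descend H)"
    "field_eq Q 3 (dc (descend I\<^sub>p) (fundamental_form (descend g) (descend I\<^sub>p))) (descend H)"
    "field_eq Q 3 (\<lambda>c x vs. - dc (descend I\<^sub>m) (fundamental_form (descend g) (descend I\<^sub>m)) c x vs) (descend H)"
    using closed_form_descend[OF H(1) assms(5)[OF _ H(2)]] field_eq_descend[OF H(2)] field_eq_descend[OF H(3)]
    by (simp_all add: dc)
  then show ?thesis
    using assms smooth_manifold_Q riemannian_metric_descend complex_structure_descend compatible_metric_descend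
    unfolding generalized_kaehler_def by blast
qed

end

section \<open>Tori\<close>

lemma lattice_closed:
  fixes \<Gamma> :: "(real^'n) set"
  assumes "is_lattice \<Gamma>"
  shows "0 \<in> \<Gamma>" and "\<gamma> \<in> \<Gamma> \<Longrightarrow> \<delta> \<in> \<Gamma> \<Longrightarrow> \<gamma> + \<delta> \<in> \<Gamma>" and "\<gamma> \<in> \<Gamma> \<Longrightarrow> - \<gamma> \<in> \<Gamma>"
proof -
  obtain B :: "real^'n^'n" where B: "\<Gamma> = {B *v z | z. \<forall>i. z $ i \<in> \<int>}"
    using assms unfolding is_lattice_def by blast
  show "0 \<in> \<Gamma>"
    unfolding B using matrix_vector_mult_0_right[of B] by (auto intro!: exI[of _ 0])
  show "\<gamma> + \<delta> \<in> \<Gamma>" if asm: "\<gamma> \<in> \<Gamma>" "\<delta> \<in> \<Gamma>"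
  proof -
    obtain y where "\<gamma> = B *v y" "\<forall>i. y $ i \<in> \<int>"
      using asm(1) unfolding B by auto
    moreover obtain z where "\<delta> = B *v z" "\<forall>i. z $ i \<in> \<int>"
      using asm(2) unfolding B by auto
    ultimately have "\<gamma> + \<delta> = B *v (y + z)" "\<forall>i. (y + z) $ i \<in> \<int>"
      by (simp_all add: matrix_vector_right_distrib)
    then show ?thesis
      unfolding B by blast
  qed
  show "- \<gamma> \<in> \<Gamma>" if asm: "\<gamma> \<in> \<Gamma>"
  proof -
    obtain y where "\<gamma> = B *v y" "\<forall>i. y $ i \<in> \<int>"
      using asm unfolding B by auto
    then have "- \<gamma> = B *v (- y)" "\<forall>i. (- y) $ i \<in> \<int>"
      using linear_neg[OF matrix_vector_mul_linear, of B y] by simp_all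
    then show ?thesis
      unfolding B by blast
  qed
qed

text \<open>A nonzero integer vector has a coordinate of absolute value at least 1. Applying the
  inverse matrix, of norm at most \<open>K\<close>, to a lattice vector recovers such a vector,
  whence the bound \<open>1 / K\<close>.\<close>

lemma lattice_discrete:
  fixes \<Gamma> :: "(real^'n) set"
  assumes "is_lattice \<Gamma>"
  shows "\<exists>\<epsilon>>0. \<forall>\<gamma>\<in>\<Gamma>. \<gamma> \<noteq> 0 \<longrightarrow> \<epsilon> \<le> norm \<gamma>"
proof -
  obtain B :: "real^'n^'n" where "invertible B" and B: "\<Gamma> = {B *v z | z. \<forall>i. z $ i \<in> \<int>}"
    using assms unfolding is_lattice_def by blast
  then obtain A where A: "A ** B = mat 1"
    unfolding invertible_def by blast
  obtain K where K: "K > 0" "\<And>x. norm (A *v x) \<le> norm x * K"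
    using bounded_linear.pos_bounded[OF matrix_vector_mul_bounded_linear[of A]] by blast
  have "1 / K \<le> norm \<gamma>" if \<gamma>: "\<gamma> \<in> \<Gamma>" "\<gamma> \<noteq> 0" for \<gamma>
  proof -
    obtain z where z: "\<gamma> = B *v z" "\<And>i. z $ i \<in> \<int>"
      using \<gamma>(1) unfolding B by blast
    have "z \<noteq> 0"
      using \<gamma>(2) z(1) by auto
    then obtain i where i: "z $ i \<noteq> 0"
      by (auto simp: vec_eq_iff)
    have "1 \<le> \<bar>z $ i\<bar>"
      using z(2)[of i] i by (auto elim!: Ints_cases)
    also have "\<dots> \<le> norm z"
      by (rule component_le_norm_cart)
    also have "z = A *v \<gamma>"
      by (simp add: z(1) matrix_vector_mul_assoc A)
    also have "norm (A *v \<gamma>) \<le> norm \<gamma> * K"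
      by (rule K(2))
    finally show ?thesis
      using K(1) by (simp add: divide_simps)
  qed
  then show ?thesis
    using K(1) by (intro exI[of _ "1 / K"]) simp
qed

lemma smooth_map_translation:
  "smooth_map euclidean_manifold euclidean_manifold (\<lambda>x :: 'a::euclidean_space. x + a)"
  unfolding smooth_map_def atlas_euclidean
  by (auto simp: smooth_between_def local_rep_euclidean intro!: smooth_on_add smooth_on_ident smooth_on_const
      continuous_intros)

lemma frechet_derivative_translation: "frechet_derivative (\<lambda>x. x + a) (at x) = (\<lambda>v. v)"
  by (rule frechet_derivative_at[symmetric]) (auto intro!: derivative_eq_intros)

lemma properly_discontinuous_translations:
  fixes \<Gamma> :: "(real^'n) set"
  assumes \<Gamma>: "is_lattice \<Gamma>"
  shows "properly_discontinuous euclidean_manifold {(\<lambda>x. x + \<gamma>) | \<gamma>. \<gamma> \<in> \<Gamma>}" (is "properly_discontinuous _ ?G")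
proof -
  note cl = lattice_closed[OF \<Gamma>]
  have orb: "orbit ?G p = {p + \<gamma> | \<gamma>. \<gamma> \<in> \<Gamma>}" for p
    by (auto simp: orbit_def)
  have orb_eq: "orbit ?G p = orbit ?G q" if "p + \<gamma> = q" "\<gamma> \<in> \<Gamma>" for p q \<gamma>
  proof (intro equalityI subsetI)
    fix x assume "x \<in> orbit ?G p"
    then obtain \<delta> where "x = p + \<delta>" "\<delta> \<in> \<Gamma>"
      unfolding orb by blast
    then have "x = q + (\<delta> + - \<gamma>)" "\<delta> + - \<gamma> \<in> \<Gamma>"
      using that(1) cl(2)[OF \<open>\<delta> \<in> \<Gamma>\<close> cl(3)[OF that(2)]] by auto
    then show "x \<in> orbit ?G q"
      unfolding orb by blast
  next
    fix x assume "x \<in> orbit ?G q"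
    then obtain \<delta> where "x = q + \<delta>" "\<delta> \<in> \<Gamma>"
      unfolding orb by blast
    then have "x = p + (\<gamma> + \<delta>)" "\<gamma> + \<delta> \<in> \<Gamma>"
      using that(1) cl(2)[OF that(2) \<open>\<delta> \<in> \<Gamma>\<close>] by auto
    then show "x \<in> orbit ?G p"
      unfolding orb by blast
  qed
  have orb_eqD: "\<exists>\<gamma>\<in>\<Gamma>. q = p + \<gamma>" if "orbit ?G p = orbit ?G q" for p q
  proof -
    have "q = q + 0"
      by simp
    then have "q \<in> orbit ?G q"
      unfolding orb using cl(1) by blast
    then show ?thesis
      unfolding that[symmetric] unfolding orb by blast
  qed
  obtain \<epsilon> where \<epsilon>: "\<epsilon> > 0" "\<And>\<gamma>. \<gamma> \<in> \<Gamma> \<Longrightarrow> \<gamma> \<noteq> 0 \<Longrightarrow> \<epsilon> \<le> norm \<gamma>"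
    using lattice_discrete[OF \<Gamma>] by blast
  show ?thesis
  proof (unfold_locales, unfold mtop_euclidean)
    show "smooth_manifold (euclidean_manifold :: (real^'n, real^'n) manifold)"
      by (rule smooth_manifold_euclidean)
    show "\<exists>e\<in>?G. \<forall>p\<in>topspace euclidean. e p = p"
    proof (rule bexI)
      show "(\<lambda>x. x + 0) \<in> ?G"
        using cl(1) by blast
    qed simp
    show "\<exists>f\<in>?G. \<forall>p\<in>topspace euclidean. f p = g (h p)" if gh: "g \<in> ?G" "h \<in> ?G" for g h
    proof -
      obtain \<gamma> \<delta> where "g = (\<lambda>x. x + \<gamma>)" "h = (\<lambda>x. x + \<delta>)" "\<gamma> \<in> \<Gamma>" "\<delta> \<in> \<Gamma>"
        using gh by blast
      then show ?thesis
        using cl(2)[of \<delta> \<gamma>] by (intro bexI[of _ "\<lambda>x. x + (\<delta> + \<gamma>)"]) (auto simp: add.assoc)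
    qed
    show "\<exists>g\<in>?G. \<forall>p\<in>topspace euclidean. g (h p) = p" if h: "h \<in> ?G" for h
    proof -
      obtain \<delta> where "h = (\<lambda>x. x + \<delta>)" "\<delta> \<in> \<Gamma>"
        using h by blast
      then have "(\<lambda>x. x + - \<delta>) \<in> ?G" "\<forall>p. (\<lambda>x. x + - \<delta>) (h p) = p"
        using cl(3)[of \<delta>] by (blast, simp)
      then show ?thesis
        by (intro bexI[of _ "\<lambda>x. x + - \<delta>"]) blast+
    qed
    show "smooth_map euclidean_manifold euclidean_manifold h" if "h \<in> ?G" for h
      using that smooth_map_translation by blast
    show "\<exists>W. openin euclidean W \<and> p \<in> W \<and> inj_on (orbit ?G) W" for p
    proof (intro exI conjI)
      \<comment> \<open>Two points of this ball differ by less than the minimal length of a nonzero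
        lattice vector.\<close>
      show "inj_on (orbit ?G) (ball p (\<epsilon> / 2))"
      proof (rule inj_onI)
        fix x y assume xy: "x \<in> ball p (\<epsilon> / 2)" "y \<in> ball p (\<epsilon> / 2)" "orbit ?G x = orbit ?G y"
        obtain \<gamma> where \<gamma>: "\<gamma> \<in> \<Gamma>" "y = x + \<gamma>"
          using orb_eqD[OF xy(3)] by blast
        have "norm \<gamma> = dist x y"
          by (simp add: \<gamma>(2) dist_norm)
        also have "\<dots> < \<epsilon>"
          using dist_triangle_half_r[of p x \<epsilon> y] xy by simp
        finally show "x = y"
          using \<epsilon>(2)[OF \<gamma>(1)] \<gamma>(2) by auto
      qed
    qed (use \<epsilon>(1) in auto)
    show "\<exists>U V. openin euclidean U \<and> openin euclidean V \<and> p \<in> U \<and> q \<in> V \<and> (\<forall>h\<in>?G. h ` U \<inter> V = {})"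
      if ne: "orbit ?G p \<noteq> orbit ?G q" for p q
    proof -
      \<comment> \<open>The orbit of \<open>p\<close> keeps a positive distance from
        \<open>q\<close>. Distinct translates of \<open>p\<close> are at least \<epsilon> apart, so
        one that comes within \<epsilon>/2 of \<open>q\<close> is a nearest one. The factor 2 leaves
        room for a ball around each of the two points.\<close>
      have "\<exists>\<delta>>0. \<forall>\<gamma>\<in>\<Gamma>. 2 * \<delta> \<le> dist (p + \<gamma>) q"
      proof (cases "\<exists>\<gamma>\<in>\<Gamma>. dist (p + \<gamma>) q < \<epsilon> / 2")
        case True
        then obtain \<gamma> where \<gamma>: "\<gamma> \<in> \<Gamma>" "dist (p + \<gamma>) q < \<epsilon> / 2"
          by blast
        have pos: "0 < dist (p + \<gamma>) q"
          using orb_eq[of p \<gamma> q] \<gamma>(1) ne by auto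
        have "dist (p + \<gamma>) q \<le> dist (p + \<delta>) q" if "\<delta> \<in> \<Gamma>" for \<delta>
        proof (cases "\<delta> = \<gamma>")
          case False
          have "\<epsilon> \<le> norm (\<gamma> + - \<delta>)"
            using False cl(2)[OF \<gamma>(1) cl(3)[OF that]] by (intro \<epsilon>(2)) auto
          also have "\<dots> = dist (p + \<gamma>) (p + \<delta>)"
            by (simp add: dist_norm)
          also have "\<dots> \<le> dist (p + \<gamma>) q + dist (p + \<delta>) q"
            by (rule dist_triangle2)
          finally show ?thesis
            using \<gamma>(2) by simp
        qed simp
        then show ?thesis
          using pos by (intro exI[of _ "dist (p + \<gamma>) q / 2"]) auto
      next
        case False
        then show ?thesis
          using \<epsilon>(1) by (intro exI[of _ "\<epsilon> / 4"]) (auto simp: not_less)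
      qed
      then obtain \<delta> where \<delta>: "\<delta> > 0" "\<And>\<gamma>. \<gamma> \<in> \<Gamma> \<Longrightarrow> 2 * \<delta> \<le> dist (p + \<gamma>) q"
        by blast
      have "(\<lambda>x. x + \<gamma>) ` ball p \<delta> \<inter> ball q \<delta> = {}" if "\<gamma> \<in> \<Gamma>" for \<gamma>
      proof (rule ccontr)
        assume "(\<lambda>x. x + \<gamma>) ` ball p \<delta> \<inter> ball q \<delta> \<noteq> {}"
        then obtain x where x: "dist p x < \<delta>" "dist q (x + \<gamma>) < \<delta>"
          by auto
        have "dist (p + \<gamma>) q \<le> dist (p + \<gamma>) (x + \<gamma>) + dist q (x + \<gamma>)"
          by (rule dist_triangle2)
        then show False
          using x \<delta>(2)[OF that] by simp
      qed
      then show ?thesis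
        using \<delta>(1) by (intro exI[of _ "ball p \<delta>"] exI[of _ "ball q \<delta>"]) auto
    qed
  qed
qed

lemma smooth_manifold_torus: "is_lattice \<Gamma> \<Longrightarrow> smooth_manifold (torus \<Gamma>)"
  unfolding torus_def by (rule properly_discontinuous.smooth_manifold_Q[OF properly_discontinuous_translations])

text \<open>Transition maps are locally translations by lattice vectors. This is what allows
  components that are constant in the standard coordinates to define tensor fields on the
  torus.\<close>

lemma frechet_derivative_torus_transition:
  assumes \<Gamma>: "is_lattice \<Gamma>" and c: "c \<in> atlas (torus \<Gamma>)" "d \<in> atlas (torus \<Gamma>)" and P: "P \<in> fst c" "P \<in> fst d"
  shows "chart_deriv c (\<lambda>p. p) d P v = v"
proof -
  interpret properly_discontinuous euclidean_manifold "{(\<lambda>x. x + \<gamma>) | \<gamma>. \<gamma> \<in> \<Gamma>}"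
    by (rule properly_discontinuous_translations[OF \<Gamma>])
  have cd: "c \<in> atlas Q" "d \<in> atlas Q"
    using c unfolding torus_def by auto
  have E: "lift_chart c = (UNIV, \<lambda>x. x)" "lift_chart d = (UNIV, \<lambda>x. x)"
    using lift_chart_atlas[OF cd(1)] lift_chart_atlas[OF cd(2)] unfolding atlas_euclidean by auto
  obtain p h where h: "h \<in> {(\<lambda>x. x + \<gamma>) | \<gamma>. \<gamma> \<in> \<Gamma>}"
    "chart_deriv c (\<lambda>p. p) d P =
       chart_deriv (lift_chart c) h (lift_chart d) p"
    by (rule lift_overlap[OF cd P])
  then show ?thesis
    unfolding h(2) E local_rep_euclidean by (auto simp: frechet_derivative_translation)
qed

section \<open>The model structure\<close>

lemma multilinear2I:
  assumes "\<And>w. linear (\<lambda>u. B [u, w])" "\<And>w. linear (\<lambda>u. B [w, u])"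
  shows "multilinear 2 B"
  unfolding multilinear_def
proof (intro allI impI)
  fix vs :: "'a list" and i :: nat
  assume "length vs = 2" "i < 2"
  moreover from this obtain v w where "vs = [v, w]"
    by (auto simp: numeral_2_eq_2 length_Suc_conv)
  ultimately have "vs = [v, w]" "i = 0 \<or> i = 1"
    by auto
  then show "linear (\<lambda>u. B (vs[i := u]))"
    using assms by auto
qed

lemma multilinear2D:
  assumes "multilinear 2 B"
  shows "linear (\<lambda>u. B [u, w])" "linear (\<lambda>u. B [w, u])"
proof -
  have "linear (\<lambda>u. B (vs[i := u]))" if "length vs = 2" "i < 2" for vs i
    using assms that unfolding multilinear_def by blast
  from this[of "[0, w]" 0] this[of "[w, 0]" 1]
  show "linear (\<lambda>u. B [u, w])" "linear (\<lambda>u. B [w, u])"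
    by simp_all
qed

lemma multilinear3I:
  assumes "\<And>v w. linear (\<lambda>u. B [u, v, w])" "\<And>v w. linear (\<lambda>u. B [v, u, w])" "\<And>v w. linear (\<lambda>u. B [v, w, u])"
  shows "multilinear 3 B"
  unfolding multilinear_def
proof (intro allI impI)
  fix vs :: "'a list" and i :: nat
  assume "length vs = 3" "i < 3"
  moreover from this obtain v w x where "vs = [v, w, x]"
    by (auto simp: numeral_3_eq_3 length_Suc_conv)
  ultimately have "vs = [v, w, x]" "i = 0 \<or> i = 1 \<or> i = 2"
    by auto
  then show "linear (\<lambda>u. B (vs[i := u]))"
    using assms by auto
qed

text \<open>Torus, fibre and time components, used alike for points, for coordinates and for tangent
  vectors of (T x N) x R.\<close>

abbreviation (input) tor :: "('a \<times> 'b) \<times> real \<Rightarrow> 'a" where "tor w \<equiv> fst (fst w)"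
abbreviation (input) fib :: "('a \<times> 'b) \<times> real \<Rightarrow> 'b" where "fib w \<equiv> snd (fst w)"
abbreviation (input) tim :: "('a \<times> 'b) \<times> real \<Rightarrow> real" where "tim w \<equiv> snd w"

text \<open>The 3 x 3 determinant, that is, the form dx1 dx2 dx3.\<close>

definition vol3 :: "real^3 \<Rightarrow> real^3 \<Rightarrow> real^3 \<Rightarrow> real" where
  "vol3 u v w = u $ 1 * (v $ 2 * w $ 3 - v $ 3 * w $ 2) - v $ 1 * (u $ 2 * w $ 3 - u $ 3 * w $ 2) +
     w $ 1 * (u $ 2 * v $ 3 - u $ 3 * v $ 2)"

definition total_chart :: "('t, real^3) chart \<Rightarrow> ('n, 'e) chart \<Rightarrow> (('t \<times> 'n) \<times> real, ((real^3) \<times> 'e) \<times> real) chart" where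
  "total_chart a b = prod_chart (prod_chart a b) (UNIV, \<lambda>x. x)"

lemma mem_total_chart: "p \<in> fst (total_chart a b) \<longleftrightarrow> tor p \<in> fst a \<and> fib p \<in> fst b"
  by (cases p) (auto simp: total_chart_def)

lemma snd_total_chart: "snd (total_chart a b) p = ((snd a (tor p), snd b (fib p)), tim p)"
  by (cases p) (auto simp: total_chart_def)

lemma total_chart_image: "snd (total_chart a b) ` fst (total_chart a b) = ((snd a ` fst a) \<times> (snd b ` fst b)) \<times> UNIV"
proof -
  have "snd (total_chart a b) ` fst (total_chart a b) =
      map_prod (map_prod (snd a) (snd b)) (\<lambda>x. x) ` ((fst a \<times> fst b) \<times> UNIV)"
    by (simp add: total_chart_def)
  also have "\<dots> = ((snd a ` fst a) \<times> (snd b ` fst b)) \<times> UNIV"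
    by (simp only: map_prod_surj_on[OF map_prod_surj_on[OF refl refl] image_ident])
  finally show ?thesis .
qed

text \<open>The torus enters only through an atlas whose transition maps have identity derivative,
  so the model can be studied without reference to a lattice.\<close>

locale flat_kaehler_product =
  fixes T :: "('t, real^3) manifold" and N :: "('n, 'e::euclidean_space) manifold"
    and J :: "('n, 'e) endomorphism_field" and k \<omega> :: "('n, 'e) covariant_field" and \<mu> :: real
  assumes T: "smooth_manifold T"
    and flat: "c \<in> atlas T \<Longrightarrow> d \<in> atlas T \<Longrightarrow> p \<in> fst c \<Longrightarrow> p \<in> fst d \<Longrightarrow>
      chart_deriv c (\<lambda>p. p) d p v = v"
    and kaehler: "kaehler N J k \<omega>"
    and \<mu>: "\<mu> \<noteq> 0"
begin

abbreviation "M \<equiv> product_manifold (product_manifold T N) (euclidean_manifold :: (real, real) manifold)"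

lemma N: "smooth_manifold N"
  and J: "complex_structure N J"
  and k: "riemannian_metric N k"
  and kJ: "compatible_metric N k J"
  and \<omega>: "closed_form N 2 \<omega>"
  using kaehler by (auto simp: kaehler_def)

lemma TN: "smooth_manifold (product_manifold T N)"
  by (rule smooth_manifold_product[OF T N])

lemma M: "smooth_manifold M"
  by (rule smooth_manifold_product[OF TN smooth_manifold_euclidean])

lemma atlas_M: "c \<in> atlas M \<longleftrightarrow> (\<exists>a b. a \<in> atlas T \<and> b \<in> atlas N \<and> c = total_chart a b)"
  unfolding atlas_product atlas_euclidean total_chart_def by blast

text \<open>As in the case of quotients, the chart of \<open>N\<close> underlying a product chart is chosen.\<close>

definition fibre_chart :: "(('t \<times> 'n) \<times> real, ((real^3) \<times> 'e) \<times> real) chart \<Rightarrow> ('n, 'e) chart" where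
  "fibre_chart c = (SOME b. b \<in> atlas N \<and> (\<exists>a\<in>atlas T. c = total_chart a b))"

lemma chart_cases:
  assumes "c \<in> atlas M"
  obtains a b where "a \<in> atlas T" "b \<in> atlas N" "c = total_chart a b" "fibre_chart c = b"
proof -
  have "\<exists>b. b \<in> atlas N \<and> (\<exists>a\<in>atlas T. c = total_chart a b)"
    using assms unfolding atlas_M by blast
  from someI_ex[OF this] show ?thesis
    using that unfolding fibre_chart_def by blast
qed

text \<open>
  In the coordinates \<open>(x\<^sup>1, s)\<close> with \<open>s = e\<^sup>\<mu>\<^sup>t\<close> and \<open>(x\<^sup>2, x\<^sup>3)\<close>, the metric is
  \<open>s\<^sup>-\<^sup>2 ((dx\<^sup>1)\<^sup>2 + ds\<^sup>2) + s ((dx\<^sup>2)\<^sup>2 + (dx\<^sup>3)\<^sup>2) + k\<close> and the complex structure is constant, up to the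
  sign of its restriction to the \<open>(x\<^sup>1, s)\<close>-plane.
\<close>

definition metric :: "(('t \<times> 'n) \<times> real, ((real^3) \<times> 'e) \<times> real) covariant_field" where
  "metric c z vs = (let v = vs ! 0; w = vs ! 1 in
     exp ((- 2 * \<mu>) * tim z) * (tor v $ 1 * tor w $ 1) + \<mu>\<^sup>2 * (tim v * tim w) +
     exp (\<mu> * tim z) * (tor v $ 2 * tor w $ 2 + tor v $ 3 * tor w $ 3) +
     k (fibre_chart c) (fib z) [fib v, fib w])"

text \<open>Here \<open>s\<close> is a sign, 1 or -1, and not the exponential coordinate. The latter
  has differential \<open>\<mu> * exp (\<mu> * t)\<close> dt, which accounts for the factors that
  appear when the constant structure is written in terms of t.\<close>

definition cplx :: "real \<Rightarrow> (('t \<times> 'n) \<times> real, ((real^3) \<times> 'e) \<times> real) endomorphism_field" where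
  "cplx s c z v = ((vector [- s * \<mu> * exp (\<mu> * tim z) * tim v, - tor v $ 3, tor v $ 2],
     J (fibre_chart c) (fib z) (fib v)), s / \<mu> * exp ((- \<mu>) * tim z) * tor v $ 1)"

definition flux :: "(('t \<times> 'n) \<times> real, ((real^3) \<times> 'e) \<times> real) covariant_field" where
  "flux c z vs = - vol3 (tor (vs ! 0)) (tor (vs ! 1)) (tor (vs ! 2))"

text \<open>The fundamental form with its exponentials multiplied out, in the shape in which it is
  differentiated.\<close>

definition kform :: "real \<Rightarrow> (('t \<times> 'n) \<times> real, ((real^3) \<times> 'e) \<times> real) covariant_field" where
  "kform s c z vs = (let v = vs ! 0; w = vs ! 1 in
     s * \<mu> * exp ((- \<mu>) * tim z) * (tor v $ 1 * tim w - tim v * tor w $ 1) +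
     exp (\<mu> * tim z) * (tor v $ 2 * tor w $ 3 - tor v $ 3 * tor w $ 2) +
     \<omega> (fibre_chart c) (fib z) [fib v, fib w])"

lemma derivative_map:
  assumes \<sigma>: "smooth_map T T \<sigma>" and \<theta>: "smooth_map N N \<theta>"
    and ab: "a \<in> atlas T" "a' \<in> atlas T" "b \<in> atlas N" "b' \<in> atlas N"
    and p: "p \<in> fst (total_chart a b)" "map_prod (map_prod \<sigma> \<theta>) (\<lambda>t. t + r) p \<in> fst (total_chart a' b')"
  shows "frechet_derivative (local_rep (total_chart a b) (map_prod (map_prod \<sigma> \<theta>) (\<lambda>t. t + r)) (total_chart a' b'))
      (at (snd (total_chart a b) p)) =
    map_prod (map_prod (chart_deriv a \<sigma> a' (tor p))
      (chart_deriv b \<theta> b' (fib p))) (\<lambda>t. t)"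
proof -
  note ch = smooth_manifold_chart[OF T ab(1)] smooth_manifold_chart[OF N ab(3)]
  have q: "tor p \<in> fst a" "fib p \<in> fst b" "\<sigma> (tor p) \<in> fst a'" "\<theta> (fib p) \<in> fst b'"
    using p by (cases p; auto simp: mem_total_chart)+
  have E: "is_chart euclidean (UNIV, \<lambda>x :: real. x)"
    using smooth_manifold_chart[OF smooth_manifold_euclidean] by (auto simp: atlas_euclidean)
  have D: "local_rep (prod_chart a b) (map_prod \<sigma> \<theta>) (prod_chart a' b') differentiable (at (snd (prod_chart a b) (fst p)))"
    by (rule smooth_map_differentiable[OF TN TN smooth_map_product[OF T N T N \<sigma> \<theta>] atlas_productI[OF ab(1,3)]
          atlas_productI[OF ab(2,4)]]) (use q in \<open>auto simp: mem_Times_iff\<close>)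
  have "frechet_derivative (local_rep (total_chart a b) (map_prod (map_prod \<sigma> \<theta>) (\<lambda>t. t + r)) (total_chart a' b'))
      (at (snd (prod_chart a b) (fst p), snd (UNIV :: real set, \<lambda>x. x) (snd p))) =
    map_prod (chart_deriv (prod_chart a b) (map_prod \<sigma> \<theta>) (prod_chart a' b') (fst p))
      (frechet_derivative (local_rep (UNIV, \<lambda>x. x) (\<lambda>t. t + r) (UNIV, \<lambda>x. x)) (at (snd (UNIV :: real set, \<lambda>x. x) (snd p))))"
    unfolding total_chart_def
    by (rule frechet_derivative_local_rep_prod[OF is_chart_prod[OF ch] E _ _ D])
      (use q in \<open>auto simp: mem_Times_iff local_rep_euclidean\<close>)
  moreover have "frechet_derivative (local_rep (prod_chart a b) (map_prod \<sigma> \<theta>) (prod_chart a' b'))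
      (at (snd a (tor p), snd b (fib p))) =
    map_prod (chart_deriv a \<sigma> a' (tor p))
      (chart_deriv b \<theta> b' (fib p))"
    by (rule frechet_derivative_local_rep_prod[OF ch q(1,2) smooth_map_differentiable[OF T T \<sigma> ab(1,2) q(1,3)]
          smooth_map_differentiable[OF N N \<theta> ab(3,4) q(2,4)]])
  ultimately show ?thesis
    by (simp add: snd_total_chart local_rep_euclidean frechet_derivative_translation map_prod_def case_prod_beta')
qed

text \<open>The time shift \<open>r\<close> is a parameter so that one computation serves both the
  gluing map, with \<open>r = 1\<close>, and the identity, with \<open>r = 0\<close>, \<alpha> = 1
  and \<beta> = 0. P2 and P3 describe multiplication by the complex number \<alpha> + i \<beta>, and
  \<open>norm\<close> matches its squared modulus to the growth of the weight on the (x2,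
  x3)-plane.\<close>

context
  fixes \<sigma> \<theta> r \<alpha> \<beta>
  assumes \<sigma>: "smooth_map T T \<sigma>" and \<theta>: "smooth_map N N \<theta>"
    and P1: "\<And>c d p u. c \<in> atlas T \<Longrightarrow> d \<in> atlas T \<Longrightarrow> p \<in> fst c \<Longrightarrow> \<sigma> p \<in> fst d \<Longrightarrow>
      chart_deriv c \<sigma> d p u $ 1 = exp (\<mu> * r) * u $ 1"
    and P2: "\<And>c d p u. c \<in> atlas T \<Longrightarrow> d \<in> atlas T \<Longrightarrow> p \<in> fst c \<Longrightarrow> \<sigma> p \<in> fst d \<Longrightarrow>
      chart_deriv c \<sigma> d p u $ 2 = \<alpha> * u $ 2 - \<beta> * u $ 3"
    and P3: "\<And>c d p u. c \<in> atlas T \<Longrightarrow> d \<in> atlas T \<Longrightarrow> p \<in> fst c \<Longrightarrow> \<sigma> p \<in> fst d \<Longrightarrow>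
      chart_deriv c \<sigma> d p u $ 3 = \<beta> * u $ 2 + \<alpha> * u $ 3"
    and norm: "\<alpha> * \<alpha> + \<beta> * \<beta> = exp (- (\<mu> * r))"
    and \<theta>J: "intertwines N N \<theta> J J" and \<theta>k: "pullback_eq N N \<theta> 2 k k"
begin

abbreviation "F \<equiv> map_prod (map_prod \<sigma> \<theta>) (\<lambda>t. t + r)"

lemma conformal: "exp (\<mu> * r) * (\<alpha> * \<alpha> + \<beta> * \<beta>) = 1"
  by (simp add: norm exp_minus)

lemma map_cases:
  assumes *: "c \<in> atlas M" "d \<in> atlas M" "p \<in> fst c" "F p \<in> fst d"
  obtains a b a' b' x y t where
    "a \<in> atlas T" "b \<in> atlas N" "c = total_chart a b" "fibre_chart c = b"
    "a' \<in> atlas T" "b' \<in> atlas N" "d = total_chart a' b'" "fibre_chart d = b'"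
    "p = ((x, y), t)" "x \<in> fst a" "y \<in> fst b" "\<sigma> x \<in> fst a'" "\<theta> y \<in> fst b'"
    "chart_deriv c F d p =
      map_prod (map_prod (chart_deriv a \<sigma> a' x)
        (chart_deriv b \<theta> b' y)) (\<lambda>t. t)"
proof -
  obtain a b where c: "a \<in> atlas T" "b \<in> atlas N" "c = total_chart a b" "fibre_chart c = b"
    by (rule chart_cases[OF *(1)])
  obtain a' b' where d: "a' \<in> atlas T" "b' \<in> atlas N" "d = total_chart a' b'" "fibre_chart d = b'"
    by (rule chart_cases[OF *(2)])
  obtain x y t where p: "p = ((x, y), t)"
    by (metis prod.collapse)
  have q: "x \<in> fst a" "y \<in> fst b" "\<sigma> x \<in> fst a'" "\<theta> y \<in> fst b'"
    using *(3,4) by (auto simp: c(3) d(3) p mem_total_chart)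
  let ?A = "chart_deriv a \<sigma> a' x"
  let ?B = "chart_deriv b \<theta> b' y"
  have D: "chart_deriv c F d p = map_prod (map_prod ?A ?B) (\<lambda>t. t)"
    using derivative_map[OF \<sigma> \<theta> c(1) d(1) c(2) d(2)] *(3,4) by (simp add: c(3) d(3) p)
  show ?thesis
    using that[OF c d p q D] .
qed

text \<open>The summands are invariant one by one. The shift multiplies the weight of the first
  coordinate by e^(-2 \<mu> r), against e^(2 \<mu> r) from the derivative; on the plane the weight
  grows by e^(\<mu> r), against the squared modulus e^(-\<mu> r) of \<alpha> + i \<beta>.\<close>

lemma metric_invariant: "pullback_eq M M F 2 metric metric"
  unfolding pullback_eq_def
proof (intro ballI allI impI)
  fix c d p and vs :: "(((real^3) \<times> 'e) \<times> real) list"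
  assume *: "c \<in> atlas M" "d \<in> atlas M" "p \<in> fst c" "F p \<in> fst d" "length vs = 2"
  obtain a b a' b' x y t where
    c: "a \<in> atlas T" "b \<in> atlas N" "c = total_chart a b" "fibre_chart c = b"
    and d: "a' \<in> atlas T" "b' \<in> atlas N" "d = total_chart a' b'" "fibre_chart d = b'"
    and p: "p = ((x, y), t)"
    and q: "x \<in> fst a" "y \<in> fst b" "\<sigma> x \<in> fst a'" "\<theta> y \<in> fst b'"
    and D: "chart_deriv c F d p =
      map_prod (map_prod (chart_deriv a \<sigma> a' x)
        (chart_deriv b \<theta> b' y)) (\<lambda>t. t)"
    by (rule map_cases[OF *(1-4)])
  let ?A = "chart_deriv a \<sigma> a' x"
  let ?B = "chart_deriv b \<theta> b' y"
  obtain v w where vs: "vs = [v, w]"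
    using *(5) by (auto simp: numeral_2_eq_2 length_Suc_conv)
  have kk: "k b' (snd b' (\<theta> y)) [?B (fib v), ?B (fib w)] = k b (snd b y) [fib v, fib w]"
    using pullback_eqD[OF \<theta>k c(2) d(2) q(2,4), of "[fib v, fib w]"] by simp
  have e1: "exp (- (2 * \<mu> * (t + r))) * (exp (\<mu> * r) * exp (\<mu> * r)) = exp (- (2 * \<mu> * t))"
    by (simp add: exp_add[symmetric] algebra_simps)
  have e2: "exp (\<mu> * (t + r)) = exp (\<mu> * t) * exp (\<mu> * r)"
    by (simp add: exp_add[symmetric] algebra_simps)
  have "exp (- (2 * \<mu> * (t + r))) * (exp (\<mu> * r) * tor v $ 1 * (exp (\<mu> * r) * tor w $ 1)) =
      exp (- (2 * \<mu> * t)) * (tor v $ 1 * tor w $ 1)"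
    unfolding e1[symmetric] by (simp add: algebra_simps)
  moreover have "exp (\<mu> * (t + r)) * ((\<alpha> * tor v $ 2 - \<beta> * tor v $ 3) * (\<alpha> * tor w $ 2 - \<beta> * tor w $ 3) +
        (\<beta> * tor v $ 2 + \<alpha> * tor v $ 3) * (\<beta> * tor w $ 2 + \<alpha> * tor w $ 3)) =
      exp (\<mu> * t) * (exp (\<mu> * r) * (\<alpha> * \<alpha> + \<beta> * \<beta>)) * (tor v $ 2 * tor w $ 2 + tor v $ 3 * tor w $ 3)"
    unfolding e2 by algebra
  ultimately show "metric d (snd d (F p)) (map (chart_deriv c F d p) vs) =
      metric c (snd c p) vs"
    unfolding D vs conformal
    by (simp add: metric_def c(3,4) d(3,4) p snd_total_chart kk P1[OF c(1) d(1) q(1,3)] P2[OF c(1) d(1) q(1,3)]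
        P3[OF c(1) d(1) q(1,3)] c(4)[unfolded c(3)] d(4)[unfolded d(3)])
qed

text \<open>On the (x2, x3)-plane, multiplication by \<alpha> + i \<beta> commutes with
  multiplication by i. In the other plane the scaling of x1 by e^(\<mu> r) is exactly the change of
  the exponentials under the time shift.\<close>

lemma cplx_invariant: "intertwines M M F (cplx s) (cplx s)"
  unfolding intertwines_def
proof (intro ballI allI impI)
  fix c d p and v :: "((real^3) \<times> 'e) \<times> real"
  assume *: "c \<in> atlas M" "d \<in> atlas M" "p \<in> fst c" "F p \<in> fst d"
  obtain a b a' b' x y t where
    c: "a \<in> atlas T" "b \<in> atlas N" "c = total_chart a b" "fibre_chart c = b"
    and d: "a' \<in> atlas T" "b' \<in> atlas N" "d = total_chart a' b'" "fibre_chart d = b'"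
    and p: "p = ((x, y), t)"
    and q: "x \<in> fst a" "y \<in> fst b" "\<sigma> x \<in> fst a'" "\<theta> y \<in> fst b'"
    and D: "chart_deriv c F d p =
      map_prod (map_prod (chart_deriv a \<sigma> a' x)
        (chart_deriv b \<theta> b' y)) (\<lambda>t. t)"
    by (rule map_cases[OF *(1-4)])
  let ?A = "chart_deriv a \<sigma> a' x"
  let ?B = "chart_deriv b \<theta> b' y"
  have JJ: "?B (J b (snd b y) (fib v)) = J b' (snd b' (\<theta> y)) (?B (fib v))"
    by (rule intertwinesD[OF \<theta>J c(2) d(2) q(2,4)])
  have e1: "exp (- (\<mu> * (t + r))) * exp (\<mu> * r) = exp (- (\<mu> * t))"
    by (simp add: exp_add[symmetric] algebra_simps)
  have e2: "exp (\<mu> * (t + r)) = exp (\<mu> * t) * exp (\<mu> * r)"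
    by (simp add: exp_add[symmetric] algebra_simps)
  have "?A (vector [- s * \<mu> * exp (\<mu> * t) * tim v, - tor v $ 3, tor v $ 2]) =
      vector [- s * \<mu> * exp (\<mu> * (t + r)) * tim v, - ?A (tor v) $ 3, ?A (tor v) $ 2]"
    unfolding vec_eq_iff forall_3 e2
    by (simp add: P1[OF c(1) d(1) q(1,3)] P2[OF c(1) d(1) q(1,3)] P3[OF c(1) d(1) q(1,3)])
  moreover have "s / \<mu> * exp (- (\<mu> * t)) * tor v $ 1 = s / \<mu> * exp (- (\<mu> * (t + r))) * ?A (tor v) $ 1"
    unfolding e1[symmetric] by (simp add: P1[OF c(1) d(1) q(1,3)])
  ultimately show "chart_deriv c F d p (cplx s c (snd c p) v) =
      cplx s d (snd d (F p)) (chart_deriv c F d p v)"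
    unfolding D by (simp add: cplx_def p snd_total_chart c(3) d(3) c(4)[unfolded c(3)] d(4)[unfolded d(3)] JJ)
qed

text \<open>The derivative on the torus has determinant
  \<open>exp (\<mu> * r) * (\<alpha> * \<alpha> + \<beta> * \<beta>)\<close>, which is 1.\<close>

lemma flux_invariant: "pullback_eq M M F 3 flux flux"
  unfolding pullback_eq_def
proof (intro ballI allI impI)
  fix c d p and vs :: "(((real^3) \<times> 'e) \<times> real) list"
  assume *: "c \<in> atlas M" "d \<in> atlas M" "p \<in> fst c" "F p \<in> fst d" "length vs = 3"
  obtain a b a' b' x y t where
    c: "a \<in> atlas T" "b \<in> atlas N" "c = total_chart a b" "fibre_chart c = b"
    and d: "a' \<in> atlas T" "b' \<in> atlas N" "d = total_chart a' b'" "fibre_chart d = b'"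
    and p: "p = ((x, y), t)"
    and q: "x \<in> fst a" "y \<in> fst b" "\<sigma> x \<in> fst a'" "\<theta> y \<in> fst b'"
    and D: "chart_deriv c F d p =
      map_prod (map_prod (chart_deriv a \<sigma> a' x)
        (chart_deriv b \<theta> b' y)) (\<lambda>t. t)"
    by (rule map_cases[OF *(1-4)])
  let ?A = "chart_deriv a \<sigma> a' x"
  obtain u v w where vs: "vs = [u, v, w]"
    using *(5) by (auto simp: numeral_3_eq_3 length_Suc_conv)
  have "vol3 (?A (tor u)) (?A (tor v)) (?A (tor w)) =
      exp (\<mu> * r) * (\<alpha> * \<alpha> + \<beta> * \<beta>) * vol3 (tor u) (tor v) (tor w)"
    unfolding vol3_def P1[OF c(1) d(1) q(1,3)] P2[OF c(1) d(1) q(1,3)] P3[OF c(1) d(1) q(1,3)] by algebra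
  then show "flux d (snd d (F p)) (map (chart_deriv c F d p) vs) =
      flux c (snd c p) vs"
    unfolding D vs conformal by (simp add: flux_def)
qed

end

section \<open>The Riemannian metric and the almost complex structures\<close>

lemma chart_domain_cases:
  assumes "c \<in> atlas M" "z \<in> snd c ` fst c"
  shows "fibre_chart c \<in> atlas N" "fib z \<in> snd (fibre_chart c) ` fst (fibre_chart c)"
proof -
  obtain a b where c: "a \<in> atlas T" "b \<in> atlas N" "c = total_chart a b" "fibre_chart c = b"
    by (rule chart_cases[OF assms(1)])
  show "fibre_chart c \<in> atlas N"
    unfolding c(4) by (rule c(2))
  show "fib z \<in> snd (fibre_chart c) ` fst (fibre_chart c)"
    unfolding c(4) using assms(2) unfolding c(3) total_chart_image by auto
qed

lemma open_domain: "c \<in> atlas M \<Longrightarrow> open (snd c ` fst c)"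
  by (rule smooth_manifold_open_image[OF M])

lemma smooth_on_exp_tim: "c \<in> atlas M \<Longrightarrow> smooth_on (snd c ` fst c) (\<lambda>z. exp (a * tim z))"
  by (rule smooth_on_compose[OF open_domain open_UNIV])
    (auto simp: smooth_on_def C_on_exp open_domain intro!: C_on_bounded_linear bounded_linear_snd)

lemma smooth_on_fib:
  assumes c: "c \<in> atlas M" and f: "smooth_on (snd (fibre_chart c) ` fst (fibre_chart c)) f"
  shows "smooth_on (snd c ` fst c) (\<lambda>z. f (fib z))"
proof (rule smooth_on_compose[OF open_domain[OF c] _ _ _ f])
  show "smooth_on (snd c ` fst c) fib"
    by (rule smooth_on_bounded_linear[OF open_domain[OF c]])
      (rule bounded_linear_compose[OF bounded_linear_snd bounded_linear_fst])
  show "open (snd (fibre_chart c) ` fst (fibre_chart c))"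
    using chart_cases[OF c] smooth_manifold_open_image[OF N] by metis
  show "fib ` snd c ` fst c \<subseteq> snd (fibre_chart c) ` fst (fibre_chart c)"
    using chart_domain_cases(2)[OF c] by blast
qed

lemma J_linear: "b \<in> atlas N \<Longrightarrow> y \<in> snd b ` fst b \<Longrightarrow> linear (J b y)"
  and J_square: "b \<in> atlas N \<Longrightarrow> y \<in> snd b ` fst b \<Longrightarrow> J b y (J b y v) = - v"
  and J_smooth: "b \<in> atlas N \<Longrightarrow> smooth_on (snd b ` fst b) (\<lambda>y. J b y v)"
  and J_intertwines: "intertwines N N (\<lambda>p. p) J J"
  using J unfolding complex_structure_def almost_complex_structure_def endomorphism_tensor_def by blast+

lemma k_multilinear: "b \<in> atlas N \<Longrightarrow> y \<in> snd b ` fst b \<Longrightarrow> multilinear 2 (k b y)"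
  and k_smooth: "b \<in> atlas N \<Longrightarrow> smooth_on (snd b ` fst b) (\<lambda>y. k b y [v, w])"
  and k_pullback: "pullback_eq N N (\<lambda>p. p) 2 k k"
  and k_sym: "b \<in> atlas N \<Longrightarrow> y \<in> snd b ` fst b \<Longrightarrow> k b y [v, w] = k b y [w, v]"
  and k_pos: "b \<in> atlas N \<Longrightarrow> y \<in> snd b ` fst b \<Longrightarrow> v \<noteq> 0 \<Longrightarrow> 0 < k b y [v, v]"
proof -
  have cov: "covariant_tensor N 2 k"
    using k by (simp add: riemannian_metric_def)
  show "smooth_on (snd b ` fst b) (\<lambda>y. k b y [v, w])" if "b \<in> atlas N"
  proof -
    have "length [v, w] = 2"
      by simp
    then show ?thesis
      using cov \<open>b \<in> atlas N\<close> unfolding covariant_tensor_def by blast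
  qed
  show "b \<in> atlas N \<Longrightarrow> y \<in> snd b ` fst b \<Longrightarrow> multilinear 2 (k b y)" "pullback_eq N N (\<lambda>p. p) 2 k k"
    using cov unfolding covariant_tensor_def by blast+
  show "b \<in> atlas N \<Longrightarrow> y \<in> snd b ` fst b \<Longrightarrow> k b y [v, w] = k b y [w, v]"
    "b \<in> atlas N \<Longrightarrow> y \<in> snd b ` fst b \<Longrightarrow> v \<noteq> 0 \<Longrightarrow> 0 < k b y [v, v]"
    using k unfolding riemannian_metric_def by blast+
qed

lemma k_linear:
  assumes "b \<in> atlas N" "y \<in> snd b ` fst b"
  shows "linear (\<lambda>v. k b y [v, w])" "linear (\<lambda>v. k b y [w, v])"
  by (rule multilinear2D[OF k_multilinear[OF assms]])+

lemma k_J: "b \<in> atlas N \<Longrightarrow> y \<in> snd b ` fst b \<Longrightarrow> k b y [J b y v, J b y w] = k b y [v, w]"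
  using kJ unfolding compatible_metric_def by blast

lemma \<omega>_eq:
  assumes "b \<in> atlas N" "y \<in> snd b ` fst b"
  shows "\<omega> b y [v, w] = k b y [J b y v, w]"
proof -
  have "length [v, w] = 2"
    by simp
  then have "\<omega> b y [v, w] = fundamental_form k J b y [v, w]"
    using kaehler assms unfolding kaehler_def field_eq_def by blast
  then show ?thesis
    by (simp add: fundamental_form_def)
qed

text \<open>The transformation laws of the model are the special case of the identity map.\<close>

lemma ident_invariant:
  shows "pullback_eq M M (\<lambda>p. p) 2 metric metric"
    and "intertwines M M (\<lambda>p. p) (cplx s) (cplx s)"
    and "pullback_eq M M (\<lambda>p. p) 3 flux flux"
proof -
  have eq: "map_prod (map_prod (\<lambda>p. p) (\<lambda>p. p)) (\<lambda>t :: real. t + 0) = (\<lambda>p. p)"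
    by (simp add: fun_eq_iff)
  note ids = smooth_map_ident[OF T] smooth_map_ident[OF N]
  show "pullback_eq M M (\<lambda>p. p) 2 metric metric"
    using metric_invariant[OF ids, of 0 1 0, unfolded eq] by (simp add: flat J_intertwines k_pullback)
  show "intertwines M M (\<lambda>p. p) (cplx s) (cplx s)"
    using cplx_invariant[OF ids, of 0 1 0, unfolded eq] by (simp add: flat J_intertwines k_pullback)
  show "pullback_eq M M (\<lambda>p. p) 3 flux flux"
    using flux_invariant[OF ids, of 0 1 0, unfolded eq] by (simp add: flat J_intertwines k_pullback)
qed

lemma metric_apply: "metric c z [v, w] =
     exp ((- 2 * \<mu>) * tim z) * (tor v $ 1 * tor w $ 1) + \<mu>\<^sup>2 * (tim v * tim w) +
     exp (\<mu> * tim z) * (tor v $ 2 * tor w $ 2 + tor v $ 3 * tor w $ 3) +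
     k (fibre_chart c) (fib z) [fib v, fib w]"
  by (simp add: metric_def)

lemma riemannian_metric: "riemannian_metric M metric"
  unfolding riemannian_metric_def covariant_tensor_def
proof (intro conjI ballI allI impI)
  show "pullback_eq M M (\<lambda>p. p) 2 metric metric"
    by (rule ident_invariant)
  fix c assume c: "c \<in> atlas M"
  show "smooth_on (snd c ` fst c) (\<lambda>z. metric c z vs)" if vs: "length vs = 2" for vs
  proof -
    obtain v w where vw: "vs = [v, w]"
      using vs by (auto simp: numeral_2_eq_2 length_Suc_conv)
    have "fibre_chart c \<in> atlas N"
      using chart_cases[OF c] by metis
    then show ?thesis
      unfolding vw metric_apply
      by (intro smooth_on_add smooth_on_mult smooth_on_const smooth_on_exp_tim c open_domain
          smooth_on_fib[OF c] k_smooth)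
  qed
  fix z assume z: "z \<in> snd c ` fst c"
  note b = chart_domain_cases[OF c z]
  note kl = k_linear[OF b]
  show "multilinear 2 (metric c z)"
  proof (rule multilinear2I)
    show "linear (\<lambda>u. metric c z [u, w])" for w
      unfolding metric_apply
      by (rule linearI) (simp_all add: linear_add[OF kl(1)] linear_scale[OF kl(1)] algebra_simps)
    show "linear (\<lambda>u. metric c z [w, u])" for w
      unfolding metric_apply
      by (rule linearI) (simp_all add: linear_add[OF kl(2)] linear_scale[OF kl(2)] algebra_simps)
  qed
  show "metric c z [u, v] = metric c z [v, u]" for u v
    unfolding metric_apply using k_sym[OF b] by (simp add: mult.commute)
  show "0 < metric c z [u, u]" if u: "u \<noteq> 0" for u
  proof -
    let ?a = "exp ((- 2 * \<mu>) * tim z) * (tor u $ 1 * tor u $ 1)" and ?b = "\<mu>\<^sup>2 * (tim u * tim u)"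
    let ?c = "exp (\<mu> * tim z) * (tor u $ 2 * tor u $ 2 + tor u $ 3 * tor u $ 3)"
    let ?k = "k (fibre_chart c) (fib z) [fib u, fib u]"
    have nn: "0 \<le> ?a" "0 \<le> ?b" "0 \<le> ?c"
      by simp_all
    have k0: "k (fibre_chart c) (fib z) [0, 0] = 0"
      by (rule linear_0[OF kl(1)])
    show ?thesis
    proof (cases "fib u = 0")
      case False
      then show ?thesis
        using nn k_pos[OF b False] unfolding metric_apply by linarith
    next
      case True
      then have "tim u \<noteq> 0 \<or> tor u $ 1 \<noteq> 0 \<or> tor u $ 2 \<noteq> 0 \<or> tor u $ 3 \<noteq> 0"
        using u by (cases u) (auto simp: vec_eq_iff forall_3 zero_prod_def)
      moreover have "0 < ?b" if "tim u \<noteq> 0"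
        using that \<mu> by (auto simp: zero_less_mult_iff neq_iff)
      moreover have "0 < ?a" if "tor u $ 1 \<noteq> 0"
        using that by (auto simp: zero_less_mult_iff neq_iff)
      moreover have "0 < ?c" if "tor u $ 2 \<noteq> 0 \<or> tor u $ 3 \<noteq> 0"
        using that sum_squares_gt_zero_iff[of "tor u $ 2" "tor u $ 3"] by simp
      ultimately have "0 < ?a + ?b + ?c"
        using nn by (smt (verit))
      then show ?thesis
        using True k0 unfolding metric_apply by simp
    qed
  qed
qed

lemma exp_cancel: "exp (\<mu> * t) * exp ((- \<mu>) * t) = 1" "exp ((- \<mu>) * t) * exp (\<mu> * t) = 1"
  "exp ((- 2 * \<mu>) * t) = exp ((- \<mu>) * t) * exp ((- \<mu>) * t)"
  by (simp_all add: exp_add[symmetric])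

lemma cplx_linear:
  assumes "c \<in> atlas M" "z \<in> snd c ` fst c"
  shows "linear (cplx s c z)"
proof -
  have lJ: "linear (J (fibre_chart c) (fib z))"
    by (rule J_linear[OF chart_domain_cases[OF assms]])
  show ?thesis
    by (rule linearI)
      (simp_all add: cplx_def linear_add[OF lJ] linear_scale[OF lJ] vec_eq_iff forall_3 algebra_simps)
qed

lemma cplx_square:
  assumes "c \<in> atlas M" "z \<in> snd c ` fst c" "s * s = 1"
  shows "cplx s c z (cplx s c z v) = - v"
proof -
  have "s * (s * x) = x" for x
    using assms(3) by (metis mult.assoc mult_1)
  then show ?thesis
    using \<mu> exp_cancel[of "tim z"]
    by (cases v) (auto simp: cplx_def J_square[OF chart_domain_cases[OF assms(1,2)]] vec_eq_iff forall_3 algebra_simps)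
qed

lemma inv_cplx:
  assumes "c \<in> atlas M" "z \<in> snd c ` fst c" "s * s = 1"
  shows "inv (cplx s c z) = (\<lambda>v. - cplx s c z v)"
  by (rule inv_unique_comp)
    (auto simp: fun_eq_iff cplx_square[OF assms] linear_neg[OF cplx_linear[OF assms(1,2)]])

lemma cplx_components:
  "tor (cplx s c z v) $ 1 = - s * \<mu> * exp (\<mu> * tim z) * tim v"
  "tor (cplx s c z v) $ 2 = - tor v $ 3" "tor (cplx s c z v) $ 3 = tor v $ 2"
  "fib (cplx s c z v) = J (fibre_chart c) (fib z) (fib v)"
  "tim (cplx s c z v) = s / \<mu> * exp ((- \<mu>) * tim z) * tor v $ 1"
  by (simp_all add: cplx_def)

lemma metric_cplx:
  assumes "c \<in> atlas M" "z \<in> snd c ` fst c" "s * s = 1"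
  shows "metric c z [cplx s c z v, cplx s c z w] = metric c z [v, w]"
proof -
  \<comment> \<open>With e and f for the two exponentials, all that matters is e f = 1; the
    structure then exchanges the contributions of the x1 and the time components.\<close>
  have "f * f * (- s * \<mu> * e * a * (- s * \<mu> * e * b)) + \<mu>\<^sup>2 * (s / \<mu> * f * c * (s / \<mu> * f * d)) =
      f * f * (c * d) + \<mu>\<^sup>2 * (a * b)" if "e * f = 1" for e f a b c d :: real
  proof -
    have "f * f * (- s * \<mu> * e * a * (- s * \<mu> * e * b)) = (s * s) * (e * f) * (e * f) * (\<mu>\<^sup>2 * (a * b))"
      by algebra
    moreover have "\<mu>\<^sup>2 * (s / \<mu> * f * c * (s / \<mu> * f * d)) = (s * s) * (f * f * (c * d))"
      using \<mu> by (simp add: power2_eq_square)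
    ultimately show ?thesis
      unfolding that assms(3) by simp
  qed
  note * = this[OF exp_cancel(1)[of "tim z"]]
  show ?thesis
    unfolding metric_apply cplx_components k_J[OF chart_domain_cases[OF assms(1,2)]] exp_cancel(3)
    by (simp only: * minus_mult_minus add.commute[of "tor v $ 3 * tor w $ 3"])
qed

lemma compatible_metric: "s * s = 1 \<Longrightarrow> compatible_metric M metric (cplx s)"
  unfolding compatible_metric_def using metric_cplx by blast

lemma almost_complex_structure:
  assumes "s * s = 1"
  shows "almost_complex_structure M (cplx s)"
  unfolding almost_complex_structure_def endomorphism_tensor_def
proof (intro conjI ballI allI)
  show "intertwines M M (\<lambda>p. p) (cplx s) (cplx s)"
    by (rule ident_invariant)
  fix c assume c: "c \<in> atlas M"
  show "linear (cplx s c z)" "cplx s c z (cplx s c z v) = - v" if "z \<in> snd c ` fst c" for z v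
    using c that assms by (simp_all add: cplx_linear cplx_square)
  show "smooth_on (snd c ` fst c) (\<lambda>z. cplx s c z v)" for v
  proof -
    have b: "fibre_chart c \<in> atlas N"
      using chart_cases[OF c] by metis
    \<comment> \<open>Only the first entry varies with the point. Splitting it off as a scalar times
      a constant vector makes the closure rules for smooth functions applicable.\<close>
    have *: "vector [x, y, y'] = x *\<^sub>R axis 1 1 + (vector [0, y, y'] :: real^3)" for x y y' :: real
      by (simp add: vec_eq_iff forall_3 axis_def)
    show ?thesis
      unfolding cplx_def *[of "- s * \<mu> * exp _ * _"]
      by (intro smooth_on_Pair smooth_on_add smooth_on_scaleR smooth_on_mult smooth_on_const smooth_on_exp_tim c
          open_domain smooth_on_fib[OF c] J_smooth[OF b])
  qed
qed

text \<open>In the plane of x1 and time the two structures are multiples of one and the same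
  endomorphism; on the complement they coincide.\<close>

lemma split_structure: "split_structure M (cplx s) (cplx s')"
  unfolding split_structure_def
proof (intro ballI allI)
  fix c z and v :: "((real^3) \<times> 'e) \<times> real"
  show "cplx s c z (cplx s' c z v) = cplx s' c z (cplx s c z v)"
    by (simp add: cplx_def vec_eq_iff forall_3 mult.left_commute mult.commute)
qed

section \<open>Fundamental forms and their torsion\<close>

lemma fundamental_form_apply:
  assumes "c \<in> atlas M" "z \<in> snd c ` fst c"
  shows "fundamental_form metric (cplx s) c z [v, w] = kform s c z [v, w]"
proof -
  have "f * f * (- s * \<mu> * e * a * b) + \<mu>\<^sup>2 * (s / \<mu> * f * c * d) = s * \<mu> * f * (c * d - a * b)"
    if "e * f = 1" for e f a b c d :: real
  proof -
    have "f * f * (- s * \<mu> * e * a * b) = (e * f) * (- s * \<mu> * f * (a * b))"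
      by algebra
    moreover have "\<mu>\<^sup>2 * (s / \<mu> * f * c * d) = s * \<mu> * f * (c * d)"
      using \<mu> by (simp add: power2_eq_square)
    ultimately show ?thesis
      unfolding that by (simp add: algebra_simps)
  qed
  note * = this[OF exp_cancel(1)[of "tim z"]]
  show ?thesis
    unfolding fundamental_form_def nth_Cons_0 nth_Cons_Suc One_nat_def metric_apply cplx_components exp_cancel(3) *
    by (simp add: kform_def \<omega>_eq[OF chart_domain_cases[OF assms]])
qed

text \<open>By compatibility the fundamental form is of type (1,1), so the structure acts trivially
  on it and \<open>dc\<close> reduces to the exterior derivative followed by the inverse
  action.\<close>

lemma act_on_fundamental_form:
  assumes "c \<in> atlas M" "z \<in> snd c ` fst c" "s * s = 1"
  shows "act_on_form (cplx s) (fundamental_form metric (cplx s)) c z [v, w] = kform s c z [v, w]"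
  unfolding fundamental_form_apply[OF assms(1,2), symmetric]
  by (simp add: act_on_form_def fundamental_form_def metric_cplx[OF assms])

lemma \<omega>_differentiable:
  assumes "b \<in> atlas N" "y \<in> snd b ` fst b"
  shows "(\<lambda>y. \<omega> b y [v, w]) differentiable (at y)"
proof -
  have "length [v, w] = 2"
    by simp
  then have "smooth_on (snd b ` fst b) (\<lambda>y. \<omega> b y [v, w])"
    using \<omega> assms(1) unfolding closed_form_def differential_form_def covariant_tensor_def by blast
  then show ?thesis
    using smooth_on_differentiable smooth_manifold_open_image[OF N assms(1)] assms(2) by blast
qed

text \<open>For fixed vectors only the exponentials and the components of \<omega> vary, so the
  derivative has one part along time and one along the fibre.\<close>

lemma frechet_derivative_kform:
  assumes c: "c \<in> atlas M" and z: "z \<in> snd c ` fst c" and s: "s * s = 1"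
  shows "frechet_derivative (\<lambda>y. act_on_form (cplx s) (fundamental_form metric (cplx s)) c y [v, w]) (at z) u =
    (- (s * \<mu>\<^sup>2) * exp ((- \<mu>) * tim z) * (tor v $ 1 * tim w - tim v * tor w $ 1) +
     \<mu> * exp (\<mu> * tim z) * (tor v $ 2 * tor w $ 3 - tor v $ 3 * tor w $ 2)) * tim u +
    frechet_derivative (\<lambda>y. \<omega> (fibre_chart c) y [fib v, fib w]) (at (fib z)) (fib u)"
proof -
  let ?\<omega>' = "frechet_derivative (\<lambda>y. \<omega> (fibre_chart c) y [fib v, fib w]) (at (fib z))"
  let ?D = "\<lambda>u. (- (s * \<mu>\<^sup>2) * exp ((- \<mu>) * tim z) * (tor v $ 1 * tim w - tim v * tor w $ 1) +
     \<mu> * exp (\<mu> * tim z) * (tor v $ 2 * tor w $ 3 - tor v $ 3 * tor w $ 2)) * tim u + ?\<omega>' (fib u)"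
  have "((\<lambda>y. \<omega> (fibre_chart c) y [fib v, fib w]) has_derivative ?\<omega>') (at (fib z))"
    using \<omega>_differentiable[OF chart_domain_cases[OF c z]] unfolding frechet_derivative_works .
  then have \<omega>': "((\<lambda>y. \<omega> (fibre_chart c) (fib y) [fib v, fib w]) has_derivative (\<lambda>u. ?\<omega>' (fib u))) (at z)"
    by (rule has_derivative_compose[OF has_derivative_snd[OF has_derivative_fst[OF has_derivative_ident]]])
  have ex: "((\<lambda>y. exp (a * tim y)) has_derivative (\<lambda>u. a * exp (a * tim z) * tim u)) (at z)" for a
    by (rule has_derivative_eq_rhs[OF has_derivative_exp[OF has_derivative_mult_right[OF has_derivative_snd[OF
              has_derivative_ident]]]]) (simp add: mult_ac)
  have A: "((\<lambda>y. kform s c y [v, w]) has_derivative ?D) (at z)"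
    unfolding kform_def Let_def nth_Cons_0 nth_Cons_Suc One_nat_def
    by (rule has_derivative_eq_rhs[OF has_derivative_add[OF has_derivative_add[OF
            has_derivative_mult_left[OF has_derivative_mult_right[OF ex]] has_derivative_mult_left[OF ex]] \<omega>']])
      (simp add: fun_eq_iff algebra_simps power2_eq_square)
  have B: "frechet_derivative (\<lambda>y. act_on_form (cplx s) (fundamental_form metric (cplx s)) c y [v, w]) (at z) =
      frechet_derivative (\<lambda>y. kform s c y [v, w]) (at z)"
    by (rule frechet_derivative_cong_open[OF open_domain[OF c] z]) (simp add: act_on_fundamental_form[OF c _ s])
  show ?thesis
    unfolding B frechet_derivative_at[OF A, symmetric] ..
qed

lemma sum_lessThan_3: "(\<Sum>i<3. f i) = f 0 + f 1 + f (2::nat)" for f :: "nat \<Rightarrow> real"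
  by (simp add: numeral_3_eq_3 numeral_2_eq_2)

lemma ext_deriv_3: "ext_deriv \<alpha> c x [u, v, w] = frechet_derivative (\<lambda>y. \<alpha> c y [v, w]) (at x) u -
    frechet_derivative (\<lambda>y. \<alpha> c y [u, w]) (at x) v + frechet_derivative (\<lambda>y. \<alpha> c y [u, v]) (at x) w"
proof -
  have "length [u, v, w] = 3"
    by simp
  then show ?thesis
    unfolding ext_deriv_def \<open>length [u, v, w] = 3\<close> sum_lessThan_3 by (simp add: numeral_2_eq_2)
qed

text \<open>The term in dx1 dt is closed, since its coefficient depends on t only, and \<omega> is
  closed by hypothesis. What remains is \<mu> e^(\<mu> t) dt dx2 dx3, written as a determinant in
  which the time component stands in place of the first coordinate.\<close>

lemma ext_deriv_kform:
  assumes c: "c \<in> atlas M" and z: "z \<in> snd c ` fst c" and s: "s * s = 1"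
  shows "ext_deriv (act_on_form (cplx s) (fundamental_form metric (cplx s))) c z [u, v, w] =
    \<mu> * exp (\<mu> * tim z) * vol3 (\<chi> i. if i = 1 then tim u else tor u $ i)
      (\<chi> i. if i = 1 then tim v else tor v $ i) (\<chi> i. if i = 1 then tim w else tor w $ i)"
proof -
  note b = chart_domain_cases[OF c z]
  have "length [fib u, fib v, fib w] = Suc 2"
    by simp
  then have "ext_deriv \<omega> (fibre_chart c) (fib z) [fib u, fib v, fib w] = 0"
    using \<omega> b unfolding closed_form_def field_eq_def by blast
  then show ?thesis
    unfolding ext_deriv_3 frechet_derivative_kform[OF assms] vol3_def
    by (simp add: algebra_simps)
qed

text \<open>The inverse structure replaces the time component by
  \<open>- s / \<mu> * exp ((- \<mu>) * t)\<close> times the first coordinate and rotates the (x2,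
  x3)-plane, which leaves dx2 dx3 unchanged. The exponentials and \<mu> cancel, so only the sign
  \<open>s\<close> distinguishes the two structures.\<close>

lemma dc_fundamental_form:
  assumes c: "c \<in> atlas M" and z: "z \<in> snd c ` fst c" and s: "s * s = 1"
  shows "dc (cplx s) (fundamental_form metric (cplx s)) c z [u, v, w] = s * flux c z [u, v, w]"
proof -
  have "dc (cplx s) (fundamental_form metric (cplx s)) c z [u, v, w] =
    \<mu> * exp (\<mu> * tim z) * vol3 (\<chi> i. if i = 1 then tim (- cplx s c z u) else tor (- cplx s c z u) $ i)
      (\<chi> i. if i = 1 then tim (- cplx s c z v) else tor (- cplx s c z v) $ i)
      (\<chi> i. if i = 1 then tim (- cplx s c z w) else tor (- cplx s c z w) $ i)"
    unfolding dc_def act_on_form_def[of "\<lambda>c x. inv (cplx s c x)"] inv_cplx[OF assms] list.map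
    by (rule ext_deriv_kform[OF assms])
  also have "\<dots> = (exp (\<mu> * tim z) * exp ((- \<mu>) * tim z)) * (s * flux c z [u, v, w])"
    using \<mu> by (simp add: vol3_def flux_def cplx_def field_simps)
  finally show ?thesis
    by (simp only: exp_cancel(1) mult_1)
qed

lemma closed_flux: "closed_form M 3 flux"
  unfolding closed_form_def differential_form_def covariant_tensor_def
proof (intro conjI ballI allI impI)
  show "pullback_eq M M (\<lambda>p. p) 3 flux flux"
    by (rule ident_invariant)
  fix c assume c: "c \<in> atlas M"
  show "multilinear 3 (flux c z)" for z
    by (rule multilinear3I; rule linearI) (simp_all add: flux_def vol3_def algebra_simps)
  show "smooth_on (snd c ` fst c) (\<lambda>z. flux c z vs)" for vs
    unfolding flux_def by (rule smooth_on_const[OF open_domain[OF c]])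
  show "flux c z vs = 0" if "length vs = 3" "i < j" "j < 3" "vs ! i = vs ! j" for z vs i j
  proof -
    have "(i = 0 \<and> j = 1) \<or> (i = 0 \<and> j = 2) \<or> (i = 1 \<and> j = 2)"
      using that by linarith
    then show ?thesis
      using that(4) by (auto simp: flux_def vol3_def algebra_simps)
  qed
next
  show "field_eq M (Suc 3) (ext_deriv flux) (\<lambda>c x vs. 0)"
    unfolding field_eq_def ext_deriv_def flux_def by simp
qed

end

text \<open>The coordinate that makes the complex structure constant. It is not in the one-chart
  atlas of the line but in the maximal atlas, with image the positive half line; the transition maps
  are an exponential and a rescaled logarithm.\<close>

lemma compatible_exp_chart:
  assumes "\<mu> \<noteq> 0"
  shows "compatible_chart euclidean_manifold (UNIV, \<lambda>t :: real. exp (\<mu> * t))"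
proof -
  let ?S = "(UNIV, \<lambda>t :: real. exp (\<mu> * t))"
  have inj: "inj (\<lambda>t. exp (\<mu> * t))"
    using assms by (auto intro!: injI)
  have surj: "range (\<lambda>t. exp (\<mu> * t)) = {0<..}"
  proof (intro equalityI subsetI)
    fix s :: real assume "s \<in> {0<..}"
    then have "s = exp (\<mu> * (ln s / \<mu>))"
      using assms by simp
    then show "s \<in> range (\<lambda>t. exp (\<mu> * t))"
      by blast
  qed auto
  have img: "(\<lambda>t. exp (\<mu> * t)) ` V = {s \<in> {0<..}. ln s / \<mu> \<in> V}" for V
  proof (intro equalityI subsetI)
    fix s assume "s \<in> {s \<in> {0<..}. ln s / \<mu> \<in> V}"
    then have "s = exp (\<mu> * (ln s / \<mu>))" "ln s / \<mu> \<in> V"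
      using assms by auto
    then show "s \<in> (\<lambda>t. exp (\<mu> * t)) ` V"
      by blast
  qed (use assms in auto)
  have cont: "continuous_on {0<..} (\<lambda>s. ln s / \<mu>)"
    by (auto intro!: continuous_intros simp: assms)
  have "is_chart euclidean ?S"
    unfolding is_chart_iff
  proof (intro conjI allI impI)
    show "open (snd ?S ` V)" if "openin euclidean V \<and> V \<subseteq> fst ?S" for V
    proof -
      have "open ({0<..} \<inter> (\<lambda>s. ln s / \<mu>) -` V)"
        using that by (intro continuous_open_preimage[OF cont]) auto
      moreover have "{0<..} \<inter> (\<lambda>s. ln s / \<mu>) -` V = {s \<in> {0<..}. ln s / \<mu> \<in> V}"
        by auto
      ultimately show ?thesis
        by (simp add: img)
    qed
    show "openin euclidean {p \<in> fst ?S. snd ?S p \<in> B}" if "open B" for B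
    proof -
      have "open ((\<lambda>t. exp (\<mu> * t)) -` B)"
        by (intro open_vimage that continuous_intros)
      then show ?thesis
        by (simp add: vimage_def)
    qed
  qed (use inj in auto)
  moreover have "smooth_between (UNIV, \<lambda>x. x) (\<lambda>p. p) ?S"
  proof -
    have "local_rep (UNIV, \<lambda>x. x) (\<lambda>p. p) ?S = (\<lambda>t. exp (\<mu> * t))"
      using inv_into_f_f[of "\<lambda>x :: real. x" UNIV] by (auto simp: local_rep_def)
    then show ?thesis
      by (simp add: smooth_between_def smooth_on_def C_on_exp)
  qed
  moreover have "smooth_between ?S (\<lambda>p. p) (UNIV, \<lambda>x. x)"
  proof -
    have "smooth_on {0<..} (\<lambda>s. inverse \<mu> * ln s)"
      by (rule smooth_on_linear_compose[OF _ bounded_linear_mult_right]) (auto simp: smooth_on_def C_on_ln)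
    moreover have "inverse \<mu> * ln s = local_rep ?S (\<lambda>p. p) (UNIV, \<lambda>x. x) s" if "s \<in> {0<..}" for s
    proof -
      have eq: "\<mu> * (inverse \<mu> * ln s) = ln s"
        using assms by simp
      have "s = exp (\<mu> * (inverse \<mu> * ln s))"
        unfolding eq using that by simp
      then show ?thesis
        using inv_into_f_f[OF inj, of "inverse \<mu> * ln s"] by (simp add: local_rep_def)
    qed
    ultimately have "smooth_on {0<..} (local_rep ?S (\<lambda>p. p) (UNIV, \<lambda>x. x))"
      using smooth_on_cong[of "{0<..}" "\<lambda>s. inverse \<mu> * ln s"] by blast
    then show ?thesis
      by (simp add: smooth_between_def surj)
  qed
  ultimately show ?thesis
    by (simp add: compatible_chart_def atlas_euclidean)
qed

context flat_kaehler_product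
begin

text \<open>Integrability by explicit coordinates: a torus chart, a holomorphic chart of N and the
  exponential chart in time. In their product the structure becomes the constant endomorphism
  \<open>?j\<close>, assembled from the constant \<open>j\<close> of the chart of N and the standard
  rotations of the other two planes.\<close>

lemma complex_structure:
  assumes "s * s = 1"
  shows "complex_structure M (cplx s)"
  unfolding complex_structure_def
proof (intro conjI ballI)
  show "almost_complex_structure M (cplx s)"
    by (rule almost_complex_structure[OF assms])
  fix p assume "p \<in> topspace (mtop M)"
  then obtain x y t where p: "p = ((x, y), t)" "x \<in> topspace (mtop T)" "y \<in> topspace (mtop N)"
    by (cases p) auto
  obtain a where a: "a \<in> atlas T" "x \<in> fst a"
    using smooth_manifold_cover[OF T p(2)] by blast
  obtain b j where b: "compatible_chart N b" "y \<in> fst b" "linear j"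
    and hol: "\<And>c q v. c \<in> atlas N \<Longrightarrow> q \<in> fst c \<inter> fst b \<Longrightarrow>
      chart_deriv c (\<lambda>p. p) b q (J c (snd c q) v) =
      j (chart_deriv c (\<lambda>p. p) b q v)"
    using J p(3) unfolding complex_structure_def by blast
  have bch: "is_chart (mtop N) b"
    using b(1) by (simp add: compatible_chart_def)
  let ?S = "(UNIV :: real set, \<lambda>t :: real. exp (\<mu> * t))"
  let ?ab = "prod_chart a b"
  let ?d = "prod_chart ?ab ?S"
  let ?j = "\<lambda>w :: ((real^3) \<times> 'e) \<times> real. ((vector [- s * tim w, - tor w $ 3, tor w $ 2] :: real^3, j (fib w)), s * tor w $ 1)"
  have S: "compatible_chart euclidean_manifold ?S"
    by (rule compatible_exp_chart[OF \<mu>])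
  have ab: "compatible_chart (product_manifold T N) ?ab"
    by (rule compatible_chart_product[OF T N compatible_chart_atlas[OF T a(1)] b(1)])
  have d: "compatible_chart M ?d"
    by (rule compatible_chart_product[OF TN smooth_manifold_euclidean ab S])
  have "linear ?j"
    by (rule linearI)
      (simp_all add: linear_add[OF b(3)] linear_scale[OF b(3)] vec_eq_iff forall_3 algebra_simps)
  moreover have "chart_deriv c (\<lambda>p. p) ?d q (cplx s c (snd c q) v) =
      ?j (chart_deriv c (\<lambda>p. p) ?d q v)"
    if c: "c \<in> atlas M" and q: "q \<in> fst c \<inter> fst ?d" for c q v
  proof -
    obtain a' b' where ab': "a' \<in> atlas T" "b' \<in> atlas N" "c = total_chart a' b'" "fibre_chart c = b'"
      by (rule chart_cases[OF c])
    obtain x' y' t' where q': "q = ((x', y'), t')"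
      by (metis prod.collapse)
    have in': "x' \<in> fst a'" "y' \<in> fst b'" "x' \<in> fst a" "y' \<in> fst b"
      using q by (auto simp: q' ab'(3) mem_total_chart)
    note ch = smooth_manifold_chart[OF T ab'(1)] smooth_manifold_chart[OF N ab'(2)]
    note idc = continuous_map_id[unfolded id_def]
    have D1: "local_rep (prod_chart a' b') (\<lambda>p. p) ?ab differentiable (at (snd (prod_chart a' b') (x', y')))"
    proof (rule smooth_between_differentiable)
      show "smooth_between (prod_chart a' b') (\<lambda>p. p) ?ab" "is_chart (mtop (product_manifold T N)) ?ab"
        using ab atlas_productI[OF ab'(1,2)] by (auto simp: compatible_chart_def)
      show "is_chart (mtop (product_manifold T N)) (prod_chart a' b')"
        by (rule smooth_manifold_chart[OF TN atlas_productI[OF ab'(1,2)]])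
    qed (use in' in auto)
    have Da: "local_rep a' (\<lambda>p. p) a differentiable (at (snd a' x'))"
      by (rule smooth_between_differentiable[OF smooth_manifold_transition[OF T ab'(1) a(1)] ch(1)
            smooth_manifold_chart[OF T a(1)] idc in'(1,3)])
    have sb: "smooth_between b' (\<lambda>p. p) b"
      using b(1) ab'(2) by (simp add: compatible_chart_def)
    have Db: "local_rep b' (\<lambda>p. p) b differentiable (at (snd b' y'))"
      by (rule smooth_between_differentiable[OF sb ch(2) bch idc in'(2,4)])
    have E: "is_chart euclidean (UNIV, \<lambda>x :: real. x)"
      using smooth_manifold_chart[OF smooth_manifold_euclidean] by (auto simp: atlas_euclidean)
    have rep: "local_rep (UNIV, \<lambda>x. x) (\<lambda>p. p) ?S = (\<lambda>t. exp (\<mu> * t))"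
      using inv_into_f_f[of "\<lambda>x :: real. x" UNIV] by (auto simp: local_rep_def)
    have ex: "((\<lambda>t. exp (\<mu> * t)) has_derivative (\<lambda>\<tau>. \<mu> * exp (\<mu> * t') * \<tau>)) (at t')"
      by (rule has_derivative_eq_rhs[OF has_derivative_exp[OF has_derivative_mult_right[OF has_derivative_ident]]])
        (simp add: mult_ac)
    have Dt: "local_rep (UNIV, \<lambda>x. x) (\<lambda>p. p) ?S differentiable (at (snd (UNIV :: real set, \<lambda>x. x) t'))"
      unfolding rep using ex by (auto simp: differentiable_def)
    let ?B = "chart_deriv b' (\<lambda>p. p) b y'"
    have idp: "map_prod (\<lambda>p. p) (\<lambda>p. p) = (\<lambda>p. p)"
      by (simp add: fun_eq_iff)
    have inner: "frechet_derivative (local_rep (prod_chart a' b') (\<lambda>p. p) ?ab) (at (snd a' x', snd b' y')) =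
        map_prod (\<lambda>v. v) ?B"
      using frechet_derivative_local_rep_prod[OF ch in'(1,2) Da Db, unfolded idp]
      unfolding ext[OF flat[OF ab'(1) a(1) in'(1,3)]] .
    have "frechet_derivative (local_rep c (\<lambda>p. p) ?d) (at (snd (prod_chart a' b') (x', y'), snd (UNIV :: real set, \<lambda>x. x) t')) =
        map_prod (chart_deriv (prod_chart a' b') (\<lambda>p. p) ?ab (x', y'))
          (frechet_derivative (local_rep (UNIV, \<lambda>x. x) (\<lambda>p. p) ?S) (at (snd (UNIV :: real set, \<lambda>x. x) t')))"
      unfolding ab'(3) total_chart_def
      by (rule frechet_derivative_local_rep_prod[OF is_chart_prod[OF ch] E _ _ D1 Dt, unfolded idp])
        (use in' in auto)
    then have D: "chart_deriv c (\<lambda>p. p) ?d q =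
        map_prod (map_prod (\<lambda>v. v) ?B) (\<lambda>\<tau>. \<mu> * exp (\<mu> * t') * \<tau>)"
      unfolding rep by (simp add: inner frechet_derivative_at[OF ex, symmetric] ab'(3) q' snd_total_chart)
    have "?B (J b' (snd b' y') (fib v)) = j (?B (fib v))"
      using hol[OF ab'(2)] in' by blast
    \<comment> \<open>The derivative of the exponential chart cancels the factor that
      \<open>cplx\<close> puts on the time component.\<close>
    moreover have "\<mu> * exp (\<mu> * t') * (s / \<mu> * exp ((- \<mu>) * t') * tor v $ 1) = s * tor v $ 1 * (exp (\<mu> * t') * exp ((- \<mu>) * t'))"
      using \<mu> by simp
    then have "\<mu> * exp (\<mu> * t') * (s / \<mu> * exp ((- \<mu>) * t') * tor v $ 1) = s * tor v $ 1"
      by (simp only: exp_cancel mult_1_right)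
    ultimately show ?thesis
      unfolding D by (simp add: prod_eq_iff vec_eq_iff forall_3 cplx_def ab'(4) ab'(4)[unfolded ab'(3)] ab'(3) q' snd_total_chart)
  qed
  ultimately show "\<exists>d j. compatible_chart M d \<and> p \<in> fst d \<and> linear j \<and>
      (\<forall>c\<in>atlas M. \<forall>q\<in>fst c \<inter> fst d. \<forall>v.
         chart_deriv c (\<lambda>p. p) d q (cplx s c (snd c q) v) =
         j (chart_deriv c (\<lambda>p. p) d q v))"
    using d a(2) b(2) p(1) by (intro exI[of _ ?d] exI[of _ ?j]) auto
qed

text \<open>Since \<open>s * s = 1\<close>, multiplying by \<open>s\<close> makes the right-hand
  side independent of the sign; the values 1 and -1 give the two torsion conditions, with the minus
  sign of the second included.\<close>

lemma dc_field_eq: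
  assumes "s * s = 1"
  shows "field_eq M 3 (\<lambda>c x vs. s * dc (cplx s) (fundamental_form metric (cplx s)) c x vs) flux"
  unfolding field_eq_def
proof (intro ballI allI impI)
  fix c z and vs :: "(((real^3) \<times> 'e) \<times> real) list"
  assume *: "c \<in> atlas M" "z \<in> snd c ` fst c" "length vs = 3"
  obtain u v w where vs: "vs = [u, v, w]"
    using *(3) by (auto simp: numeral_3_eq_3 length_Suc_conv)
  show "s * dc (cplx s) (fundamental_form metric (cplx s)) c z vs = flux c z vs"
    unfolding vs dc_fundamental_form[OF *(1,2) assms] mult.assoc[symmetric] assms by simp
qed

lemma generalized_kaehler: "generalized_kaehler M metric (cplx 1) (cplx (- 1))"
  unfolding generalized_kaehler_def
  using M riemannian_metric complex_structure[of 1] complex_structure[of "-1"] compatible_metric[of 1]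
    compatible_metric[of "-1"] closed_flux dc_field_eq[of 1] dc_field_eq[of "-1"]
  by (intro conjI exI[of _ flux]) simp_all

end

section \<open>Mapping tori\<close>

locale mapping_torus_action =
  fixes A :: "('a, 'e::euclidean_space) manifold" and f :: "'a \<Rightarrow> 'a"
  assumes A: "smooth_manifold A" and f: "diffeomorphism A A f"
begin

abbreviation "X \<equiv> topspace (mtop A)"
abbreviation "f' \<equiv> inv_into X f"
abbreviation "MR \<equiv> product_manifold A (euclidean_manifold :: (real, real) manifold)"
abbreviation "iter \<equiv> int_iterate X f"

definition act :: "int \<Rightarrow> 'a \<times> real \<Rightarrow> 'a \<times> real" where
  "act n = (\<lambda>(x, t). (iter n x, t + of_int n))"

abbreviation "G \<equiv> {(\<lambda>(x, t). (iter n x, t + of_int n)) | n :: int. True}"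

lemma mapping_torus_eq: "mapping_torus A f = quotient_manifold MR G"
  by (simp add: mapping_torus_def)

lemma G_eq: "G = range act"
  by (auto simp: act_def)

lemma act_apply: "act n (x, t) = (iter n x, t + of_int n)"
  by (simp add: act_def)

lemma MR: "smooth_manifold MR"
  by (rule smooth_manifold_product[OF A smooth_manifold_euclidean])

lemma smooth_f: "smooth_map A A f" and smooth_f': "smooth_map A A f'" and bij: "bij_betw f X X"
  using f by (auto simp: diffeomorphism_def)

lemma f_closed: "x \<in> X \<Longrightarrow> f x \<in> X" and f'_closed: "x \<in> X \<Longrightarrow> f' x \<in> X"
  and f_f': "x \<in> X \<Longrightarrow> f (f' x) = x" and f'_f: "x \<in> X \<Longrightarrow> f' (f x) = x"
  using bij_betwE[OF bij] bij_betwE[OF bij_betw_inv_into[OF bij]]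
    bij_betw_inv_into_right[OF bij] bij_betw_inv_into_left[OF bij] by auto

section \<open>Iterates over the integers\<close>

lemma iter_0: "iter 0 x = x"
  by (simp add: int_iterate_def)

lemma iter_closed:
  assumes "x \<in> X"
  shows "iter n x \<in> X"
proof -
  have "(f ^^ m) x \<in> X" "(f' ^^ m) x \<in> X" for m
    by (induction m) (simp_all add: assms f_closed f'_closed)
  then show ?thesis
    by (simp add: int_iterate_def)
qed

lemma iter_succ:
  assumes "x \<in> X"
  shows "iter (n + 1) x = f (iter n x)"
proof (cases "0 \<le> n")
  case True
  then have "nat (n + 1) = Suc (nat n)"
    by linarith
  then show ?thesis
    using True by (simp add: int_iterate_def)
next
  case False
  then have *: "nat (- n) = Suc (nat (- (n + 1)))"
    by linarith
  have "(f' ^^ m) x \<in> X" for m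
    by (induction m) (simp_all add: assms f'_closed)
  then have "f (iter n x) = (f' ^^ nat (- (n + 1))) x"
    using False by (simp add: int_iterate_def * f_f')
  \<comment> \<open>The case n = -1 is separate, because its successor 0 falls into the nonnegative
    branch of \<open>int_iterate\<close>.\<close>
  also have "\<dots> = iter (n + 1) x"
    using False by (cases "n = -1") (simp_all add: int_iterate_def)
  finally show ?thesis
    by simp
qed

lemma iter_pred:
  assumes "x \<in> X"
  shows "iter (n - 1) x = f' (iter n x)"
  using iter_succ[OF assms, of "n - 1"] f'_f[OF iter_closed[OF assms]] by simp

lemma iter_add:
  assumes "x \<in> X"
  shows "iter (m + n) x = iter m (iter n x)"
proof (induction m rule: int_induct[where k = 0])
  case base
  then show ?case
    by (simp add: iter_0)
next
  case (step1 i)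
  then show ?case
    using iter_succ[OF assms, of "i + n"] iter_succ[OF iter_closed[OF assms], of i n] by (simp add: ac_simps)
next
  case (step2 i)
  have "i - 1 + n = i + n - 1"
    by simp
  then show ?case
    using step2 iter_pred[OF assms, of "i + n"] iter_pred[OF iter_closed[OF assms], of i n] by (simp only:)
qed

lemma smooth_up: "smooth_map MR MR (map_prod f (\<lambda>t. t + 1))"
  and smooth_down: "smooth_map MR MR (map_prod f' (\<lambda>t. t + - 1))"
  by (intro smooth_map_product A smooth_manifold_euclidean smooth_f smooth_f' smooth_map_translation)+

text \<open>Reduces statements about the whole action to its generator and the inverse of the
  generator. \<open>cong\<close> is required because consecutive iterates obey the recursion only on
  the underlying set; smoothness is carried along since the chain rule in \<open>up\<close> and
  \<open>down\<close> needs it.\<close>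

lemma act_induct:
  assumes cong: "\<And>h h'. P h \<Longrightarrow> (\<And>p. p \<in> topspace (mtop MR) \<Longrightarrow> h p = h' p) \<Longrightarrow> P h'"
    and base: "P (\<lambda>p. p)"
    and up: "\<And>h. smooth_map MR MR h \<Longrightarrow> P h \<Longrightarrow> P (\<lambda>p. map_prod f (\<lambda>t. t + 1) (h p))"
    and down: "\<And>h. smooth_map MR MR h \<Longrightarrow> P h \<Longrightarrow> P (\<lambda>p. map_prod f' (\<lambda>t. t + - 1) (h p))"
  shows "smooth_map MR MR (act n) \<and> P (act n)"
proof -
  have *: "smooth_map MR MR (act m) \<and> P (act m)"
    if "smooth_map MR MR h" "P h" "\<And>p. p \<in> topspace (mtop MR) \<Longrightarrow> h p = act m p" for h m
    using smooth_map_cong[where F = h and G = "act m", OF MR that(3,1)] cong[OF that(2), of "act m"] that(3) by blast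
  show ?thesis
  proof (induction n rule: int_induct[where k = 0])
    case base
    show ?case
      by (rule *[OF smooth_map_ident[OF MR] assms(2)]) (auto simp: act_def iter_0)
  next
    case (step1 i)
    note h = step1(2)[THEN conjunct1] step1(2)[THEN conjunct2]
    show ?case
      by (rule *[OF smooth_map_compose[OF MR MR MR h(1) smooth_up] up[OF h]]) (auto simp: act_def iter_succ)
  next
    case (step2 i)
    note h = step2(2)[THEN conjunct1] step2(2)[THEN conjunct2]
    show ?case
      by (rule *[OF smooth_map_compose[OF MR MR MR h(1) smooth_down] down[OF h]]) (auto simp: act_def iter_pred)
  qed
qed

lemma smooth_act: "smooth_map MR MR (act n)"
  using act_induct[of "\<lambda>_. True"] by simp

lemma up_down: "p \<in> topspace (mtop MR) \<Longrightarrow> map_prod f (\<lambda>t. t + 1) (map_prod f' (\<lambda>t. t + - 1) p) = p"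
  and down_up: "p \<in> topspace (mtop MR) \<Longrightarrow> map_prod f' (\<lambda>t. t + - 1) (map_prod f (\<lambda>t. t + 1) p) = p"
  by (auto simp: f_f' f'_f)

lemma pullback_eq_act:
  assumes "pullback_eq MR MR (\<lambda>p. p) k T T" "pullback_eq MR MR (map_prod f (\<lambda>t. t + 1)) k T T"
  shows "pullback_eq MR MR (act n) k T T"
proof -
  have down: "pullback_eq MR MR (map_prod f' (\<lambda>t. t + - 1)) k T T"
    by (rule pullback_eq_inverse[OF MR MR smooth_up smooth_down up_down assms(2)])
  show ?thesis
  proof (rule act_induct[THEN conjunct2])
    show "pullback_eq MR MR h' k T T" if "pullback_eq MR MR h k T T" "\<And>p. p \<in> topspace (mtop MR) \<Longrightarrow> h p = h' p" for h h'
      by (rule pullback_eq_cong[OF MR that(2,1)])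
  qed (rule assms(1) pullback_eq_compose[OF MR MR MR _ smooth_up _ assms(2)]
      pullback_eq_compose[OF MR MR MR _ smooth_down _ down]; assumption)+
qed

lemma intertwines_act:
  assumes "intertwines MR MR (\<lambda>p. p) I I" "intertwines MR MR (map_prod f (\<lambda>t. t + 1)) I I"
  shows "intertwines MR MR (act n) I I"
proof -
  have down: "intertwines MR MR (map_prod f' (\<lambda>t. t + - 1)) I I"
    by (rule intertwines_inverse[OF MR MR smooth_up smooth_down down_up up_down assms(2)])
  show ?thesis
  proof (rule act_induct[THEN conjunct2])
    show "intertwines MR MR h' I I" if "intertwines MR MR h I I" "\<And>p. p \<in> topspace (mtop MR) \<Longrightarrow> h p = h' p" for h h'
      by (rule intertwines_cong[OF MR that(2,1)])
  qed (rule assms(1) intertwines_compose[OF MR MR MR _ smooth_up _ assms(2)]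
      intertwines_compose[OF MR MR MR _ smooth_down _ down]; assumption)+
qed

section \<open>Orbits of the integer action and proper discontinuity\<close>

lemma act_add: "p \<in> topspace (mtop MR) \<Longrightarrow> act (m + n) p = act m (act n p)"
  by (auto simp: act_def iter_add)

lemma act_0: "act 0 p = p"
  by (cases p) (simp add: act_apply iter_0)

lemma orbit_act: "orbit (range act) p = range (\<lambda>n. act n p)"
  by (auto simp: orbit_def)

lemma orbit_eq_act:
  assumes "p \<in> topspace (mtop MR)"
  shows "orbit (range act) (act n p) = orbit (range act) p"
proof -
  have "act m (act n p) = act (m + n) p" "act m p = act (m - n) (act n p)" for m
    using act_add[OF assms, of m n] act_add[OF assms, of "m - n" n] by simp_all
  then show ?thesis
    unfolding orbit_act by (metis (no_types, lifting) image_subset_iff rangeI subset_antisym)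
qed

lemma orbit_eqE:
  assumes "orbit (range act) p = orbit (range act) q"
  obtains n where "q = act n p"
proof -
  have "q \<in> orbit (range act) q"
    unfolding orbit_act using act_0[of q] by (metis rangeI)
  then have "q \<in> range (\<lambda>n. act n p)"
    unfolding assms[symmetric] unfolding orbit_act .
  then show ?thesis
    using that by blast
qed

text \<open>The distance from \<open>t - s\<close> to the nearest integer is the smaller of its
  fractional part and the complement of that part to 1.\<close>

lemma integer_translates_separated:
  fixes t s :: real
  assumes "\<And>n :: int. s \<noteq> t + of_int n"
  shows "\<exists>\<epsilon>>0. \<forall>m :: int. 2 * \<epsilon> \<le> \<bar>t + of_int m - s\<bar>"
proof -
  define u where "u = t - s"
  have fr: "0 < frac u" "frac u < 1"
    using assms[of "- \<lfloor>u\<rfloor>"] by (auto simp: u_def frac_gt_0_iff frac_lt_1 Ints_def algebra_simps)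
  have "min (frac u) (1 - frac u) \<le> \<bar>t + of_int m - s\<bar>" for m
  proof -
    have eq: "t + of_int m - s = frac u + of_int (\<lfloor>u\<rfloor> + m)"
      by (simp add: u_def frac_def)
    show ?thesis
    proof (cases "0 \<le> \<lfloor>u\<rfloor> + m")
      case True
      then have "(0 :: real) \<le> of_int (\<lfloor>u\<rfloor> + m)"
        by simp
      then show ?thesis
        unfolding eq using fr by linarith
    next
      case False
      then have "of_int (\<lfloor>u\<rfloor> + m) \<le> (- 1 :: real)"
        by linarith
      then show ?thesis
        unfolding eq using fr by linarith
    qed
  qed
  then show ?thesis
    using fr by (intro exI[of _ "min (frac u) (1 - frac u) / 2"]) auto
qed

text \<open>If the times differ by an integer \<open>n\<close>, the points are separated in the
  manifold, by disjoint neighbourhoods of \<open>iter n x\<close> and \<open>y\<close>; time windows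
  of radius 1/4 guarantee that no iterate other than the n-th can relate them. Otherwise the time
  coordinate alone separates the orbits.\<close>

lemma separated:
  assumes p: "p \<in> topspace (mtop MR)" and q: "q \<in> topspace (mtop MR)"
    and ne: "orbit (range act) p \<noteq> orbit (range act) q"
  shows "\<exists>U V. openin (mtop MR) U \<and> openin (mtop MR) V \<and> p \<in> U \<and> q \<in> V \<and> (\<forall>h\<in>range act. h ` U \<inter> V = {})"
proof -
  have meets: "\<exists>z. z \<in> U \<and> h z \<in> V" if "h ` U \<inter> V \<noteq> {}" for h :: "'a \<times> real \<Rightarrow> 'a \<times> real" and U V
    using that by blast
  obtain x t y s where pq: "p = (x, t)" "q = (y, s)" "x \<in> X" "y \<in> X"
    using p q by (cases p; cases q) auto
  show ?thesis
  proof (cases "\<exists>n :: int. s = t + of_int n")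
    case True
    then obtain n :: int where n: "s = t + of_int n"
      by blast
    have "iter n x \<noteq> y"
      using orbit_eq_act[OF p, of n] ne by (auto simp: pq act_apply n)
    then obtain U V where UV: "openin (mtop A) U" "openin (mtop A) V" "iter n x \<in> U" "y \<in> V" "disjnt U V"
      using A iter_closed[OF pq(3), of n] pq(4) unfolding smooth_manifold_def Hausdorff_space_def by metis
    \<comment> \<open>Continuity of an iterate is read off from the smooth action by restricting it
      to the slice at time 0.\<close>
    have cont: "continuous_map (mtop A) (mtop A) (iter n)"
    proof -
      have "continuous_map (mtop A) (mtop MR) (\<lambda>x. (x, 0))"
        by (simp add: continuous_map_pairwise o_def)
      then have "continuous_map (mtop A) (mtop A) (fst \<circ> (act n \<circ> (\<lambda>x. (x, 0))))"
        using smooth_map_continuous[OF smooth_act[of n]]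
        by (intro continuous_map_compose[where X' = "mtop MR"] continuous_map_compose) (auto simp: continuous_map_fst)
      then show ?thesis
        by (simp add: o_def act_apply)
    qed
    show ?thesis
    proof (intro exI conjI ballI)
      show "openin (mtop MR) ({x \<in> X. iter n x \<in> U} \<times> {t - 1 / 4 <..< t + 1 / 4})"
        using openin_continuous_map_preimage[OF cont UV(1)] by (simp add: openin_prod_Times_iff)
      show "openin (mtop MR) (V \<times> {s - 1 / 4 <..< s + 1 / 4})"
        using UV(2) by (simp add: openin_prod_Times_iff)
      show "h ` ({x \<in> X. iter n x \<in> U} \<times> {t - 1 / 4 <..< t + 1 / 4}) \<inter> V \<times> {s - 1 / 4 <..< s + 1 / 4} = {}"
        if h: "h \<in> range act" for h
      proof (rule ccontr)
        from h obtain m where m: "h = act m"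
          by (rule rangeE)
        assume "h ` ({x \<in> X. iter n x \<in> U} \<times> {t - 1 / 4 <..< t + 1 / 4}) \<inter> V \<times> {s - 1 / 4 <..< s + 1 / 4} \<noteq> {}"
        from meets[OF this] obtain z where z: "z \<in> {x \<in> X. iter n x \<in> U} \<times> {t - 1 / 4 <..< t + 1 / 4}"
            "h z \<in> V \<times> {s - 1 / 4 <..< s + 1 / 4}"
          by (elim exE conjE)
        obtain x' t' where "z = (x', t')"
          by (rule prod.exhaust)
        then have *: "iter n x' \<in> U" "t' \<in> {t - 1 / 4 <..< t + 1 / 4}" "iter m x' \<in> V"
            "t' + of_int m \<in> {s - 1 / 4 <..< s + 1 / 4}"
          using z by (simp_all add: m act_apply)
        have "of_int (m - n) < (1 :: real)" "of_int (m - n) > (- 1 :: real)"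
          using *(2,4) unfolding n greaterThanLessThan_iff of_int_diff by linarith+
        then have "m - n < 1" "- 1 < m - n"
          by simp_all
        then have "m = n"
          by linarith
        then show False
          using *(1,3) UV(5) unfolding disjnt_def by blast
      qed
    qed (use pq UV(3,4) in simp_all)
  next
    case False
    then obtain \<epsilon> where \<epsilon>: "\<epsilon> > 0" "\<And>m :: int. 2 * \<epsilon> \<le> \<bar>t + of_int m - s\<bar>"
      using integer_translates_separated[of s t] by blast
    show ?thesis
    proof (intro exI conjI ballI)
      show "openin (mtop MR) (X \<times> {t - \<epsilon> <..< t + \<epsilon>})" "openin (mtop MR) (X \<times> {s - \<epsilon> <..< s + \<epsilon>})"
        by (simp_all add: openin_prod_Times_iff)
      show "h ` (X \<times> {t - \<epsilon> <..< t + \<epsilon>}) \<inter> X \<times> {s - \<epsilon> <..< s + \<epsilon>} = {}" if h: "h \<in> range act" for h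
      proof (rule ccontr)
        from h obtain m where m: "h = act m"
          by (rule rangeE)
        assume "h ` (X \<times> {t - \<epsilon> <..< t + \<epsilon>}) \<inter> X \<times> {s - \<epsilon> <..< s + \<epsilon>} \<noteq> {}"
        from meets[OF this] obtain z where z: "z \<in> X \<times> {t - \<epsilon> <..< t + \<epsilon>}" "h z \<in> X \<times> {s - \<epsilon> <..< s + \<epsilon>}"
          by (elim exE conjE)
        obtain x' t' where "z = (x', t')"
          by (rule prod.exhaust)
        then have "t' \<in> {t - \<epsilon> <..< t + \<epsilon>}" "t' + of_int m \<in> {s - \<epsilon> <..< s + \<epsilon>}"
          using z by (simp_all add: m act_apply)
        then show False
          using \<epsilon>(2)[of m] unfolding greaterThanLessThan_iff by linarith
      qed
    qed (use pq \<epsilon>(1) in simp_all)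
  qed
qed

text \<open>In a time window of length 1, two points of the same orbit differ by an integer shift of
  absolute value less than 1, hence by none.\<close>

lemma evenly:
  assumes p: "p \<in> topspace (mtop MR)"
  shows "\<exists>W. openin (mtop MR) W \<and> p \<in> W \<and> inj_on (orbit (range act)) W"
proof (intro exI conjI)
  let ?W = "X \<times> {snd p - 1 / 2 <..< snd p + 1 / 2}"
  show "openin (mtop MR) ?W"
    by (simp add: openin_prod_Times_iff)
  show "p \<in> ?W"
    using p by (cases p) auto
  show "inj_on (orbit (range act)) ?W"
  proof (rule inj_onI)
    fix z z' assume z: "z \<in> ?W" "z' \<in> ?W" "orbit (range act) z = orbit (range act) z'"
    obtain n where n: "z' = act n z"
      by (rule orbit_eqE[OF z(3)])
    have "snd z' = snd z + of_int n"
      by (cases z) (simp add: n act_apply)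
    then have "of_int n < (1 :: real)" "of_int n > (- 1 :: real)"
      using z(1,2) by (auto simp: mem_Times_iff)
    then have "n = 0"
      by linarith
    then show "z = z'"
      using n act_0 by simp
  qed
qed

sublocale quot: properly_discontinuous MR G
  unfolding G_eq
proof
  show "smooth_manifold MR"
    by (rule MR)
  show "\<exists>e\<in>range act. \<forall>p\<in>topspace (mtop MR). e p = p"
    by (rule bexI[of _ "act 0"]) (simp_all add: act_0)
  show "\<exists>f\<in>range act. \<forall>p\<in>topspace (mtop MR). f p = g (h p)" if gh: "g \<in> range act" "h \<in> range act" for g h
  proof -
    obtain m n where "g = act m" "h = act n"
      using gh by (elim rangeE)
    then show ?thesis
      using act_add[of _ m n] by (intro bexI[of _ "act (m + n)"]) simp_all
  qed
  show "\<exists>g\<in>range act. \<forall>p\<in>topspace (mtop MR). g (h p) = p" if h: "h \<in> range act" for h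
  proof -
    from h obtain n where n: "h = act n"
      by (rule rangeE)
    have "act (- n) (act n p) = p" if "p \<in> topspace (mtop MR)" for p
      using act_add[OF that, of "- n" n] act_0 by simp
    then show ?thesis
      unfolding n by (intro bexI[of _ "act (- n)"]) simp_all
  qed
  show "smooth_map MR MR h" if "h \<in> range act" for h
    using that by (rule rangeE) (simp add: smooth_act)
qed (rule evenly separated; assumption)+

end

context flat_kaehler_product
begin

text \<open>The Kaehler metric is recovered from the form and the complex structure: k(v, w) =
  -\<omega>(J v, w).\<close>

lemma pullback_metric:
  assumes J: "intertwines N N \<psi> J J" and \<omega>: "pullback_eq N N \<psi> 2 \<omega> \<omega>"
  shows "pullback_eq N N \<psi> 2 k k"
  unfolding pullback_eq_def
proof (intro ballI allI impI)
  fix c d p and vs :: "'e list"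
  assume *: "c \<in> atlas N" "d \<in> atlas N" "p \<in> fst c" "\<psi> p \<in> fst d" "length vs = 2"
  obtain v w where vs: "vs = [v, w]"
    using *(5) by (auto simp: numeral_2_eq_2 length_Suc_conv)
  let ?D = "chart_deriv c \<psi> d p"
  have c: "snd c p \<in> snd c ` fst c" and d: "snd d (\<psi> p) \<in> snd d ` fst d"
    using *(3,4) by auto
  have k: "k b y [v, w] = - \<omega> b y [J b y v, w]" if b: "b \<in> atlas N" "y \<in> snd b ` fst b" for b y v w
    using linear_neg[OF k_linear(1)[OF b], of v] by (simp add: \<omega>_eq[OF b] J_square[OF b])
  have "\<omega> d (snd d (\<psi> p)) [?D (J c (snd c p) v), ?D w] = \<omega> c (snd c p) [J c (snd c p) v, w]"
    using pullback_eqD[OF \<omega> *(1-4), of "[J c (snd c p) v, w]"] by simp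
  then show "k d (snd d (\<psi> p)) (map ?D vs) = k c (snd c p) vs"
    unfolding vs list.map k[OF *(2) d] k[OF *(1) c] intertwinesD[OF J *(1-4)] by simp
qed

end

section \<open>Admissible families of coframes\<close>

text \<open>A frame contains no zero vector: the first vector gives \<open>a1 t \<noteq> 0\<close>,
  the second the positivity of l.\<close>

lemma admissible_coefficients:
  assumes adm: "admissible a1 b2 b3" and t: "t \<in> {0..1}"
  shows "a1 t \<noteq> 0" "0 < l_fun b2 b3 t"
proof -
  have "independent (range (frame a1 b2 b3 t))"
    using assms by (simp add: admissible_def)
  then have "0 \<notin> range (frame a1 b2 b3 t)"
    using dependent_zero by blast
  then have nz: "frame a1 b2 b3 t 1 \<noteq> 0" "frame a1 b2 b3 t 2 \<noteq> 0"
    by (metis rangeI)+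
  show "a1 t \<noteq> 0"
    using nz(1) by (auto simp: frame_def vec_eq_iff forall_3)
  have "b2 t \<noteq> 0 \<or> b3 t \<noteq> 0"
    using nz(2) by (auto simp: frame_def vec_eq_iff forall_3)
  then show "0 < l_fun b2 b3 t"
    by (simp add: l_fun_def sum_power2_gt_zero_iff)
qed

lemma smooth_on_has_vector_derivative:
  assumes "smooth_on {0..1} f" "t \<in> {0..1}"
  shows "(f has_vector_derivative deriv01 f t) (at t within {0..1})"
proof -
  have "C_on (Suc 0) {0..1} f"
    using assms(1) by (simp add: smooth_on_def)
  then show ?thesis
    using assms(2) by (simp add: C_on.simps(2) vector_derivative_works[symmetric])
qed

lemma admissible_reciprocal_derivative:
  assumes adm: "admissible a1 b2 b3" and t: "t \<in> {0..1}"
  shows "((\<lambda>s. 1 / l_fun b2 b3 s) has_real_derivative - (2 * v_fun b2 b3 t / (l_fun b2 b3 t)\<^sup>2)) (at t within {0..1})"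
proof -
  have b: "(b2 has_real_derivative deriv01 b2 t) (at t within {0..1})"
    "(b3 has_real_derivative deriv01 b3 t) (at t within {0..1})"
    using adm t smooth_on_has_vector_derivative unfolding admissible_def has_real_derivative_iff_has_vector_derivative by auto
  have l: "(l_fun b2 b3 has_real_derivative 2 * v_fun b2 b3 t) (at t within {0..1})"
    unfolding l_fun_def[abs_def] v_fun_def by (auto intro!: derivative_eq_intros b)
  show ?thesis
    using admissible_coefficients(2)[OF adm t]
    by (auto intro!: derivative_eq_intros l simp: power2_eq_square)
qed

text \<open>
  Although only the values of \<open>v/l\<close> and \<open>w/l\<close> at the end points are assumed to match, the constancy
  of \<open>(1/l)'/a\<^sub>1\<close> turns this into \<open>a\<^sub>1(1) l(1) = a\<^sub>1(0) l(0)\<close>; since \<open>1/l\<close> is strictly monotone,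
  the gluing map is a proper rescaling.
\<close>

lemma admissible_monodromy:
  assumes adm: "admissible a1 b2 b3" and C: "C \<noteq> 0"
    and const: "\<And>t. t \<in> {0..1} \<Longrightarrow> deriv01 (\<lambda>s. 1 / l_fun b2 b3 s) t * (1 / a1 t) = C"
  shows "0 < a1 1 / a1 0" "a1 1 / a1 0 \<noteq> 1" "l_fun b2 b3 1 / l_fun b2 b3 0 = inverse (a1 1 / a1 0)"
proof -
  note nz = admissible_coefficients[OF adm]
  have der: "deriv01 (\<lambda>s. 1 / l_fun b2 b3 s) t = - (2 * v_fun b2 b3 t / (l_fun b2 b3 t)\<^sup>2)" if "t \<in> {0..1}" for t
    by (rule vector_derivative_within_closed_interval)
      (use that admissible_reciprocal_derivative[OF adm that] in \<open>auto simp: has_real_derivative_iff_has_vector_derivative\<close>)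
  have v: "2 * v_fun b2 b3 t / (l_fun b2 b3 t)\<^sup>2 = - C * a1 t" if "t \<in> {0..1}" for t
  proof -
    have "- (2 * v_fun b2 b3 t / (l_fun b2 b3 t)\<^sup>2) * (1 / a1 t) * a1 t = C * a1 t"
      using const[OF that] unfolding der[OF that] by simp
    then show ?thesis
      using nz(1)[OF that] by simp
  qed
  \<comment> \<open>As the derivative of 1/l is -2v/l^2 and equals C a1, the quotient v/l is
    proportional to a1 l. Equal end values of v/l thus become equal end values of a1 l.\<close>
  have "v_fun b2 b3 t / l_fun b2 b3 t = - C / 2 * (a1 t * l_fun b2 b3 t)" if "t \<in> {0..1}" for t
  proof -
    have "v_fun b2 b3 t / l_fun b2 b3 t = (2 * v_fun b2 b3 t / (l_fun b2 b3 t)\<^sup>2) * l_fun b2 b3 t / 2"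
      using nz(2)[OF that] by (simp add: power2_eq_square)
    then show ?thesis
      unfolding v[OF that] by simp
  qed
  then have "- C / 2 * (a1 1 * l_fun b2 b3 1) = - C / 2 * (a1 0 * l_fun b2 b3 0)"
    using adm unfolding admissible_def by (metis atLeastAtMost_iff order_refl zero_le_one)
  then have al: "a1 1 * l_fun b2 b3 1 = a1 0 * l_fun b2 b3 0"
    using C by simp
  show "l_fun b2 b3 1 / l_fun b2 b3 0 = inverse (a1 1 / a1 0)"
    using al nz[of 0] nz[of 1] by (simp add: field_simps)
  have cont: "continuous_on {0..1} a1"
    using adm unfolding admissible_def smooth_on_def by (metis C_on.simps(1))
  \<comment> \<open>A continuous function without zeros keeps its sign.\<close>
  show "0 < a1 1 / a1 0"
  proof (rule ccontr)
    assume "\<not> 0 < a1 1 / a1 0"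
    then consider "a1 0 \<le> 0" "0 \<le> a1 1" | "a1 1 \<le> 0" "0 \<le> a1 0"
      unfolding not_less divide_le_0_iff by blast
    then obtain \<xi> where "0 \<le> \<xi>" "\<xi> \<le> 1" "a1 \<xi> = 0"
      using IVT'[of a1 0 0 1] IVT2'[of a1 1 0 0] cont by cases auto
    then show False
      using nz(1)[of \<xi>] by auto
  qed
  show "a1 1 / a1 0 \<noteq> 1"
  proof
    assume "a1 1 / a1 0 = 1"
    then have leq: "l_fun b2 b3 1 = l_fun b2 b3 0"
      using al nz(1)[of 0] by (simp add: field_simps)
    \<comment> \<open>If l had equal end values, the mean value theorem would give a zero of the
      derivative of 1/l, which is C a1 and never vanishes.\<close>
    have "\<exists>\<xi>\<in>{0<..<1}. 1 / l_fun b2 b3 1 - 1 / l_fun b2 b3 0 = (- (2 * v_fun b2 b3 \<xi> / (l_fun b2 b3 \<xi>)\<^sup>2)) * (1 - 0)"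
    proof (rule mvt_simple[where f = "\<lambda>s. 1 / l_fun b2 b3 s" and f' = "\<lambda>t. (*) (- (2 * v_fun b2 b3 t / (l_fun b2 b3 t)\<^sup>2))"])
      show "((\<lambda>s. 1 / l_fun b2 b3 s) has_derivative (*) (- (2 * v_fun b2 b3 t / (l_fun b2 b3 t)\<^sup>2))) (at t within {0..1})"
        if "0 \<le> t" "t \<le> 1" for t
        using admissible_reciprocal_derivative[OF adm, of t] that unfolding has_field_derivative_def by simp
    qed simp
    then obtain \<xi> where \<xi>: "\<xi> \<in> {0<..<1}" "2 * v_fun b2 b3 \<xi> / (l_fun b2 b3 \<xi>)\<^sup>2 = 0"
      unfolding leq by auto
    then show False
      using v[of \<xi>] C nz(1)[of \<xi>] by auto
  qed
qed

text \<open>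
  The three coframe equations say that \<open>d\<rho>\<close> is multiplication by \<open>a\<^sub>1(1)/a\<^sub>1(0)\<close> on the first
  coordinate and by the complex number \<open>(b\<^sub>2 + i b\<^sub>3)(1) / (b\<^sub>2 + i b\<^sub>3)(0)\<close> on the other two.
\<close>

lemma coframe_pullback_derivative:
  assumes adm: "admissible a1 b2 b3"
    and pb: "\<forall>i. pullback_eq S S \<rho> 1 (coframe a1 b2 b3 1 i) (coframe a1 b2 b3 0 i)"
    and c: "c \<in> atlas S" "d \<in> atlas S" "p \<in> fst c" "\<rho> p \<in> fst d"
  defines "D \<equiv> chart_deriv c \<rho> d p"
    and "\<alpha> \<equiv> (b2 1 * b2 0 + b3 1 * b3 0) / l_fun b2 b3 0"
    and "\<beta> \<equiv> (b3 1 * b2 0 - b2 1 * b3 0) / l_fun b2 b3 0"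
  shows "D u $ 1 = a1 1 / a1 0 * u $ 1" "D u $ 2 = \<alpha> * u $ 2 - \<beta> * u $ 3" "D u $ 3 = \<beta> * u $ 2 + \<alpha> * u $ 3"
proof -
  note nz = admissible_coefficients[OF adm]
  have co: "coframe a1 b2 b3 1 i d (snd d (\<rho> p)) [D u] = coframe a1 b2 b3 0 i c (snd c p) [u]" for i
    using pullback_eqD[OF pb[rule_format, of i] c, of "[u]"] by (simp add: D_def)
  show "D u $ 1 = a1 1 / a1 0 * u $ 1"
    using co[of 1] nz(1)[of 0] nz(1)[of 1] by (simp add: coframe_def field_simps)
  let ?l0 = "l_fun b2 b3 0" and ?l1 = "l_fun b2 b3 1"
  have e2: "b2 1 / ?l1 * D u $ 2 + b3 1 / ?l1 * D u $ 3 = b2 0 / ?l0 * u $ 2 + b3 0 / ?l0 * u $ 3"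
    using co[of 2] by (simp add: coframe_def Let_def)
  have e3: "- (b3 1 / ?l1) * D u $ 2 + b2 1 / ?l1 * D u $ 3 = - (b3 0 / ?l0) * u $ 2 + b2 0 / ?l0 * u $ 3"
    using co[of 3] by (simp add: coframe_def Let_def)
  \<comment> \<open>The second and third coframe equations are solved for the derivative by
    combining them with coefficients \<open>b2 1\<close> and \<open>b3 1\<close>; the common factor
    that then appears is this one.\<close>
  have l1: "(b2 1 * b2 1 + b3 1 * b3 1) / ?l1 = 1"
  proof -
    have "b2 1 * b2 1 + b3 1 * b3 1 = ?l1"
      by (simp add: l_fun_def power2_eq_square)
    then show ?thesis
      using nz(2)[of 1] by (simp only:) simp
  qed
  have "D u $ 2 = (b2 1 * b2 1 + b3 1 * b3 1) / ?l1 * D u $ 2"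
    unfolding l1 by simp
  also have "\<dots> = b2 1 * (b2 1 / ?l1 * D u $ 2 + b3 1 / ?l1 * D u $ 3) - b3 1 * (- (b3 1 / ?l1) * D u $ 2 + b2 1 / ?l1 * D u $ 3)"
    by (simp add: algebra_simps add_divide_distrib diff_divide_distrib)
  also have "\<dots> = \<alpha> * u $ 2 - \<beta> * u $ 3"
    unfolding e2 e3 \<alpha>_def \<beta>_def by (simp add: algebra_simps add_divide_distrib diff_divide_distrib)
  finally show "D u $ 2 = \<alpha> * u $ 2 - \<beta> * u $ 3" .
  have "D u $ 3 = (b2 1 * b2 1 + b3 1 * b3 1) / ?l1 * D u $ 3"
    unfolding l1 by simp
  also have "\<dots> = b3 1 * (b2 1 / ?l1 * D u $ 2 + b3 1 / ?l1 * D u $ 3) + b2 1 * (- (b3 1 / ?l1) * D u $ 2 + b2 1 / ?l1 * D u $ 3)"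
    by (simp add: algebra_simps add_divide_distrib diff_divide_distrib)
  also have "\<dots> = \<beta> * u $ 2 + \<alpha> * u $ 3"
    unfolding e2 e3 \<alpha>_def \<beta>_def by (simp add: algebra_simps add_divide_distrib diff_divide_distrib)
  finally show "D u $ 3 = \<beta> * u $ 2 + \<alpha> * u $ 3" .
qed

section \<open>The split generalized Kaehler structure on the mapping torus\<close>

theorem theorem3p3:
  fixes \<Gamma>\<^sub>0 :: "(real^3) set"
    and a1 b2 b3 :: "real \<Rightarrow> real"
    and N :: "('n, 'e::euclidean_space) manifold"
    and J :: "('n, 'e) endomorphism_field"
    and k \<omega> :: "('n, 'e) covariant_field"
    and \<rho> :: "(real^3) set \<Rightarrow> (real^3) set"
    and \<psi> :: "'n \<Rightarrow> 'n"
  assumes "kaehler N J k \<omega>"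
    and "compact_space (mtop N)"
    and "is_lattice \<Gamma>\<^sub>0"
    and "admissible a1 b2 b3"
    and "diffeomorphism (torus \<Gamma>\<^sub>0) (torus \<Gamma>\<^sub>0) \<rho>"
    and "\<forall>i. pullback_eq (torus \<Gamma>\<^sub>0) (torus \<Gamma>\<^sub>0) \<rho> 1 (coframe a1 b2 b3 1 i) (coframe a1 b2 b3 0 i)"
    and "\<exists>C. C \<noteq> 0 \<and> (\<forall>t\<in>{0..1}. deriv01 (\<lambda>s. 1 / l_fun b2 b3 s) t * (1 / a1 t) = C)"
    and "diffeomorphism N N \<psi>"
    and "intertwines N N \<psi> J J"
    and "pullback_eq N N \<psi> 2 \<omega> \<omega>"
  shows "\<exists>g I\<^sub>p I\<^sub>m.
    generalized_kaehler (mapping_torus (product_manifold (torus \<Gamma>\<^sub>0) N) (map_prod \<rho> \<psi>)) g I\<^sub>p I\<^sub>m \<and>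
    split_structure (mapping_torus (product_manifold (torus \<Gamma>\<^sub>0) N) (map_prod \<rho> \<psi>)) I\<^sub>p I\<^sub>m"
proof -
  define \<mu> where "\<mu> = ln (a1 1 / a1 0)"
  define \<alpha> where "\<alpha> = (b2 1 * b2 0 + b3 1 * b3 0) / l_fun b2 b3 0"
  define \<beta> where "\<beta> = (b3 1 * b2 0 - b2 1 * b3 0) / l_fun b2 b3 0"
  obtain C where C: "C \<noteq> 0" "\<And>t. t \<in> {0..1} \<Longrightarrow> deriv01 (\<lambda>s. 1 / l_fun b2 b3 s) t * (1 / a1 t) = C"
    using assms(7) by blast
  note r = admissible_monodromy[OF assms(4) C]
  \<comment> \<open>The factor 1 in the exponent is the time shift \<open>r\<close> of the
    invariance lemmas, kept so that the facts match them literally.\<close>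
  have \<mu>: "\<mu> \<noteq> 0" "exp (\<mu> * 1) = a1 1 / a1 0"
    using r(1,2) by (auto simp: \<mu>_def)
  have l0: "0 < l_fun b2 b3 0"
    using admissible_coefficients(2)[OF assms(4), of 0] by simp
  \<comment> \<open>Multiplicativity of the squared modulus: \<alpha> + i \<beta> is the product of
    (b2 + i b3)(1) with the conjugate of (b2 + i b3)(0), divided by l(0).\<close>
  have "\<alpha> * \<alpha> + \<beta> * \<beta> = l_fun b2 b3 1 * l_fun b2 b3 0 / (l_fun b2 b3 0 * l_fun b2 b3 0)"
    unfolding \<alpha>_def \<beta>_def times_divide_times_eq add_divide_distrib[symmetric]
    by (rule arg_cong[where f = "\<lambda>x. x / _"]) (simp add: l_fun_def power2_eq_square algebra_simps)
  also have "\<dots> = exp (- (\<mu> * 1))"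
    using l0 r(3) unfolding exp_minus \<mu>(2) by simp
  finally have norm: "\<alpha> * \<alpha> + \<beta> * \<beta> = exp (- (\<mu> * 1))" .
  interpret P: flat_kaehler_product "torus \<Gamma>\<^sub>0" N J k \<omega> \<mu>
    by unfold_locales
      (use assms(1) \<mu>(1) smooth_manifold_torus[OF assms(3)] frechet_derivative_torus_transition[OF assms(3)] in auto)
  have sm: "smooth_map (torus \<Gamma>\<^sub>0) (torus \<Gamma>\<^sub>0) \<rho>" "smooth_map N N \<psi>"
    using assms(5,8) by (simp_all add: diffeomorphism_def)
  note D = coframe_pullback_derivative[OF assms(4,6), folded \<alpha>_def \<beta>_def \<mu>(2)]
  note inv = sm D norm assms(9) P.pullback_metric[OF assms(9,10)]
  interpret Q: mapping_torus_action "product_manifold (torus \<Gamma>\<^sub>0) N" "map_prod \<rho> \<psi>"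
    by unfold_locales (rule P.TN diffeomorphism_product[OF P.T P.N P.T P.N assms(5,8)])+
  let ?g = "Q.quot.descend P.metric" and ?Ip = "Q.quot.descend (P.cplx 1)" and ?Im = "Q.quot.descend (P.cplx (- 1))"
  have metric: "pullback_eq P.M P.M (Q.act n) 2 P.metric P.metric" for n
    by (rule Q.pullback_eq_act[OF P.ident_invariant(1) P.metric_invariant[OF inv]])
  have cplx: "intertwines P.M P.M (Q.act n) (P.cplx s) (P.cplx s)" for n s
    by (rule Q.intertwines_act[OF P.ident_invariant(2) P.cplx_invariant[OF inv]])
  have flux: "pullback_eq P.M P.M (Q.act n) 3 P.flux P.flux" for n
    by (rule Q.pullback_eq_act[OF P.ident_invariant(3) P.flux_invariant[OF inv]])
  \<comment> \<open>Any form representing the torsion agrees with \<open>flux\<close> on coordinate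
    domains and lists of length 3, so it inherits the invariance of \<open>flux\<close>.\<close>
  have H: "pullback_eq P.M P.M (Q.act n) 3 H H"
    if H: "field_eq P.M 3 (dc (P.cplx 1) (fundamental_form P.metric (P.cplx 1))) H" for n H
    unfolding pullback_eq_def
  proof (intro ballI allI impI)
    fix c d p and vs :: "(((real^3) \<times> 'e) \<times> real) list"
    assume *: "c \<in> atlas P.M" "d \<in> atlas P.M" "p \<in> fst c" "Q.act n p \<in> fst d" "length vs = 3"
    have HF: "H b z us = P.flux b z us" if "b \<in> atlas P.M" "z \<in> snd b ` fst b" "length us = 3" for b z us
    proof -
      have "dc (P.cplx 1) (fundamental_form P.metric (P.cplx 1)) b z us = H b z us"
        using H that unfolding field_eq_def by blast
      moreover have "1 * dc (P.cplx 1) (fundamental_form P.metric (P.cplx 1)) b z us = P.flux b z us"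
        using P.dc_field_eq[of 1, OF mult_1] that unfolding field_eq_def by blast
      ultimately show ?thesis
        by simp
    qed
    show "H d (snd d (Q.act n p)) (map (chart_deriv c (Q.act n) d p) vs) = H c (snd c p) vs"
      using pullback_eqD[OF flux *] *(3-5) by (simp add: HF[OF *(1)] HF[OF *(2)])
  qed
  have "generalized_kaehler Q.quot.Q ?g ?Ip ?Im"
  proof (rule Q.quot.generalized_kaehler_descend[OF P.generalized_kaehler])
    fix h :: "((real^3) set \<times> 'n) \<times> real \<Rightarrow> ((real^3) set \<times> 'n) \<times> real"
    assume "h \<in> Q.G"
    then obtain n where n: "h = Q.act n"
      unfolding Q.G_eq by (rule rangeE)
    show "pullback_eq P.M P.M h 2 P.metric P.metric" "intertwines P.M P.M h (P.cplx 1) (P.cplx 1)"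
      "intertwines P.M P.M h (P.cplx (- 1)) (P.cplx (- 1))"
      unfolding n by (rule metric cplx)+
    show "pullback_eq P.M P.M h 3 H H"
      if "field_eq P.M 3 (dc (P.cplx 1) (fundamental_form P.metric (P.cplx 1))) H" for H
      unfolding n by (rule H[OF that])
  qed
  moreover have "split_structure Q.quot.Q ?Ip ?Im"
    by (rule Q.quot.split_structure_descend[OF P.split_structure])
  ultimately show ?thesis
    unfolding Q.mapping_torus_eq by blast
qed

end
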